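(* Let $\mathbf{k}$ be a field and let $(M,\prec,\succ,\bullet)$ be an NS algebra over $\mathbf{k}$. Let $T(M)=\bigoplus_{n\ge1}M^{\otimes n}$ be the reduced tensor algebra, let $(F_N(T(M)),\diamond,P)$ be the free Nijenhuis algebra on the algebra $T(M)$ constructed in the context (with $P=N_{T(M)}$), and let $i_M:M\hookrightarrow T(M)\xrightarrow{\,j_{T(M)}\,}F_N(T(M))$ be the natural injection. Let $J_M$ be the Nijenhuis ideal of $F_N(T(M))$ generated by the set $$\big\{\,x\prec y-x\diamond P(y),\quad x\succ y-P(x)\diamond y,\quad x\bullet y+P(x\otimes y)\ \big|\ x,y\in M\,\big\},$$ where elements of $M$ and of $T(M)$ are regarded as elements of $F_N(T(M))$ via $i_M$ and $j_{T(M)}$. Let $\pi:F_N(T(M))\to F_N(T(M))/J_M$ be the quotient map and $\rho:=\pi\circ i_M$. Then the quotient Nijenhuis algebra $F_N(T(M))/J_M$, together with $\rho$, is the universal enveloping Nijenhuis algebra of $M$. That is, $\rho:M\to F_N(T(M))/J_M$ is a homomorphism of NS algebras and, for every Nijenhuis algebra $(N,Q)$ and every homomorphism of NS algebras $f:M\to(N,\prec_Q,\succ_Q,\bullet_Q)$, there is a unique Nijenhuis algebra homomorphism $\check f:F_N(T(M))/J_M\to N$ such that $\check f\circ\rho=f$.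
   Context: All algebras are over a field $\mathbf{k}$ and are nonunitary (not necessarily unital) associative. A Nijenhuis algebra is an algebra $N$ with a $\mathbf{k}$-linear endomorphism $P:N\to N$ satisfying $P(x)P(y)=P(P(x)y)+P(xP(y))-P^2(xy)$ for all $x,y\in N$. A Nijenhuis algebra homomorphism is an algebra homomorphism commuting with the operators. A Nijenhuis ideal is a two-sided ideal $J$ with $P(J)\subseteq J$; the quotient by it is again a Nijenhuis algebra. An NS algebra is a $\mathbf{k}$-vector space $M$ with three binary (bilinear) operations $\prec,\succ,\bullet$ such that, with $\star=\prec+\succ+\bullet$, for all $x,y,z\in M$: $(x\prec y)\prec z=x\prec(y\star z)$; $(x\succ y)\prec z=x\succ(y\prec z)$; $(x\star y)\succ z=x\succ(y\succ z)$; $(x\star y)\bullet z+(x\bullet y)\prec z=x\succ(y\bullet z)+x\bullet(y\star z)$. Homomorphisms of NS algebras are linear maps preserving the three operations. Every Nijenhuis algebra $(N,Q)$ is an NS algebra $(N,\prec_Q,\succ_Q,\bullet_Q)$ (a known fact) with $x\prec_Q y=xQ(y)$, $x\succ_Q y=Q(x)y$, $x\bullet_Q y=-Q(xy)$; a Nijenhuis algebra is regarded as an NS algebra in this way. Construction of $F_N(A)$ for an algebra $A$ with $\mathbf{k}$-basis $X$ (applied here to $A=T(M)$ with a chosen basis). Bracketed words. Let $\lfloor,\rfloor$ be two symbols not in $X$, and let $M(X')$ be the free semigroup on $X'=X\cup\{\lfloor,\rfloor\}$. For subsets $Y,Z\subseteq M(X')$ let $\lfloor Z\rfloor=\{\lfloor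 z\rfloor: z\in Z\}$ and $$\Lambda(Y,Z)=\Big(\bigcup_{r\ge1}(Y\lfloor Z\rfloor)^r\Big)\cup\Big(\bigcup_{r\ge0}(Y\lfloor Z\rfloor)^rY\Big)\cup\Big(\bigcup_{r\ge1}(\lfloor Z\rfloor Y)^r\Big)\cup\Big(\bigcup_{r\ge0}(\lfloor Z\rfloor Y)^r\lfloor Z\rfloor\Big).$$ Set $\mathfrak{X}_0=X$, $\mathfrak{X}_{n+1}=\Lambda(X,\mathfrak{X}_n)$ for $n\ge0$; these are increasing, and $\mathfrak{X}_\infty=\bigcup_{n\ge0}\mathfrak{X}_n$. Every $\mathbf{x}\in\mathfrak{X}_\infty$ has a unique standard decomposition $\mathbf{x}=\mathbf{x}_1\cdots\mathbf{x}_b$ in which the $\mathbf{x}_i$ lie alternately in $X$ and in $\lfloor\mathfrak{X}_\infty\rfloor$; $b$ is the breadth of $\mathbf{x}$. The depth $d(\mathbf{x})$ is the smallest $n$ with $\mathbf{x}\in\mathfrak{X}_n$. Put $F_N(A)=\bigoplus_{\mathbf{x}\in\mathfrak{X}_\infty}\mathbf{k}\,\mathbf{x}$; identify $A=\bigoplus_{x\in X}\mathbf{k}x$ with a subspace of $F_N(A)$. Product. The bilinear product $\diamond$ on $F_N(A)$ is defined on basis words $\mathbf{x},\mathbf{x}'\in\mathfrak{X}_\infty$ by recursion on $d(\mathbf{x})+d(\mathbf{x}')$. If both have breadth one: - if $\mathbf{x},\mathbf{x}'\in X$, then $\mathbf{x}\diamond\mathbf{x}'$ is the product of $\mathbf{x}$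 and $\mathbf{x}'$ in $A\subseteq F_N(A)$; - if exactly one of $\mathbf{x},\mathbf{x}'$ is in $X$ and the other in $\lfloor\mathfrak{X}_\infty\rfloor$, then $\mathbf{x}\diamond\mathbf{x}'=\mathbf{x}\mathbf{x}'$ (concatenation); - if $\mathbf{x}=\lfloor\bar{\mathbf{x}}\rfloor$ and $\mathbf{x}'=\lfloor\bar{\mathbf{x}}'\rfloor$, then $\mathbf{x}\diamond\mathbf{x}'=\lfloor\lfloor\bar{\mathbf{x}}\rfloor\diamond\bar{\mathbf{x}}'\rfloor+\lfloor\bar{\mathbf{x}}\diamond\lfloor\bar{\mathbf{x}}'\rfloor\rfloor-\lfloor\lfloor\bar{\mathbf{x}}\diamond\bar{\mathbf{x}}'\rfloor\rfloor$, where $\lfloor\cdot\rfloor$ is extended linearly. In general, for standard decompositions $\mathbf{x}=\mathbf{x}_1\cdots\mathbf{x}_b$ and $\mathbf{x}'=\mathbf{x}'_1\cdots\mathbf{x}'_{b'}$, set $\mathbf{x}\diamond\mathbf{x}'=\mathbf{x}_1\cdots\mathbf{x}_{b-1}(\mathbf{x}_b\diamond\mathbf{x}'_1)\mathbf{x}'_2\cdots\mathbf{x}'_{b'}$, with $\mathbf{x}_b\diamond\mathbf{x}'_1$ as just defined and the rest being (linearly extended) concatenation. Operator and embedding. $N_A:F_N(A)\to F_N(A)$ is the linear map with $N_A(\mathbf{x})=\lfloor\mathbf{x}\rfloor$ for $\mathbf{x}\in\mathfrak{X}_\infty$. $j_A:A\to F_N(A)$ is the linear extension of the inclusion $X\hookrightarrow\mathfrak{X}_\infty$.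 With these data $(F_N(A),\diamond,N_A,j_A)$ is the free Nijenhuis algebra on the algebra $A$: every algebra homomorphism from $A$ to a Nijenhuis algebra factors uniquely through $j_A$ by a Nijenhuis algebra homomorphism. *)

theory Defs
  imports HOL.Hull "HOL-Algebra.Module" "HOL-Algebra.QuotRing"
begin

section \<open>Nonunital algebras, NS algebras and Nijenhuis algebras\<close>

text \<open>
  Vector spaces over a field \<open>K\<close> are modules \<open>module K V\<close> in the sense of the library.  The record
  type \<open>module\<close> also has the fields \<open>mult\<close> and \<open>one\<close>: \<open>one\<close> is never used below, and \<open>mult\<close> is used
  only where the vector space carries an algebra structure.  Unused fields are left \<open>undefined\<close>.
\<close>

definition linear_map ::
  "('k, 'y) ring_scheme \<Rightarrow> ('k, 'a, 'z) module_scheme \<Rightarrow> ('k, 'b, 'w) module_scheme \<Rightarrow> ('a \<Rightarrow> 'b) \<Rightarrow> bool"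
  where "linear_map K V W f \<longleftrightarrow>
    f \<in> carrier V \<rightarrow> carrier W \<and>
    (\<forall>x\<in>carrier V. \<forall>y\<in>carrier V. f (x \<oplus>\<^bsub>V\<^esub> y) = f x \<oplus>\<^bsub>W\<^esub> f y) \<and>
    (\<forall>c\<in>carrier K. \<forall>x\<in>carrier V. f (c \<odot>\<^bsub>V\<^esub> x) = c \<odot>\<^bsub>W\<^esub> f x)"

definition bilinear_op ::
  "('k, 'y) ring_scheme \<Rightarrow> ('k, 'a, 'z) module_scheme \<Rightarrow> ('a \<Rightarrow> 'a \<Rightarrow> 'a) \<Rightarrow> bool"
  where "bilinear_op K V f \<longleftrightarrow>
    (\<forall>x\<in>carrier V. linear_map K V V (f x)) \<and>
    (\<forall>y\<in>carrier V. linear_map K V V (\<lambda>x. f x y))"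

locale nonunital_algebra = module K A
  for K :: "('k, 'y) ring_scheme" (structure) and A :: "('k, 'a, 'z) module_scheme" (structure) +
  assumes mult_bilinear: "bilinear_op K A (\<otimes>\<^bsub>A\<^esub>)"
    and mult_assoc:
      "\<lbrakk>x \<in> carrier A; y \<in> carrier A; z \<in> carrier A\<rbrakk> \<Longrightarrow>
        (x \<otimes>\<^bsub>A\<^esub> y) \<otimes>\<^bsub>A\<^esub> z = x \<otimes>\<^bsub>A\<^esub> (y \<otimes>\<^bsub>A\<^esub> z)"

locale nijenhuis_algebra = nonunital_algebra K A
  for K :: "('k, 'y) ring_scheme" (structure) and A :: "('k, 'a, 'z) module_scheme" (structure) +
  fixes P :: "'a \<Rightarrow> 'a"
  assumes op_linear: "linear_map K A A P"
    and nijenhuis: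
      "\<lbrakk>x \<in> carrier A; y \<in> carrier A\<rbrakk> \<Longrightarrow>
        P x \<otimes>\<^bsub>A\<^esub> P y = P (P x \<otimes>\<^bsub>A\<^esub> y) \<oplus>\<^bsub>A\<^esub> P (x \<otimes>\<^bsub>A\<^esub> P y) \<ominus>\<^bsub>A\<^esub> P (P (x \<otimes>\<^bsub>A\<^esub> y))"

definition nijenhuis_hom ::
  "('k, 'y) ring_scheme \<Rightarrow> ('k, 'a, 'z) module_scheme \<Rightarrow> ('a \<Rightarrow> 'a) \<Rightarrow>
    ('k, 'b, 'w) module_scheme \<Rightarrow> ('b \<Rightarrow> 'b) \<Rightarrow> ('a \<Rightarrow> 'b) \<Rightarrow> bool"
  where "nijenhuis_hom K A P B Q g \<longleftrightarrow>
    linear_map K A B g \<and>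
    (\<forall>x\<in>carrier A. \<forall>y\<in>carrier A. g (x \<otimes>\<^bsub>A\<^esub> y) = g x \<otimes>\<^bsub>B\<^esub> g y) \<and>
    (\<forall>x\<in>carrier A. g (P x) = Q (g x))"

definition nijenhuis_ideal ::
  "('k, 'y) ring_scheme \<Rightarrow> ('k, 'a, 'z) module_scheme \<Rightarrow> ('a \<Rightarrow> 'a) \<Rightarrow> 'a set \<Rightarrow> bool"
  where "nijenhuis_ideal K A P J \<longleftrightarrow>
    submodule J K A \<and>
    (\<forall>a\<in>carrier A. \<forall>x\<in>J. a \<otimes>\<^bsub>A\<^esub> x \<in> J \<and> x \<otimes>\<^bsub>A\<^esub> a \<in> J) \<and>
    P ` J \<subseteq> J"

text \<open>\<open>lop\<close>, \<open>rop\<close> and \<open>bop\<close> stand for \<open>\<prec>\<close>, \<open>\<succ>\<close> and \<open>\<bullet>\<close>.\<close>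

definition ns_star ::
  "('k, 'a, 'z) module_scheme \<Rightarrow> ('a \<Rightarrow> 'a \<Rightarrow> 'a) \<Rightarrow> ('a \<Rightarrow> 'a \<Rightarrow> 'a) \<Rightarrow> ('a \<Rightarrow> 'a \<Rightarrow> 'a) \<Rightarrow> 'a \<Rightarrow> 'a \<Rightarrow> 'a"
  where "ns_star M lop rop bop x y = lop x y \<oplus>\<^bsub>M\<^esub> rop x y \<oplus>\<^bsub>M\<^esub> bop x y"

locale ns_algebra = module K M
  for K :: "('k, 'y) ring_scheme" (structure) and M :: "('k, 'a, 'z) module_scheme" (structure) +
  fixes lop :: "'a \<Rightarrow> 'a \<Rightarrow> 'a" and rop :: "'a \<Rightarrow> 'a \<Rightarrow> 'a" and bop :: "'a \<Rightarrow> 'a \<Rightarrow> 'a"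
  assumes lop_bilinear: "bilinear_op K M lop"
    and rop_bilinear: "bilinear_op K M rop"
    and bop_bilinear: "bilinear_op K M bop"
    and ns1: "\<lbrakk>x \<in> carrier M; y \<in> carrier M; z \<in> carrier M\<rbrakk> \<Longrightarrow>
        lop (lop x y) z = lop x (ns_star M lop rop bop y z)"
    and ns2: "\<lbrakk>x \<in> carrier M; y \<in> carrier M; z \<in> carrier M\<rbrakk> \<Longrightarrow>
        lop (rop x y) z = rop x (lop y z)"
    and ns3: "\<lbrakk>x \<in> carrier M; y \<in> carrier M; z \<in> carrier M\<rbrakk> \<Longrightarrow>
        rop (ns_star M lop rop bop x y) z = rop x (rop y z)"
    and ns4: "\<lbrakk>x \<in> carrier M; y \<in> carrier M; z \<in> carrier M\<rbrakk> \<Longrightarrow>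
        bop (ns_star M lop rop bop x y) z \<oplus>\<^bsub>M\<^esub> lop (bop x y) z =
        rop x (bop y z) \<oplus>\<^bsub>M\<^esub> bop x (ns_star M lop rop bop y z)"

definition ns_hom ::
  "('k, 'y) ring_scheme \<Rightarrow>
    ('k, 'a, 'z) module_scheme \<Rightarrow> ('a \<Rightarrow> 'a \<Rightarrow> 'a) \<Rightarrow> ('a \<Rightarrow> 'a \<Rightarrow> 'a) \<Rightarrow> ('a \<Rightarrow> 'a \<Rightarrow> 'a) \<Rightarrow>
    ('k, 'b, 'w) module_scheme \<Rightarrow> ('b \<Rightarrow> 'b \<Rightarrow> 'b) \<Rightarrow> ('b \<Rightarrow> 'b \<Rightarrow> 'b) \<Rightarrow> ('b \<Rightarrow> 'b \<Rightarrow> 'b) \<Rightarrow>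
    ('a \<Rightarrow> 'b) \<Rightarrow> bool"
  where "ns_hom K M lop rop bop M' lop' rop' bop' f \<longleftrightarrow>
    linear_map K M M' f \<and>
    (\<forall>x\<in>carrier M. \<forall>y\<in>carrier M.
      f (lop x y) = lop' (f x) (f y) \<and>
      f (rop x y) = rop' (f x) (f y) \<and>
      f (bop x y) = bop' (f x) (f y))"

definition nij_lop :: "('k, 'a, 'z) module_scheme \<Rightarrow> ('a \<Rightarrow> 'a) \<Rightarrow> 'a \<Rightarrow> 'a \<Rightarrow> 'a"
  where "nij_lop N Q x y = x \<otimes>\<^bsub>N\<^esub> Q y"

definition nij_rop :: "('k, 'a, 'z) module_scheme \<Rightarrow> ('a \<Rightarrow> 'a) \<Rightarrow> 'a \<Rightarrow> 'a \<Rightarrow> 'a"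
  where "nij_rop N Q x y = Q x \<otimes>\<^bsub>N\<^esub> y"

definition nij_bop :: "('k, 'a, 'z) module_scheme \<Rightarrow> ('a \<Rightarrow> 'a) \<Rightarrow> 'a \<Rightarrow> 'a \<Rightarrow> 'a"
  where "nij_bop N Q x y = \<ominus>\<^bsub>N\<^esub> Q (x \<otimes>\<^bsub>N\<^esub> y)"


section \<open>Free modules, bases, direct sums and quotients\<close>

definition free_mod :: "('k, 'y) ring_scheme \<Rightarrow> 'w set \<Rightarrow> ('k, 'w \<Rightarrow> 'k) module"
  where "free_mod K S =
    \<lparr>carrier = {p. (\<forall>w. p w \<in> carrier K) \<and> (\<forall>w. w \<notin> S \<longrightarrow> p w = \<zero>\<^bsub>K\<^esub>) \<and> finite {w. p w \<noteq> \<zero>\<^bsub>K\<^esub>}},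
     mult = undefined, one = undefined,
     zero = (\<lambda>w. \<zero>\<^bsub>K\<^esub>),
     add = (\<lambda>p q w. p w \<oplus>\<^bsub>K\<^esub> q w),
     smult = (\<lambda>c p w. c \<otimes>\<^bsub>K\<^esub> p w)\<rparr>"

definition delta :: "('k, 'y) ring_scheme \<Rightarrow> 'w \<Rightarrow> 'w \<Rightarrow> 'k"
  where "delta K w = (\<lambda>v. if v = w then \<one>\<^bsub>K\<^esub> else \<zero>\<^bsub>K\<^esub>)"

text \<open>\<open>lin_ext K V g\<close> is the linear extension to a free module of \<open>g\<close>, given on basis elements.\<close>

definition lin_ext ::
  "('k, 'y) ring_scheme \<Rightarrow> ('k, 'a, 'z) module_scheme \<Rightarrow> ('w \<Rightarrow> 'a) \<Rightarrow> ('w \<Rightarrow> 'k) \<Rightarrow> 'a"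
  where "lin_ext K V g p = finsum V (\<lambda>w. p w \<odot>\<^bsub>V\<^esub> g w) {w. p w \<noteq> \<zero>\<^bsub>K\<^esub>}"

definition is_basis :: "('k, 'y) ring_scheme \<Rightarrow> ('k, 'a, 'z) module_scheme \<Rightarrow> 'a set \<Rightarrow> bool"
  where "is_basis K V X \<longleftrightarrow>
    X \<subseteq> carrier V \<and>
    (\<forall>v\<in>carrier V. \<exists>p\<in>carrier (free_mod K X). lin_ext K V (\<lambda>x. x) p = v) \<and>
    (\<forall>p\<in>carrier (free_mod K X). lin_ext K V (\<lambda>x. x) p = \<zero>\<^bsub>V\<^esub> \<longrightarrow> p = \<zero>\<^bsub>free_mod K X\<^esub>)"

definition coords ::
  "('k, 'y) ring_scheme \<Rightarrow> ('k, 'a, 'z) module_scheme \<Rightarrow> 'a set \<Rightarrow> 'a \<Rightarrow> 'a \<Rightarrow> 'k"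
  where "coords K V X v = (THE p. p \<in> carrier (free_mod K X) \<and> lin_ext K V (\<lambda>x. x) p = v)"

definition direct_sum :: "'i set \<Rightarrow> ('i \<Rightarrow> ('k, 'a) module) \<Rightarrow> ('k, 'i \<Rightarrow> 'a) module"
  where "direct_sum I V =
    \<lparr>carrier = {t \<in> (\<Pi>\<^sub>E i\<in>I. carrier (V i)). finite {i\<in>I. t i \<noteq> \<zero>\<^bsub>V i\<^esub>}},
     mult = undefined, one = undefined,
     zero = (\<lambda>i\<in>I. \<zero>\<^bsub>V i\<^esub>),
     add = (\<lambda>s t. \<lambda>i\<in>I. s i \<oplus>\<^bsub>V i\<^esub> t i),
     smult = (\<lambda>c t. \<lambda>i\<in>I. c \<odot>\<^bsub>V i\<^esub> t i)\<rparr>"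

text \<open>
  The quotient by a subspace or an ideal: cosets as in the library's factor rings.  An operation on
  cosets is the union of the cosets of the results on representatives, as in \<open>rcoset_mult\<close>.
\<close>

definition quot_alg :: "('k, 'a, 'z) module_scheme \<Rightarrow> 'a set \<Rightarrow> ('k, 'a set) module"
  where "quot_alg A J =
    \<lparr>carrier = a_rcosets\<^bsub>A\<^esub> J, mult = rcoset_mult A J, one = undefined, zero = J, add = set_add A,
     smult = (\<lambda>c S. \<Union>a\<in>S. J +>\<^bsub>A\<^esub> (c \<odot>\<^bsub>A\<^esub> a))\<rparr>"

definition quot_op :: "('k, 'a, 'z) module_scheme \<Rightarrow> 'a set \<Rightarrow> ('a \<Rightarrow> 'a) \<Rightarrow> 'a set \<Rightarrow> 'a set"
  where "quot_op A J P S = (\<Union>a\<in>S. J +>\<^bsub>A\<^esub> P a)"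


section \<open>The reduced tensor algebra\<close>

text \<open>
  The tensor power of degree \<open>n\<close> is the free vector space on the set of \<open>n\<close>-tuples of vectors modulo
  the relations of multilinearity.
\<close>

definition tuples :: "('k, 'a, 'z) module_scheme \<Rightarrow> nat \<Rightarrow> 'a list set"
  where "tuples M n = {xs. length xs = n \<and> set xs \<subseteq> carrier M}"

abbreviation free_tuples ::
  "('k, 'y) ring_scheme \<Rightarrow> ('k, 'a, 'z) module_scheme \<Rightarrow> nat \<Rightarrow> ('k, 'a list \<Rightarrow> 'k) module"
  where "free_tuples K M n \<equiv> free_mod K (tuples M n)"

definition multilin_gens ::
  "('k, 'y) ring_scheme \<Rightarrow> ('k, 'a, 'z) module_scheme \<Rightarrow> nat \<Rightarrow> ('a list \<Rightarrow> 'k) set"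
  where "multilin_gens K M n =
    {delta K (us @ [x \<oplus>\<^bsub>M\<^esub> y] @ vs) \<ominus>\<^bsub>free_tuples K M n\<^esub>
       (delta K (us @ [x] @ vs) \<oplus>\<^bsub>free_tuples K M n\<^esub> delta K (us @ [y] @ vs)) | us vs x y.
       x \<in> carrier M \<and> y \<in> carrier M \<and> set us \<subseteq> carrier M \<and> set vs \<subseteq> carrier M \<and>
       length us + 1 + length vs = n} \<union>
    {delta K (us @ [c \<odot>\<^bsub>M\<^esub> x] @ vs) \<ominus>\<^bsub>free_tuples K M n\<^esub>
       (c \<odot>\<^bsub>free_tuples K M n\<^esub> delta K (us @ [x] @ vs)) | us vs c x.
       c \<in> carrier K \<and> x \<in> carrier M \<and> set us \<subseteq> carrier M \<and> set vs \<subseteq> carrier M \<and>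
       length us + 1 + length vs = n}"

definition multilin_rel ::
  "('k, 'y) ring_scheme \<Rightarrow> ('k, 'a, 'z) module_scheme \<Rightarrow> nat \<Rightarrow> ('a list \<Rightarrow> 'k) set"
  where "multilin_rel K M n = (\<lambda>H. submodule H K (free_tuples K M n)) hull multilin_gens K M n"

definition tensor_power ::
  "('k, 'y) ring_scheme \<Rightarrow> ('k, 'a, 'z) module_scheme \<Rightarrow> nat \<Rightarrow> ('k, ('a list \<Rightarrow> 'k) set) module"
  where "tensor_power K M n = quot_alg (free_tuples K M n) (multilin_rel K M n)"

text \<open>
  The product of homogeneous tensors \<open>S\<close> and \<open>T\<close> whose degrees add up to \<open>n\<close> is induced by the
  concatenation of tuples, extended bilinearly.
\<close>

definition tensor_mult ::
  "('k, 'y) ring_scheme \<Rightarrow> ('k, 'a, 'z) module_scheme \<Rightarrow> nat \<Rightarrow>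
    ('a list \<Rightarrow> 'k) set \<Rightarrow> ('a list \<Rightarrow> 'k) set \<Rightarrow> ('a list \<Rightarrow> 'k) set"
  where "tensor_mult K M n S T =
    (\<Union>p\<in>S. \<Union>q\<in>T. multilin_rel K M n +>\<^bsub>free_tuples K M n\<^esub>
       lin_ext K (free_tuples K M n)
         (\<lambda>us. lin_ext K (free_tuples K M n) (\<lambda>vs. delta K (us @ vs)) q) p)"

definition tensor_algebra ::
  "('k, 'y) ring_scheme \<Rightarrow> ('k, 'a, 'z) module_scheme \<Rightarrow> ('k, nat \<Rightarrow> ('a list \<Rightarrow> 'k) set) module"
  where "tensor_algebra K M =
    (direct_sum {1..} (tensor_power K M))
      \<lparr>mult := (\<lambda>s t. \<lambda>n\<in>{1..}.
         finsum (tensor_power K M n) (\<lambda>i. tensor_mult K M n (s i) (t (n - i))) {1..<n})\<rparr>"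

text \<open>\<open>pure_tensor K M [x\<^sub>1, \<dots>, x\<^sub>n]\<close> is \<open>x\<^sub>1 \<otimes> \<dots> \<otimes> x\<^sub>n\<close>; for \<open>n = 1\<close> this is the inclusion of \<open>M\<close>.\<close>

definition pure_tensor ::
  "('k, 'y) ring_scheme \<Rightarrow> ('k, 'a, 'z) module_scheme \<Rightarrow> 'a list \<Rightarrow> nat \<Rightarrow> ('a list \<Rightarrow> 'k) set"
  where "pure_tensor K M xs =
    (\<lambda>n\<in>{1..}. if n = length xs
       then multilin_rel K M n +>\<^bsub>free_tuples K M n\<^esub> delta K xs
       else \<zero>\<^bsub>tensor_power K M n\<^esub>)"


section \<open>The free Nijenhuis algebra on an algebra with a basis\<close>

text \<open>
  A bracketed word is a list of letters, a letter being a generator or a bracketed word enclosed in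
  a pair of brackets.  A word in which generators and brackets alternate is thus its own standard
  decomposition, and its length as a list is its breadth.
\<close>

datatype 'x letter = Gen 'x | Br "'x letter list"

type_synonym 'x word = "'x letter list"

definition cat :: "'a list set \<Rightarrow> 'a list set \<Rightarrow> 'a list set"
  where "cat Y Z = {y @ z | y z. y \<in> Y \<and> z \<in> Z}"

primrec cat_pow :: "'a list set \<Rightarrow> nat \<Rightarrow> 'a list set"
  where
    "cat_pow Y 0 = {[]}"
  | "cat_pow Y (Suc r) = cat Y (cat_pow Y r)"

definition brackets :: "'x word set \<Rightarrow> 'x word set"
  where "brackets Z = (\<lambda>z. [Br z]) ` Z"

definition Lambda :: "'x word set \<Rightarrow> 'x word set \<Rightarrow> 'x word set"
  where "Lambda Y Z =
    (\<Union>r\<in>{1..}. cat_pow (cat Y (brackets Z)) r) \<union>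
    (\<Union>r. cat (cat_pow (cat Y (brackets Z)) r) Y) \<union>
    (\<Union>r\<in>{1..}. cat_pow (cat (brackets Z) Y) r) \<union>
    (\<Union>r. cat (cat_pow (cat (brackets Z) Y) r) (brackets Z))"

primrec words_upto :: "'x set \<Rightarrow> nat \<Rightarrow> 'x word set"
  where
    "words_upto X 0 = (\<lambda>x. [Gen x]) ` X"
  | "words_upto X (Suc n) = Lambda ((\<lambda>x. [Gen x]) ` X) (words_upto X n)"

definition words :: "'x set \<Rightarrow> 'x word set"
  where "words X = (\<Union>n. words_upto X n)"

abbreviation word_space :: "('k, 'y) ring_scheme \<Rightarrow> 'x set \<Rightarrow> ('k, 'x word \<Rightarrow> 'k) module"
  where "word_space K X \<equiv> free_mod K (words X)"

definition word_op :: "('k, 'y) ring_scheme \<Rightarrow> 'x set \<Rightarrow> ('x word \<Rightarrow> 'k) \<Rightarrow> 'x word \<Rightarrow> 'k"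
  where "word_op K X = lin_ext K (word_space K X) (\<lambda>w. delta K [Br w])"

definition alg_emb ::
  "('k, 'y) ring_scheme \<Rightarrow> ('k, 'a, 'z) module_scheme \<Rightarrow> 'a set \<Rightarrow> 'a \<Rightarrow> 'a word \<Rightarrow> 'k"
  where "alg_emb K A X a = lin_ext K (word_space K X) (\<lambda>x. delta K [Gen x]) (coords K A X a)"

text \<open>
  The product of two basis words: \<open>letter_prod\<close> is the case of breadth one, \<open>word_prod\<close> the general
  case.  The value of \<open>word_prod\<close> on the empty list, which is not a bracketed word, is immaterial.
\<close>

function (sequential)
  letter_prod :: "('k, 'y) ring_scheme \<Rightarrow> ('k, 'a, 'z) module_scheme \<Rightarrow> 'a set \<Rightarrow>
    'a letter \<Rightarrow> 'a letter \<Rightarrow> 'a word \<Rightarrow> 'k" and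
  word_prod :: "('k, 'y) ring_scheme \<Rightarrow> ('k, 'a, 'z) module_scheme \<Rightarrow> 'a set \<Rightarrow>
    'a word \<Rightarrow> 'a word \<Rightarrow> 'a word \<Rightarrow> 'k"
  where
    "letter_prod K A X (Gen x) (Gen y) = alg_emb K A X (x \<otimes>\<^bsub>A\<^esub> y)"
  | "letter_prod K A X (Gen x) (Br v) = delta K [Gen x, Br v]"
  | "letter_prod K A X (Br u) (Gen y) = delta K [Br u, Gen y]"
  | "letter_prod K A X (Br u) (Br v) =
       word_op K X (word_prod K A X [Br u] v) \<oplus>\<^bsub>word_space K X\<^esub>
       word_op K X (word_prod K A X u [Br v]) \<ominus>\<^bsub>word_space K X\<^esub>
       word_op K X (word_op K X (word_prod K A X u v))"
  | "word_prod K A X u v =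
       (if u = [] \<or> v = [] then \<zero>\<^bsub>word_space K X\<^esub>
        else lin_ext K (word_space K X) (\<lambda>w. delta K (butlast u @ w @ tl v))
               (letter_prod K A X (last u) (hd v)))"
  by pat_completeness auto

lemma size_last_less: "u \<noteq> [] \<Longrightarrow> size (last u) < size_list size u"
  by (induction u) auto

lemma size_hd_less: "u \<noteq> [] \<Longrightarrow> size (hd u) < size_list size u"
  by (induction u) auto

termination
proof (relation "measure (case_sum (\<lambda>(_, _, _, a, b). Suc (size a + size b))
                                    (\<lambda>(_, _, _, u, v). size_list size u + size_list size v))",
    goal_cases)
  case (5 K A X u v)
  then show ?case
    using size_last_less[of u] size_hd_less[of v] by simp
qed auto

definition free_nijenhuis ::
  "('k, 'y) ring_scheme \<Rightarrow> ('k, 'a, 'z) module_scheme \<Rightarrow> 'a set \<Rightarrow> ('k, 'a word \<Rightarrow> 'k) module"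
  where "free_nijenhuis K A X =
    (word_space K X)
      \<lparr>mult := (\<lambda>p q. lin_ext K (word_space K X)
         (\<lambda>u. lin_ext K (word_space K X) (\<lambda>v. word_prod K A X u v) q) p)\<rparr>"


section \<open>The enveloping Nijenhuis algebra of an NS algebra\<close>

text \<open>In this section \<open>X\<close> is a basis of the reduced tensor algebra of \<open>M\<close>.\<close>

definition tensor_nij ::
  "('k, 'y) ring_scheme \<Rightarrow> ('k, 'a, 'z) module_scheme \<Rightarrow> (nat \<Rightarrow> ('a list \<Rightarrow> 'k) set) set \<Rightarrow>
    ('k, (nat \<Rightarrow> ('a list \<Rightarrow> 'k) set) word \<Rightarrow> 'k) module"
  where "tensor_nij K M X = free_nijenhuis K (tensor_algebra K M) X"

definition ns_inj ::
  "('k, 'y) ring_scheme \<Rightarrow> ('k, 'a, 'z) module_scheme \<Rightarrow> (nat \<Rightarrow> ('a list \<Rightarrow> 'k) set) set \<Rightarrow>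
    'a \<Rightarrow> (nat \<Rightarrow> ('a list \<Rightarrow> 'k) set) word \<Rightarrow> 'k"
  where "ns_inj K M X x = alg_emb K (tensor_algebra K M) X (pure_tensor K M [x])"

definition env_gens ::
  "('k, 'y) ring_scheme \<Rightarrow> ('k, 'a, 'z) module_scheme \<Rightarrow>
    ('a \<Rightarrow> 'a \<Rightarrow> 'a) \<Rightarrow> ('a \<Rightarrow> 'a \<Rightarrow> 'a) \<Rightarrow> ('a \<Rightarrow> 'a \<Rightarrow> 'a) \<Rightarrow>
    (nat \<Rightarrow> ('a list \<Rightarrow> 'k) set) set \<Rightarrow> ((nat \<Rightarrow> ('a list \<Rightarrow> 'k) set) word \<Rightarrow> 'k) set"
  where "env_gens K M lop rop bop X =
    (let F = tensor_nij K M X; P = word_op K X; i = ns_inj K M X;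
         j = alg_emb K (tensor_algebra K M) X
     in {i (lop x y) \<ominus>\<^bsub>F\<^esub> (i x \<otimes>\<^bsub>F\<^esub> P (i y)) | x y. x \<in> carrier M \<and> y \<in> carrier M} \<union>
        {i (rop x y) \<ominus>\<^bsub>F\<^esub> (P (i x) \<otimes>\<^bsub>F\<^esub> i y) | x y. x \<in> carrier M \<and> y \<in> carrier M} \<union>
        {i (bop x y) \<oplus>\<^bsub>F\<^esub> P (j (pure_tensor K M [x, y])) | x y. x \<in> carrier M \<and> y \<in> carrier M})"

definition env_ideal ::
  "('k, 'y) ring_scheme \<Rightarrow> ('k, 'a, 'z) module_scheme \<Rightarrow>
    ('a \<Rightarrow> 'a \<Rightarrow> 'a) \<Rightarrow> ('a \<Rightarrow> 'a \<Rightarrow> 'a) \<Rightarrow> ('a \<Rightarrow> 'a \<Rightarrow> 'a) \<Rightarrow>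
    (nat \<Rightarrow> ('a list \<Rightarrow> 'k) set) set \<Rightarrow> ((nat \<Rightarrow> ('a list \<Rightarrow> 'k) set) word \<Rightarrow> 'k) set"
  where "env_ideal K M lop rop bop X =
    nijenhuis_ideal K (tensor_nij K M X) (word_op K X) hull env_gens K M lop rop bop X"

definition env_alg ::
  "('k, 'y) ring_scheme \<Rightarrow> ('k, 'a, 'z) module_scheme \<Rightarrow>
    ('a \<Rightarrow> 'a \<Rightarrow> 'a) \<Rightarrow> ('a \<Rightarrow> 'a \<Rightarrow> 'a) \<Rightarrow> ('a \<Rightarrow> 'a \<Rightarrow> 'a) \<Rightarrow>
    (nat \<Rightarrow> ('a list \<Rightarrow> 'k) set) set \<Rightarrow>
    ('k, ((nat \<Rightarrow> ('a list \<Rightarrow> 'k) set) word \<Rightarrow> 'k) set) module"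
  where "env_alg K M lop rop bop X =
    quot_alg (tensor_nij K M X) (env_ideal K M lop rop bop X)"

definition env_op ::
  "('k, 'y) ring_scheme \<Rightarrow> ('k, 'a, 'z) module_scheme \<Rightarrow>
    ('a \<Rightarrow> 'a \<Rightarrow> 'a) \<Rightarrow> ('a \<Rightarrow> 'a \<Rightarrow> 'a) \<Rightarrow> ('a \<Rightarrow> 'a \<Rightarrow> 'a) \<Rightarrow>
    (nat \<Rightarrow> ('a list \<Rightarrow> 'k) set) set \<Rightarrow>
    ((nat \<Rightarrow> ('a list \<Rightarrow> 'k) set) word \<Rightarrow> 'k) set \<Rightarrow>
    ((nat \<Rightarrow> ('a list \<Rightarrow> 'k) set) word \<Rightarrow> 'k) set"
  where "env_op K M lop rop bop X =
    quot_op (tensor_nij K M X) (env_ideal K M lop rop bop X) (word_op K X)"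

definition env_map ::
  "('k, 'y) ring_scheme \<Rightarrow> ('k, 'a, 'z) module_scheme \<Rightarrow>
    ('a \<Rightarrow> 'a \<Rightarrow> 'a) \<Rightarrow> ('a \<Rightarrow> 'a \<Rightarrow> 'a) \<Rightarrow> ('a \<Rightarrow> 'a \<Rightarrow> 'a) \<Rightarrow>
    (nat \<Rightarrow> ('a list \<Rightarrow> 'k) set) set \<Rightarrow>
    'a \<Rightarrow> ((nat \<Rightarrow> ('a list \<Rightarrow> 'k) set) word \<Rightarrow> 'k) set"
  where "env_map K M lop rop bop X x =
    env_ideal K M lop rop bop X +>\<^bsub>tensor_nij K M X\<^esub> ns_inj K M X x"

end

(*
The reduced tensor algebra T(M) is generated by M and every linear map from M to a nonunital
algebra extends to it; every algebra homomorphism from T(M) to a Nijenhuis algebra extends to the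
algebra of bracketed words.  So an NS homomorphism f from M to (N, Q) extends to a Nijenhuis
homomorphism on the free Nijenhuis algebra, and the generators of J_M are exactly what f is forced
to kill, so it factors through the quotient.  That the bracketed words form an associative algebra
is shown on basis words by induction on their total size: only neighbouring letters interact, and
for three bracketed letters the Nijenhuis identity reduces the claim to seven smaller instances.
*)

theory Submission
  imports Defs
begin

section \<open>Sums and differences in abelian groups\<close>

text \<open>Checking the laws of T(M) directly would mean handling families of sums of cosets.
  Instead, concatenation on the free module over all nonempty tuples is associative on basis
  elements, and a linear multiplicative surjection carries the laws over. A map out of T(M) then
  amounts to a map on tuples that vanishes on the multilinearity relations in each degree. For
  bracketed words the obstacle is alternation: a product of two neighbouring letters may be inserted
  into a word only if its support is known. Two letters of one kind give a combination of single
  letters of that kind, and letters of different kinds give a word of length two. This control of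
  the support must be proved together with closedness, since a product of brackets recursively
  involves products of words. The same case distinction drives associativity and the
  multiplicativity of the extension of f. Functions are total, so uniqueness can only hold among
  functions that are fixed outside the carrier, which is the role of
  \<open>extensional\<close>.\<close>

lemma (in abelian_group) a_minus_eq_zero_iff:
  assumes "x \<in> carrier G" "y \<in> carrier G"
  shows "x \<ominus> y = \<zero> \<longleftrightarrow> x = y"
proof
  assume "x \<ominus> y = \<zero>"
  then have "\<ominus> (\<ominus> y) = x"
    using assms by (intro minus_equality) (simp_all add: a_minus_def)
  then show "x = y" using assms by simp
qed (use assms in \<open>simp add: a_minus_def r_neg\<close>)

lemma (in abelian_monoid) finsum_single:
  assumes "finite B" "b \<in> B" "g b \<in> carrier G" "\<And>c. \<lbrakk>c \<in> B; c \<noteq> b\<rbrakk> \<Longrightarrow> g c = \<zero>"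
  shows "finsum G g B = g b"
proof -
  have "finsum G g B = finsum G g {b}"
  proof (rule add.finprod_mono_neutral_cong_right)
    show "g \<in> B \<rightarrow> carrier G" using assms(3,4) by (metis Pi_I zero_closed)
  qed (use assms in simp_all)
  also have "\<dots> = g b"
    using finsum_insert[of "{}" b g] assms(3) by simp
  finally show ?thesis .
qed

section \<open>Linear maps\<close>

lemma linear_mapI:
  assumes "\<And>x. x \<in> carrier V \<Longrightarrow> f x \<in> carrier W"
    and "\<And>x y. \<lbrakk>x \<in> carrier V; y \<in> carrier V\<rbrakk> \<Longrightarrow> f (x \<oplus>\<^bsub>V\<^esub> y) = f x \<oplus>\<^bsub>W\<^esub> f y"
    and "\<And>c x. \<lbrakk>c \<in> carrier K; x \<in> carrier V\<rbrakk> \<Longrightarrow> f (c \<odot>\<^bsub>V\<^esub> x) = c \<odot>\<^bsub>W\<^esub> f x"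
  shows "linear_map K V W f"
  using assms unfolding linear_map_def by auto

lemma linear_map_closed: "\<lbrakk>linear_map K V W f; x \<in> carrier V\<rbrakk> \<Longrightarrow> f x \<in> carrier W"
  unfolding linear_map_def by auto

lemma linear_map_add:
  "\<lbrakk>linear_map K V W f; x \<in> carrier V; y \<in> carrier V\<rbrakk> \<Longrightarrow> f (x \<oplus>\<^bsub>V\<^esub> y) = f x \<oplus>\<^bsub>W\<^esub> f y"
  unfolding linear_map_def by auto

lemma linear_map_smult:
  "\<lbrakk>linear_map K V W f; c \<in> carrier K; x \<in> carrier V\<rbrakk> \<Longrightarrow> f (c \<odot>\<^bsub>V\<^esub> x) = c \<odot>\<^bsub>W\<^esub> f x"
  unfolding linear_map_def by auto

lemma linear_map_zero:
  assumes "module K V" "module K W" "linear_map K V W f"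
  shows "f \<zero>\<^bsub>V\<^esub> = \<zero>\<^bsub>W\<^esub>"
proof -
  interpret V: module K V by fact
  interpret W: module K W by fact
  have "f (\<zero>\<^bsub>K\<^esub> \<odot>\<^bsub>V\<^esub> \<zero>\<^bsub>V\<^esub>) = \<zero>\<^bsub>K\<^esub> \<odot>\<^bsub>W\<^esub> f \<zero>\<^bsub>V\<^esub>"
    using assms(3) by (intro linear_map_smult) auto
  then show ?thesis
    using linear_map_closed[OF assms(3)] by simp
qed

lemma linear_map_uminus:
  assumes "module K V" "module K W" "linear_map K V W f" "x \<in> carrier V"
  shows "f (\<ominus>\<^bsub>V\<^esub> x) = \<ominus>\<^bsub>W\<^esub> f x"
proof -
  interpret V: module K V by fact
  interpret W: module K W by fact
  have "f (\<ominus>\<^bsub>V\<^esub> x) \<oplus>\<^bsub>W\<^esub> f x = \<zero>\<^bsub>W\<^esub>"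
    using linear_map_add[OF assms(3), of "\<ominus>\<^bsub>V\<^esub> x" x] assms(4) linear_map_zero[OF assms(1-3)]
    by (simp add: V.M.l_neg)
  then show ?thesis
    using linear_map_closed[OF assms(3)] assms(4) by (intro W.M.minus_equality[symmetric]) auto
qed

lemma linear_map_minus:
  assumes "module K V" "module K W" "linear_map K V W f" "x \<in> carrier V" "y \<in> carrier V"
  shows "f (x \<ominus>\<^bsub>V\<^esub> y) = f x \<ominus>\<^bsub>W\<^esub> f y"
proof -
  interpret V: module K V by fact
  show ?thesis
    using assms linear_map_add[OF assms(3), of x "\<ominus>\<^bsub>V\<^esub> y"] linear_map_uminus[OF assms(1-3)]
    by (simp add: a_minus_def)
qed

lemma linear_map_finsum:
  assumes "module K V" "module K W" "linear_map K V W f" "g \<in> B \<rightarrow> carrier V"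
  shows "f (finsum V g B) = finsum W (\<lambda>b. f (g b)) B"
proof -
  interpret V: module K V by fact
  interpret W: module K W by fact
  show ?thesis
  proof (cases "finite B")
    case True
    then show ?thesis
      using assms(4)
    proof induction
      case empty
      then show ?case using linear_map_zero[OF assms(1-3)] by simp
    next
      case (insert b B)
      then show ?case
        using linear_map_closed[OF assms(3)]
        by (auto simp: V.M.finsum_insert W.M.finsum_insert Pi_def linear_map_add[OF assms(3)])
    qed
  next
    \<comment> \<open>Over an infinite index set \<open>finsum\<close> is zero by convention, so the
      claim becomes preservation of zero.\<close>
    case False
    then show ?thesis
      using linear_map_zero[OF assms(1-3)] by simp
  qed
qed

lemma linear_map_id: "linear_map K V V (\<lambda>x. x)"
  by (intro linear_mapI) auto

lemma linear_map_comp: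
  "\<lbrakk>linear_map K V W g; linear_map K U V f\<rbrakk> \<Longrightarrow> linear_map K U W (\<lambda>x. g (f x))"
  unfolding linear_map_def by (simp add: Pi_iff)

lemma linear_map_plus:
  assumes "module K W" "linear_map K V W f" "linear_map K V W g"
  shows "linear_map K V W (\<lambda>x. f x \<oplus>\<^bsub>W\<^esub> g x)"
proof -
  interpret W: module K W by fact
  note closed = linear_map_closed[OF assms(2)] linear_map_closed[OF assms(3)]
  show ?thesis
    by (intro linear_mapI)
      (simp_all add: closed linear_map_add[OF assms(2)] linear_map_add[OF assms(3)]
        linear_map_smult[OF assms(2)] linear_map_smult[OF assms(3)] W.smult_r_distr W.M.a_ac)
qed

lemma linear_map_neg:
  assumes "module K W" "linear_map K V W f"
  shows "linear_map K V W (\<lambda>x. \<ominus>\<^bsub>W\<^esub> f x)"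
proof -
  interpret W: module K W by fact
  note closed = linear_map_closed[OF assms(2)]
  show ?thesis
    by (intro linear_mapI)
      (simp_all add: closed linear_map_add[OF assms(2)] linear_map_smult[OF assms(2)]
        W.smult_r_minus W.M.minus_add)
qed

lemma linear_map_diff:
  assumes "module K W" "linear_map K V W f" "linear_map K V W g"
  shows "linear_map K V W (\<lambda>x. f x \<ominus>\<^bsub>W\<^esub> g x)"
  unfolding a_minus_def by (intro linear_map_plus linear_map_neg assms)

text \<open>\<open>linear_map\<close> looks only at arguments in the carrier, so agreement there
  suffices. This transfers linearity to functions such as \<open>alg_emb\<close>, which are defined
  with a fixed codomain but take values in smaller spans.\<close>

lemma linear_map_cong:
  assumes "module K V" "linear_map K V W f" "\<And>x. x \<in> carrier V \<Longrightarrow> f x = g x"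
  shows "linear_map K V W g"
proof -
  interpret V: module K V by fact
  show ?thesis
    by (rule linear_mapI)
      (simp_all add: assms(3)[symmetric] linear_map_closed[OF assms(2)] linear_map_add[OF assms(2)]
        linear_map_smult[OF assms(2)])
qed

text \<open>Serves the degree \<open>n\<close> part of a product of tensors, a finite sum over the
  ways of splitting \<open>n\<close>, which has to be linear in each factor.\<close>

lemma linear_map_finsum_param:
  assumes W: "module K W" and g: "\<And>b. b \<in> B \<Longrightarrow> linear_map K V W (g b)"
  shows "linear_map K V W (\<lambda>x. finsum W (\<lambda>b. g b x) B)"
proof -
  interpret W: module K W by fact
  note c = linear_map_closed[OF g]
  show ?thesis
  proof (rule linear_mapI)
    fix x assume x: "x \<in> carrier V"
    show "finsum W (\<lambda>b. g b x) B \<in> carrier W"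
      using c[OF _ x] by (intro W.M.finsum_closed) auto
    show "finsum W (\<lambda>b. g b (x \<oplus>\<^bsub>V\<^esub> y)) B = finsum W (\<lambda>b. g b x) B \<oplus>\<^bsub>W\<^esub> finsum W (\<lambda>b. g b y) B"
      if y: "y \<in> carrier V" for y
    proof (subst W.M.finsum_addf[symmetric])
      show "finsum W (\<lambda>b. g b (x \<oplus>\<^bsub>V\<^esub> y)) B = finsum W (\<lambda>b. g b x \<oplus>\<^bsub>W\<^esub> g b y) B"
        by (rule W.M.finsum_cong') (simp_all add: linear_map_add[OF g] c x y)
    qed (use c x y in auto)
    show "finsum W (\<lambda>b. g b (r \<odot>\<^bsub>V\<^esub> x)) B = r \<odot>\<^bsub>W\<^esub> finsum W (\<lambda>b. g b x) B"
      if r: "r \<in> carrier K" for r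
    proof (cases "finite B")
      case True
      show ?thesis
      proof (subst W.finsum_smult_ldistr[OF True r])
        show "finsum W (\<lambda>b. g b (r \<odot>\<^bsub>V\<^esub> x)) B = finsum W (\<lambda>b. r \<odot>\<^bsub>W\<^esub> g b x) B"
          by (rule W.M.finsum_cong') (simp_all add: linear_map_smult[OF g] c x r)
      qed (use c x in auto)
    qed (use r in simp)
  qed
qed

lemma bilinear_opD:
  assumes "bilinear_op K V f"
  shows "x \<in> carrier V \<Longrightarrow> linear_map K V V (f x)"
    and "y \<in> carrier V \<Longrightarrow> linear_map K V V (\<lambda>x. f x y)"
  using assms unfolding bilinear_op_def by auto

section \<open>Free modules\<close>

lemma free_mod_simps:
  "\<zero>\<^bsub>free_mod K S\<^esub> = (\<lambda>w. \<zero>\<^bsub>K\<^esub>)"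
  "p \<oplus>\<^bsub>free_mod K S\<^esub> q = (\<lambda>w. p w \<oplus>\<^bsub>K\<^esub> q w)"
  "c \<odot>\<^bsub>free_mod K S\<^esub> p = (\<lambda>w. c \<otimes>\<^bsub>K\<^esub> p w)"
  by (simp_all add: free_mod_def)

lemma free_mod_carrierI:
  "\<lbrakk>\<And>w. p w \<in> carrier K; \<And>w. w \<notin> S \<Longrightarrow> p w = \<zero>\<^bsub>K\<^esub>; finite {w. p w \<noteq> \<zero>\<^bsub>K\<^esub>}\<rbrakk>
    \<Longrightarrow> p \<in> carrier (free_mod K S)"
  by (simp add: free_mod_def)

lemma free_mod_carrierD:
  assumes "p \<in> carrier (free_mod K S)"
  shows "p w \<in> carrier K" "w \<notin> S \<Longrightarrow> p w = \<zero>\<^bsub>K\<^esub>" "finite {w. p w \<noteq> \<zero>\<^bsub>K\<^esub>}"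
    "{w. p w \<noteq> \<zero>\<^bsub>K\<^esub>} \<subseteq> S"
  using assms by (auto simp: free_mod_def)

lemma free_mod_mono: "S \<subseteq> S' \<Longrightarrow> carrier (free_mod K S) \<subseteq> carrier (free_mod K S')"
  by (auto simp: free_mod_def)

lemma free_mod_module:
  fixes K :: "('k, 'y) ring_scheme" (structure) and S :: "'w set"
  assumes "cring K"
  shows "module K (free_mod K S)"
proof -
  interpret cring K by fact
  have fin: "finite {w. p w \<oplus> q w \<noteq> \<zero>}"
    if "finite {w. p w \<noteq> \<zero>}" "finite {w. q w \<noteq> \<zero>}" for p q :: "'w \<Rightarrow> 'k"
    by (rule finite_subset[OF _ finite_UnI[OF that]]) auto
  have fin': "finite {w. c \<otimes> p w \<noteq> \<zero>}"
    if "finite {w. p w \<noteq> \<zero>}" "c \<in> carrier K" for p :: "'w \<Rightarrow> 'k" and c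
    by (rule finite_subset[OF _ that(1)]) (use that(2) in auto)
  show ?thesis
  proof (intro moduleI abelian_groupI)
    fix p assume p: "p \<in> carrier (free_mod K S)"
    show "\<exists>q\<in>carrier (free_mod K S). q \<oplus>\<^bsub>free_mod K S\<^esub> p = \<zero>\<^bsub>free_mod K S\<^esub>"
    proof (rule bexI)
      show "(\<lambda>w. \<ominus> p w) \<oplus>\<^bsub>free_mod K S\<^esub> p = \<zero>\<^bsub>free_mod K S\<^esub>"
        using p by (auto simp: free_mod_def l_neg)
      show "(\<lambda>w. \<ominus> p w) \<in> carrier (free_mod K S)"
      proof (rule free_mod_carrierI)
        show "finite {w. \<ominus> p w \<noteq> \<zero>}"
          by (rule finite_subset[OF _ free_mod_carrierD(3)[OF p]]) auto
      qed (use free_mod_carrierD[OF p] in auto)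
    qed
  qed (use assms in \<open>auto simp: free_mod_def fin fin' a_ac l_distr r_distr m_assoc\<close>)
qed

text \<open>The negative is defined as an inverse in the module, so it might depend on
  \<open>S\<close>. The pointwise formula shows that it does not, which makes differences taken over
  different index sets comparable.\<close>

lemma free_mod_uminus:
  assumes "cring K" "p \<in> carrier (free_mod K S)"
  shows "\<ominus>\<^bsub>free_mod K S\<^esub> p = (\<lambda>w. \<ominus>\<^bsub>K\<^esub> p w)"
proof -
  interpret cring K by fact
  interpret F: module K "free_mod K S" by (rule free_mod_module) fact
  have "(\<lambda>w. \<ominus>\<^bsub>K\<^esub> p w) \<in> carrier (free_mod K S)"
  proof (rule free_mod_carrierI)
    show "finite {w. \<ominus>\<^bsub>K\<^esub> p w \<noteq> \<zero>\<^bsub>K\<^esub>}"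
      by (rule finite_subset[OF _ free_mod_carrierD(3)[OF assms(2)]]) auto
  qed (use free_mod_carrierD[OF assms(2)] in auto)
  then show ?thesis
    by (intro F.M.minus_equality) (use assms free_mod_carrierD(1)[OF assms(2)] in \<open>auto simp: free_mod_simps l_neg\<close>)
qed

lemma delta_closed:
  assumes "cring K" "w \<in> S"
  shows "delta K w \<in> carrier (free_mod K S)"
proof -
  interpret cring K by fact
  show ?thesis
  proof (rule free_mod_carrierI)
    show "finite {v. delta K w v \<noteq> \<zero>\<^bsub>K\<^esub>}"
      by (rule finite_subset[of _ "{w}"]) (auto simp: delta_def)
  qed (use assms in \<open>auto simp: delta_def\<close>)
qed

lemma finsum_free_mod:
  assumes "cring K" "finite B" "g \<in> B \<rightarrow> carrier (free_mod K S)"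
  shows "finsum (free_mod K S) g B = (\<lambda>w. finsum K (\<lambda>b. g b w) B)"
proof -
  interpret cring K by fact
  interpret F: module K "free_mod K S" by (rule free_mod_module) fact
  show ?thesis
    using assms(2,3)
  proof induction
    case empty
    then show ?case by (simp add: free_mod_simps)
  next
    case (insert b B)
    then have gb: "g b \<in> carrier (free_mod K S)" and gB: "g \<in> B \<rightarrow> carrier (free_mod K S)"
      by (simp_all add: Pi_iff)
    have "finsum (free_mod K S) g (insert b B) = g b \<oplus>\<^bsub>free_mod K S\<^esub> finsum (free_mod K S) g B"
      by (rule F.M.finsum_insert[OF insert.hyps gB gb])
    also have "\<dots> = (\<lambda>w. g b w \<oplus>\<^bsub>K\<^esub> finsum K (\<lambda>b. g b w) B)"
      by (simp only: insert.IH[OF gB] free_mod_simps)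
    also have "\<dots> = (\<lambda>w. finsum K (\<lambda>b. g b w) (insert b B))"
    proof
      fix w
      have "g b w \<in> carrier K" "(\<lambda>b. g b w) \<in> B \<rightarrow> carrier K"
        using free_mod_carrierD(1)[of _ K S w] gb gB by (simp_all add: Pi_iff)
      then show "g b w \<oplus>\<^bsub>K\<^esub> finsum K (\<lambda>b. g b w) B = finsum K (\<lambda>b. g b w) (insert b B)"
        by (intro finsum_insert[OF insert.hyps, symmetric])
    qed
    finally show ?case .
  qed
qed

text \<open>Zero coefficients contribute nothing, so any finite set between the support and
  \<open>S\<close> will do. This is what allows combinations with different supports to be added
  termwise.\<close>

lemma lin_ext_superset:
  assumes V: "module K V" and p: "p \<in> carrier (free_mod K S)"
    and g: "\<And>w. w \<in> S \<Longrightarrow> g w \<in> carrier V"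
    and B: "finite B" "{w. p w \<noteq> \<zero>\<^bsub>K\<^esub>} \<subseteq> B" "B \<subseteq> S"
  shows "lin_ext K V g p = finsum V (\<lambda>w. p w \<odot>\<^bsub>V\<^esub> g w) B"
proof -
  interpret V: module K V by fact
  note pD = free_mod_carrierD[OF p]
  show ?thesis
    unfolding lin_ext_def
    by (rule V.M.add.finprod_mono_neutral_cong_left) (use B pD g in \<open>auto intro!: V.smult_closed\<close>)
qed

lemma linear_map_lin_ext:
  assumes V: "module K V" and g: "\<And>w. w \<in> S \<Longrightarrow> g w \<in> carrier V"
  shows "linear_map K (free_mod K S) V (lin_ext K V g)"
proof (rule linear_mapI)
  interpret V: module K V by fact
  interpret F: module K "free_mod K S" by (rule free_mod_module) unfold_locales
  fix p assume p: "p \<in> carrier (free_mod K S)"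
  note pD = free_mod_carrierD[OF p]
  let ?P = "{w. p w \<noteq> \<zero>\<^bsub>K\<^esub>}"
  show "lin_ext K V g p \<in> carrier V"
    unfolding lin_ext_def using pD g by (intro V.M.finsum_closed) (auto intro!: V.smult_closed)
  {
    fix q assume q: "q \<in> carrier (free_mod K S)"
    note qD = free_mod_carrierD[OF q]
    let ?B = "?P \<union> {w. q w \<noteq> \<zero>\<^bsub>K\<^esub>}"
    have B: "finite ?B" "?B \<subseteq> S" using pD qD by auto
    have "lin_ext K V g (p \<oplus>\<^bsub>free_mod K S\<^esub> q)
        = finsum V (\<lambda>w. (p \<oplus>\<^bsub>free_mod K S\<^esub> q) w \<odot>\<^bsub>V\<^esub> g w) ?B"
      by (rule lin_ext_superset[OF V F.M.a_closed[OF p q] g]) (use B in \<open>auto simp: free_mod_simps\<close>)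
    also have "\<dots> = finsum V (\<lambda>w. p w \<odot>\<^bsub>V\<^esub> g w \<oplus>\<^bsub>V\<^esub> q w \<odot>\<^bsub>V\<^esub> g w) ?B"
    proof (rule V.M.finsum_cong')
      fix i assume "i \<in> ?B"
      then have "g i \<in> carrier V" using B(2) g by blast
      then show "(p \<oplus>\<^bsub>free_mod K S\<^esub> q) i \<odot>\<^bsub>V\<^esub> g i = p i \<odot>\<^bsub>V\<^esub> g i \<oplus>\<^bsub>V\<^esub> q i \<odot>\<^bsub>V\<^esub> g i"
        using pD(1) qD(1) by (simp add: free_mod_simps V.smult_l_distr)
    qed (use pD qD g B in \<open>auto intro!: V.smult_closed V.M.a_closed\<close>)
    also have "\<dots> = finsum V (\<lambda>w. p w \<odot>\<^bsub>V\<^esub> g w) ?B \<oplus>\<^bsub>V\<^esub> finsum V (\<lambda>w. q w \<odot>\<^bsub>V\<^esub> g w) ?B"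
      using pD qD g B by (intro V.M.finsum_addf) (auto intro!: V.smult_closed)
    also have "\<dots> = lin_ext K V g p \<oplus>\<^bsub>V\<^esub> lin_ext K V g q"
      using B lin_ext_superset[OF V p g, where B = ?B] lin_ext_superset[OF V q g, where B = ?B] by simp
    finally show "lin_ext K V g (p \<oplus>\<^bsub>free_mod K S\<^esub> q) = lin_ext K V g p \<oplus>\<^bsub>V\<^esub> lin_ext K V g q" .
  }
  fix c assume c: "c \<in> carrier K"
  have "lin_ext K V g (c \<odot>\<^bsub>free_mod K S\<^esub> p)
      = finsum V (\<lambda>w. (c \<odot>\<^bsub>free_mod K S\<^esub> p) w \<odot>\<^bsub>V\<^esub> g w) ?P"
    by (rule lin_ext_superset[OF V F.smult_closed[OF c p] g]) (use pD c in \<open>auto simp: free_mod_simps\<close>)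
  also have "\<dots> = finsum V (\<lambda>w. c \<odot>\<^bsub>V\<^esub> (p w \<odot>\<^bsub>V\<^esub> g w)) ?P"
  proof (rule V.M.finsum_cong')
    fix i assume "i \<in> ?P"
    then have "g i \<in> carrier V" using pD(4) g by blast
    then show "(c \<odot>\<^bsub>free_mod K S\<^esub> p) i \<odot>\<^bsub>V\<^esub> g i = c \<odot>\<^bsub>V\<^esub> (p i \<odot>\<^bsub>V\<^esub> g i)"
      using pD(1) c by (simp add: free_mod_simps V.smult_assoc1)
  qed (use pD g c in \<open>auto intro!: V.smult_closed\<close>)
  also have "\<dots> = c \<odot>\<^bsub>V\<^esub> lin_ext K V g p"
    unfolding lin_ext_def using pD g c
    by (intro V.finsum_smult_ldistr[symmetric]) (auto intro!: V.smult_closed)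
  finally show "lin_ext K V g (c \<odot>\<^bsub>free_mod K S\<^esub> p) = c \<odot>\<^bsub>V\<^esub> lin_ext K V g p" .
qed

lemma lin_ext_closed:
  assumes "module K V" "\<And>w. w \<in> S \<Longrightarrow> g w \<in> carrier V" "p \<in> carrier (free_mod K S)"
  shows "lin_ext K V g p \<in> carrier V"
  by (rule linear_map_closed[OF linear_map_lin_ext assms(3)]) (fact assms)+

lemma lin_ext_delta:
  assumes V: "module K V" and "g w \<in> carrier V"
  shows "lin_ext K V g (delta K w) = g w"
proof -
  interpret V: module K V by fact
  \<comment> \<open>\<open>K\<close> is only a commutative ring here, where one may equal zero;
    hence the support is merely contained in \<open>{w}\<close>.\<close>
  have "lin_ext K V g (delta K w) = finsum V (\<lambda>v. delta K w v \<odot>\<^bsub>V\<^esub> g v) {w}"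
  proof (rule lin_ext_superset[OF V])
    show "delta K w \<in> carrier (free_mod K {w})"
      by (rule delta_closed[OF V.is_cring]) simp
    show "{v. delta K w v \<noteq> \<zero>\<^bsub>K\<^esub>} \<subseteq> {w}"
      by (auto simp: delta_def)
  qed (use assms(2) in simp_all)
  also have "\<dots> = g w" using assms(2) by (simp add: delta_def)
  finally show ?thesis .
qed

lemma lin_ext_cong:
  assumes "module K V" "p \<in> carrier (free_mod K S)"
    and "\<And>w. w \<in> S \<Longrightarrow> g w \<in> carrier V" "\<And>w. w \<in> S \<Longrightarrow> g w = h w"
  shows "lin_ext K V g p = lin_ext K V h p"
proof -
  interpret V: module K V by fact
  note pD = free_mod_carrierD[OF assms(2)]
  show ?thesis
    unfolding lin_ext_def using pD assms(3,4)
    by (intro V.M.finsum_cong') (auto intro!: V.smult_closed)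
qed

lemma linear_map_lin_ext_eq:
  assumes V: "module K V" and W: "module K W" and f: "linear_map K V W f"
    and g: "\<And>w. w \<in> S \<Longrightarrow> g w \<in> carrier V" and p: "p \<in> carrier (free_mod K S)"
  shows "f (lin_ext K V g p) = lin_ext K W (\<lambda>w. f (g w)) p"
proof -
  interpret V: module K V by fact
  interpret W: module K W by fact
  note pD = free_mod_carrierD[OF p]
  have gP: "g w \<in> carrier V" if "p w \<noteq> \<zero>\<^bsub>K\<^esub>" for w using that pD(4) g by blast
  have "f (lin_ext K V g p) = finsum W (\<lambda>w. f (p w \<odot>\<^bsub>V\<^esub> g w)) {w. p w \<noteq> \<zero>\<^bsub>K\<^esub>}"
    unfolding lin_ext_def using pD gP by (intro linear_map_finsum[OF V W f]) auto
  also have "\<dots> = lin_ext K W (\<lambda>w. f (g w)) p"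
    unfolding lin_ext_def using pD gP linear_map_closed[OF f] linear_map_smult[OF f]
    by (intro W.M.finsum_cong') (auto intro!: W.smult_closed)
  finally show ?thesis .
qed

lemma lin_ext_id:
  fixes K (structure)
  assumes K: "cring K" and p: "p \<in> carrier (free_mod K S)"
  shows "lin_ext K (free_mod K S) (delta K) p = p"
proof
  fix v
  interpret cring K by fact
  note pD = free_mod_carrierD[OF p]
  have "lin_ext K (free_mod K S) (delta K) p v
      = finsum K (\<lambda>w. p w \<otimes> delta K w v) {w. p w \<noteq> \<zero>}"
    unfolding lin_ext_def
  proof (subst finsum_free_mod[OF K pD(3)])
    show "(\<lambda>w. p w \<odot>\<^bsub>free_mod K S\<^esub> delta K w) \<in> {w. p w \<noteq> \<zero>} \<rightarrow> carrier (free_mod K S)"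
      using pD by (auto intro!: module.smult_closed[OF free_mod_module[OF K]] delta_closed[OF K])
  qed (simp add: free_mod_simps)
  also have "\<dots> = finsum K (\<lambda>w. if v = w then p w else \<zero>) {w. p w \<noteq> \<zero>}"
    by (rule finsum_cong') (use pD in \<open>auto simp: delta_def\<close>)
  also have "\<dots> = p v"
  proof (cases "p v = \<zero>")
    case True
    then have "finsum K (\<lambda>w. if v = w then p w else \<zero>) {w. p w \<noteq> \<zero>}
        = finsum K (\<lambda>w. \<zero>) {w. p w \<noteq> \<zero>}"
      by (intro finsum_cong') auto
    then show ?thesis using True finsum_zero by simp
  next
    case False
    then show ?thesis
      using add.finprod_singleton[of v "{w. p w \<noteq> \<zero>}" p] pD by auto
  qed
  finally show "lin_ext K (free_mod K S) (delta K) p v = p v" .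
qed

lemma linear_map_free_mod:
  assumes V: "module K V" and f: "linear_map K (free_mod K S) V f" and p: "p \<in> carrier (free_mod K S)"
  shows "f p = lin_ext K V (\<lambda>w. f (delta K w)) p"
proof -
  interpret V: module K V by fact
  have "f p = f (lin_ext K (free_mod K S) (delta K) p)"
    using lin_ext_id[OF V.is_cring p] by simp
  also have "\<dots> = lin_ext K V (\<lambda>w. f (delta K w)) p"
    by (rule linear_map_lin_ext_eq[OF free_mod_module[OF V.is_cring] V f delta_closed[OF V.is_cring] p])
  finally show ?thesis .
qed

text \<open>The functions \<open>delta K w\<close> span the free module. Nearly every identity
  between linear expressions below is reduced to basis elements through this rule or its bilinear
  and trilinear versions.\<close>

lemma free_mod_eqI:
  assumes V: "module K V" and f: "linear_map K (free_mod K S) V f"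
    and g: "linear_map K (free_mod K S) V g" and p: "p \<in> carrier (free_mod K S)"
    and eq: "\<And>w. w \<in> S \<Longrightarrow> f (delta K w) = g (delta K w)"
  shows "f p = g p"
proof -
  interpret V: module K V by fact
  show ?thesis
    unfolding linear_map_free_mod[OF V f p] linear_map_free_mod[OF V g p]
    by (rule lin_ext_cong[OF V p])
      (simp_all add: linear_map_closed[OF g] delta_closed[OF V.is_cring] eq)
qed

text \<open>The sum is formed in the target module and so formally refers to its index set. Since
  the operations are pointwise the value does not change, and a combination computed in a large span
  may be regarded as an element of a smaller one.\<close>

lemma lin_ext_free_mod_cong_set:
  assumes K: "cring K" and S: "S \<subseteq> S'" and p: "p \<in> carrier (free_mod K T)"
    and g: "\<And>w. w \<in> T \<Longrightarrow> g w \<in> carrier (free_mod K S)"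
  shows "lin_ext K (free_mod K S') g p = lin_ext K (free_mod K S) g p"
proof -
  note pD = free_mod_carrierD[OF p]
  have *: "finsum (free_mod K U) (\<lambda>w. p w \<odot>\<^bsub>free_mod K U\<^esub> g w) {w. p w \<noteq> \<zero>\<^bsub>K\<^esub>}
     = (\<lambda>v. finsum K (\<lambda>w. p w \<otimes>\<^bsub>K\<^esub> g w v) {w. p w \<noteq> \<zero>\<^bsub>K\<^esub>})"
    if "\<And>w. w \<in> T \<Longrightarrow> g w \<in> carrier (free_mod K U)" for U
  proof (subst finsum_free_mod[OF K pD(3)])
    show "(\<lambda>w. p w \<odot>\<^bsub>free_mod K U\<^esub> g w) \<in> {w. p w \<noteq> \<zero>\<^bsub>K\<^esub>} \<rightarrow> carrier (free_mod K U)"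
      using that pD by (auto intro!: module.smult_closed[OF free_mod_module[OF K]])
  qed (simp add: free_mod_simps)
  have "g w \<in> carrier (free_mod K S')" if "w \<in> T" for w
    using g[OF that] free_mod_mono[OF S] by auto
  from *[OF this] *[OF g] show ?thesis
    unfolding lin_ext_def by simp
qed

text \<open>Gives linearity of a double extension in its inner argument. The scalar has to move past
  the coefficient \<open>p w\<close>, which uses commutativity of \<open>K\<close>.\<close>

lemma linear_map_lin_ext_param:
  assumes V: "module K V" and p: "p \<in> carrier (free_mod K S)"
    and g: "\<And>w. w \<in> S \<Longrightarrow> linear_map K U V (g w)"
  shows "linear_map K U V (\<lambda>x. lin_ext K V (\<lambda>w. g w x) p)"
proof (rule linear_mapI)
  interpret V: module K V by fact
  note pD = free_mod_carrierD[OF p]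
  have g': "linear_map K U V (g w)" if "p w \<noteq> \<zero>\<^bsub>K\<^esub>" for w using that pD(4) g by blast
  fix x assume x: "x \<in> carrier U"
  then have gx: "(\<lambda>w. p w \<odot>\<^bsub>V\<^esub> g w x) \<in> {w. p w \<noteq> \<zero>\<^bsub>K\<^esub>} \<rightarrow> carrier V"
    using linear_map_closed[OF g'] pD by auto
  then show "lin_ext K V (\<lambda>w. g w x) p \<in> carrier V"
    unfolding lin_ext_def by (intro V.M.finsum_closed)
  {
    fix y assume y: "y \<in> carrier U"
    then have gy: "(\<lambda>w. p w \<odot>\<^bsub>V\<^esub> g w y) \<in> {w. p w \<noteq> \<zero>\<^bsub>K\<^esub>} \<rightarrow> carrier V"
      using linear_map_closed[OF g'] pD by auto
    show "lin_ext K V (\<lambda>w. g w (x \<oplus>\<^bsub>U\<^esub> y)) p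
        = lin_ext K V (\<lambda>w. g w x) p \<oplus>\<^bsub>V\<^esub> lin_ext K V (\<lambda>w. g w y) p"
      unfolding lin_ext_def V.M.finsum_addf[OF gx gy, symmetric]
    proof (rule V.M.finsum_cong')
      fix w assume "w \<in> {w. p w \<noteq> \<zero>\<^bsub>K\<^esub>}"
      then show "p w \<odot>\<^bsub>V\<^esub> g w (x \<oplus>\<^bsub>U\<^esub> y) = p w \<odot>\<^bsub>V\<^esub> g w x \<oplus>\<^bsub>V\<^esub> p w \<odot>\<^bsub>V\<^esub> g w y"
        using x y pD(1)[of w] by (simp add: linear_map_add[OF g'] linear_map_closed[OF g'] V.smult_r_distr)
    qed (use gx gy in auto)
  }
  fix c assume c: "c \<in> carrier K"
  show "lin_ext K V (\<lambda>w. g w (c \<odot>\<^bsub>U\<^esub> x)) p = c \<odot>\<^bsub>V\<^esub> lin_ext K V (\<lambda>w. g w x) p"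
    unfolding lin_ext_def V.finsum_smult_ldistr[OF pD(3) c gx]
  proof (rule V.M.finsum_cong')
    fix w assume "w \<in> {w. p w \<noteq> \<zero>\<^bsub>K\<^esub>}"
    then show "p w \<odot>\<^bsub>V\<^esub> g w (c \<odot>\<^bsub>U\<^esub> x) = c \<odot>\<^bsub>V\<^esub> (p w \<odot>\<^bsub>V\<^esub> g w x)"
      using x c pD(1)[of w] linear_map_closed[OF g', of w x]
      by (simp add: linear_map_smult[OF g'] V.smult_assoc1[symmetric] V.R.m_comm)
  qed (use gx c in auto)
qed

text \<open>The left side is linear in \<open>q\<close>, hence the combination of its values at
  basis elements, and these collapse to the inner sum on the right.\<close>

lemma lin_ext_swap:
  assumes V: "module K V" and p: "p \<in> carrier (free_mod K S)" and q: "q \<in> carrier (free_mod K T)"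
    and g: "\<And>s t. \<lbrakk>s \<in> S; t \<in> T\<rbrakk> \<Longrightarrow> g s t \<in> carrier V"
  shows "lin_ext K V (\<lambda>s. lin_ext K V (\<lambda>t. g s t) q) p = lin_ext K V (\<lambda>t. lin_ext K V (\<lambda>s. g s t) p) q"
proof -
  let ?h = "\<lambda>q. lin_ext K V (\<lambda>s. lin_ext K V (\<lambda>t. g s t) q) p"
  have h: "linear_map K (free_mod K T) V ?h"
    by (rule linear_map_lin_ext_param[OF V p], rule linear_map_lin_ext[OF V], rule g)
  have "?h (delta K t) = lin_ext K V (\<lambda>s. g s t) p" if t: "t \<in> T" for t
  proof (rule lin_ext_cong[OF V p])
    show "lin_ext K V (\<lambda>t. g s t) (delta K t) = g s t" if "s \<in> S" for s
      using g[OF that t] by (rule lin_ext_delta[OF V])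
    then show "lin_ext K V (\<lambda>t. g s t) (delta K t) \<in> carrier V" if "s \<in> S" for s
      using g[OF that t] that by simp
  qed
  moreover have "?h (delta K t) \<in> carrier V" if t: "t \<in> T" for t
  proof -
    interpret V: module K V by fact
    show ?thesis
      by (rule linear_map_closed[OF h delta_closed[OF V.is_cring t]])
  qed
  ultimately have "lin_ext K V (\<lambda>t. ?h (delta K t)) q = lin_ext K V (\<lambda>t. lin_ext K V (\<lambda>s. g s t) p) q"
    by (intro lin_ext_cong[OF V q])
  with linear_map_free_mod[OF V h q] show ?thesis by (rule trans)
qed

text \<open>Linearity in the second argument is only demanded when the first is a basis element,
  since the first argument has been reduced to one by then.\<close>

lemma bilinear_eqI:
  assumes W: "module K W"
    and f1: "\<And>q. q \<in> carrier (free_mod K T) \<Longrightarrow> linear_map K (free_mod K S) W (\<lambda>p. f p q)"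
    and f2: "\<And>w. w \<in> S \<Longrightarrow> linear_map K (free_mod K T) W (f (delta K w))"
    and g1: "\<And>q. q \<in> carrier (free_mod K T) \<Longrightarrow> linear_map K (free_mod K S) W (\<lambda>p. g p q)"
    and g2: "\<And>w. w \<in> S \<Longrightarrow> linear_map K (free_mod K T) W (g (delta K w))"
    and eq: "\<And>v w. \<lbrakk>v \<in> S; w \<in> T\<rbrakk> \<Longrightarrow> f (delta K v) (delta K w) = g (delta K v) (delta K w)"
    and pq: "p \<in> carrier (free_mod K S)" "q \<in> carrier (free_mod K T)"
  shows "f p q = g p q"
proof (rule free_mod_eqI[OF W f1[OF pq(2)] g1[OF pq(2)] pq(1)])
  fix w assume w: "w \<in> S"
  show "f (delta K w) q = g (delta K w) q"
    by (rule free_mod_eqI[OF W f2[OF w] g2[OF w] pq(2) eq[OF w]])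
qed

lemma trilinear_eqI:
  assumes W: "module K W"
    and f1: "\<And>q r. \<lbrakk>q \<in> carrier (free_mod K T); r \<in> carrier (free_mod K U)\<rbrakk>
      \<Longrightarrow> linear_map K (free_mod K S) W (\<lambda>p. f p q r)"
    and f2: "\<And>u r. \<lbrakk>u \<in> S; r \<in> carrier (free_mod K U)\<rbrakk>
      \<Longrightarrow> linear_map K (free_mod K T) W (\<lambda>q. f (delta K u) q r)"
    and f3: "\<And>u v. \<lbrakk>u \<in> S; v \<in> T\<rbrakk> \<Longrightarrow> linear_map K (free_mod K U) W (f (delta K u) (delta K v))"
    and g1: "\<And>q r. \<lbrakk>q \<in> carrier (free_mod K T); r \<in> carrier (free_mod K U)\<rbrakk>
      \<Longrightarrow> linear_map K (free_mod K S) W (\<lambda>p. g p q r)"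
    and g2: "\<And>u r. \<lbrakk>u \<in> S; r \<in> carrier (free_mod K U)\<rbrakk>
      \<Longrightarrow> linear_map K (free_mod K T) W (\<lambda>q. g (delta K u) q r)"
    and g3: "\<And>u v. \<lbrakk>u \<in> S; v \<in> T\<rbrakk> \<Longrightarrow> linear_map K (free_mod K U) W (g (delta K u) (delta K v))"
    and eq: "\<And>u v w. \<lbrakk>u \<in> S; v \<in> T; w \<in> U\<rbrakk>
      \<Longrightarrow> f (delta K u) (delta K v) (delta K w) = g (delta K u) (delta K v) (delta K w)"
    and pqr: "p \<in> carrier (free_mod K S)" "q \<in> carrier (free_mod K T)" "r \<in> carrier (free_mod K U)"
  shows "f p q r = g p q r"
proof (rule free_mod_eqI[OF W f1[OF pqr(2,3)] g1[OF pqr(2,3)] pqr(1)])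
  fix u assume u: "u \<in> S"
  show "f (delta K u) q r = g (delta K u) q r"
  proof (rule free_mod_eqI[OF W f2[OF u pqr(3)] g2[OF u pqr(3)] pqr(2)])
    fix v assume v: "v \<in> T"
    show "f (delta K u) (delta K v) r = g (delta K u) (delta K v) r"
      by (rule free_mod_eqI[OF W f3[OF u v] g3[OF u v] pqr(3) eq[OF u v]])
  qed
qed

context nonunital_algebra
begin

lemma linear_mult_right: "x \<in> carrier A \<Longrightarrow> linear_map K A A (\<lambda>y. x \<otimes>\<^bsub>A\<^esub> y)"
  using bilinear_opD(1)[OF mult_bilinear] by simp

lemma linear_mult_left: "y \<in> carrier A \<Longrightarrow> linear_map K A A (\<lambda>x. x \<otimes>\<^bsub>A\<^esub> y)"
  by (rule bilinear_opD(2)[OF mult_bilinear])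

lemma mult_closed: "\<lbrakk>x \<in> carrier A; y \<in> carrier A\<rbrakk> \<Longrightarrow> x \<otimes>\<^bsub>A\<^esub> y \<in> carrier A"
  using linear_map_closed[OF linear_mult_right] by blast

end

section \<open>Surjective images and quotients\<close>

text \<open>Every axiom is checked on preimages. The condition on zero is stated separately because
  linearity yields it only once \<open>W\<close> is known to be a module.\<close>

lemma module_image:
  assumes V: "module K V" and f: "linear_map K V W f"
    and surj: "f ` carrier V = carrier W" and zero: "f \<zero>\<^bsub>V\<^esub> = \<zero>\<^bsub>W\<^esub>"
  shows "module K W"
proof -
  interpret V: module K V by fact
  note hom = linear_map_add[OF f, symmetric] linear_map_smult[OF f, symmetric] zero[symmetric]
  have closed: "x \<in> carrier V \<Longrightarrow> f x \<in> carrier W" for x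
    by (rule linear_map_closed[OF f])
  have ex: "\<exists>x\<in>carrier V. y = f x" if "y \<in> carrier W" for y
    using that surj by blast
  show ?thesis
  proof (intro moduleI abelian_groupI V.is_cring)
    fix x y assume "x \<in> carrier W" "y \<in> carrier W"
    then obtain a b where ab: "a \<in> carrier V" "b \<in> carrier V" "x = f a" "y = f b"
      unfolding surj[symmetric] by blast
    show "x \<oplus>\<^bsub>W\<^esub> y \<in> carrier W" using ab by (simp add: hom closed)
    show "x \<oplus>\<^bsub>W\<^esub> y = y \<oplus>\<^bsub>W\<^esub> x" using ab by (simp add: hom V.M.a_comm)
    {
      fix z assume "z \<in> carrier W"
      then obtain c where c: "c \<in> carrier V" "z = f c" unfolding surj[symmetric] by blast
      show "x \<oplus>\<^bsub>W\<^esub> y \<oplus>\<^bsub>W\<^esub> z = x \<oplus>\<^bsub>W\<^esub> (y \<oplus>\<^bsub>W\<^esub> z)"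
        using ab c by (simp add: hom V.M.a_assoc)
    }
    fix r assume r: "r \<in> carrier K"
    show "r \<odot>\<^bsub>W\<^esub> (x \<oplus>\<^bsub>W\<^esub> y) = r \<odot>\<^bsub>W\<^esub> x \<oplus>\<^bsub>W\<^esub> r \<odot>\<^bsub>W\<^esub> y"
      using ab r by (simp add: hom V.smult_r_distr)
  next
    fix x assume "x \<in> carrier W"
    then obtain a where a: "a \<in> carrier V" "x = f a" unfolding surj[symmetric] by blast
    show "\<zero>\<^bsub>W\<^esub> \<oplus>\<^bsub>W\<^esub> x = x" using a by (simp add: hom)
    show "\<one>\<^bsub>K\<^esub> \<odot>\<^bsub>W\<^esub> x = x" using a by (simp add: hom)
    have "f (\<ominus>\<^bsub>V\<^esub> a) \<oplus>\<^bsub>W\<^esub> x = \<zero>\<^bsub>W\<^esub>" using a by (simp add: hom V.M.l_neg)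
    then show "\<exists>y\<in>carrier W. y \<oplus>\<^bsub>W\<^esub> x = \<zero>\<^bsub>W\<^esub>" using a closed by blast
    fix r assume r: "r \<in> carrier K"
    show "r \<odot>\<^bsub>W\<^esub> x \<in> carrier W" using a r by (simp add: hom closed)
    fix s assume s: "s \<in> carrier K"
    show "(r \<oplus>\<^bsub>K\<^esub> s) \<odot>\<^bsub>W\<^esub> x = r \<odot>\<^bsub>W\<^esub> x \<oplus>\<^bsub>W\<^esub> s \<odot>\<^bsub>W\<^esub> x"
      using a r s by (simp add: hom V.smult_l_distr)
    show "(r \<otimes>\<^bsub>K\<^esub> s) \<odot>\<^bsub>W\<^esub> x = r \<odot>\<^bsub>W\<^esub> (s \<odot>\<^bsub>W\<^esub> x)"
      using a r s by (simp add: hom V.smult_assoc1)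
  qed (simp add: hom closed)
qed

lemma module_mult_update:
  assumes "module K V"
  shows "module K (V\<lparr>mult := m\<rparr>)"
  by (rule module_image[OF assms, where f = "\<lambda>x. x"]) (simp_all add: linear_map_def)

lemma linear_map_mult_update:
  "linear_map K (V\<lparr>mult := m\<rparr>) W f \<longleftrightarrow> linear_map K V W f"
  "linear_map K V (W\<lparr>mult := n\<rparr>) f \<longleftrightarrow> linear_map K V W f"
  by (simp_all add: linear_map_def)

lemma bilinear_op_image:
  assumes f: "linear_map K V W f" and surj: "f ` carrier V = carrier W"
    and m: "bilinear_op K V m"
    and hom: "\<And>x y. \<lbrakk>x \<in> carrier V; y \<in> carrier V\<rbrakk> \<Longrightarrow> f (m x y) = m' (f x) (f y)"
    and V: "module K V"
  shows "bilinear_op K W m'"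
proof -
  interpret V: module K V by fact
  have ex: "\<exists>x\<in>carrier V. y = f x" if "y \<in> carrier W" for y
    using that surj by blast
  note lin = linear_map_add[OF f, symmetric] linear_map_smult[OF f, symmetric] hom[symmetric]
  note closed = linear_map_closed[OF f]
  note m1 = linear_map_closed[OF bilinear_opD(1)[OF m]] linear_map_add[OF bilinear_opD(1)[OF m]]
    linear_map_smult[OF bilinear_opD(1)[OF m]]
  note m2 = linear_map_add[OF bilinear_opD(2)[OF m]] linear_map_smult[OF bilinear_opD(2)[OF m]]
  show ?thesis
    unfolding bilinear_op_def
  proof (intro conjI ballI linear_mapI)
    fix x y assume "x \<in> carrier W" "y \<in> carrier W"
    then obtain a b where ab: "a \<in> carrier V" "b \<in> carrier V" "x = f a" "y = f b"
      unfolding surj[symmetric] by blast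
    show "m' x y \<in> carrier W" "m' y x \<in> carrier W" using ab by (simp_all add: lin m1 closed)
    {
      fix z assume "z \<in> carrier W"
      then obtain c where c: "c \<in> carrier V" "z = f c" unfolding surj[symmetric] by blast
      show "m' x (y \<oplus>\<^bsub>W\<^esub> z) = m' x y \<oplus>\<^bsub>W\<^esub> m' x z"
        "m' (y \<oplus>\<^bsub>W\<^esub> z) x = m' y x \<oplus>\<^bsub>W\<^esub> m' z x"
        using ab c by (simp_all add: lin m1 m2)
    }
  next
    fix r x y assume "r \<in> carrier K" "x \<in> carrier W" "y \<in> carrier W"
    then obtain a b where ab: "a \<in> carrier V" "b \<in> carrier V" "x = f a" "y = f b" "r \<in> carrier K"
      unfolding surj[symmetric] by blast
    show "m' x (r \<odot>\<^bsub>W\<^esub> y) = r \<odot>\<^bsub>W\<^esub> m' x y" "m' (r \<odot>\<^bsub>W\<^esub> y) x = r \<odot>\<^bsub>W\<^esub> m' y x"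
      using ab by (simp_all add: lin m1 m2)
  qed
qed

lemma nonunital_algebra_image:
  assumes A: "nonunital_algebra K A" and f: "linear_map K A B f"
    and surj: "f ` carrier A = carrier B" and zero: "f \<zero>\<^bsub>A\<^esub> = \<zero>\<^bsub>B\<^esub>"
    and hom: "\<And>x y. \<lbrakk>x \<in> carrier A; y \<in> carrier A\<rbrakk> \<Longrightarrow> f (x \<otimes>\<^bsub>A\<^esub> y) = f x \<otimes>\<^bsub>B\<^esub> f y"
  shows "nonunital_algebra K B"
proof -
  interpret A: nonunital_algebra K A by fact
  have ex: "\<exists>x\<in>carrier A. y = f x" if "y \<in> carrier B" for y
    using that surj by blast
  show ?thesis
  proof (intro nonunital_algebra.intro nonunital_algebra_axioms.intro)
    show "module K B" by (rule module_image[OF A.module_axioms f surj zero])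
    show "bilinear_op K B (\<otimes>\<^bsub>B\<^esub>)"
      using f surj A.mult_bilinear _ A.module_axioms by (rule bilinear_op_image) (rule hom)
    fix x y z assume xyz: "x \<in> carrier B" "y \<in> carrier B" "z \<in> carrier B"
    obtain a where "a \<in> carrier A" "x = f a" using ex[OF xyz(1)] by blast
    moreover obtain b where "b \<in> carrier A" "y = f b" using ex[OF xyz(2)] by blast
    moreover obtain c where "c \<in> carrier A" "z = f c" using ex[OF xyz(3)] by blast
    ultimately show "x \<otimes>\<^bsub>B\<^esub> y \<otimes>\<^bsub>B\<^esub> z = x \<otimes>\<^bsub>B\<^esub> (y \<otimes>\<^bsub>B\<^esub> z)"
      by (simp add: hom[symmetric] A.mult_closed A.mult_assoc)
  qed
qed

lemma nijenhuis_algebra_image: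
  assumes A: "nijenhuis_algebra K A P" and f: "linear_map K A B f"
    and surj: "f ` carrier A = carrier B" and zero: "f \<zero>\<^bsub>A\<^esub> = \<zero>\<^bsub>B\<^esub>"
    and hom: "\<And>x y. \<lbrakk>x \<in> carrier A; y \<in> carrier A\<rbrakk> \<Longrightarrow> f (x \<otimes>\<^bsub>A\<^esub> y) = f x \<otimes>\<^bsub>B\<^esub> f y"
    and op: "\<And>x. x \<in> carrier A \<Longrightarrow> f (P x) = Q (f x)"
  shows "nijenhuis_algebra K B Q"
proof -
  interpret A: nijenhuis_algebra K A P by fact
  have B: "nonunital_algebra K B"
    by (rule nonunital_algebra_image[OF A.nonunital_algebra_axioms f surj zero hom])
  interpret B: nonunital_algebra K B by fact
  have ex: "\<exists>x\<in>carrier A. y = f x" if "y \<in> carrier B" for y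
    using that surj by blast
  note Pc = linear_map_closed[OF A.op_linear]
  note lin = linear_map_add[OF f, symmetric] linear_map_smult[OF f, symmetric] hom[symmetric]
    op[symmetric] linear_map_minus[OF A.module_axioms B.module_axioms f, symmetric]
  show ?thesis
  proof (intro nijenhuis_algebra.intro nijenhuis_algebra_axioms.intro B linear_mapI)
    fix x y assume "x \<in> carrier B" "y \<in> carrier B"
    then obtain a b where ab: "a \<in> carrier A" "b \<in> carrier A" "x = f a" "y = f b"
      unfolding surj[symmetric] by blast
    then show "Q (x \<oplus>\<^bsub>B\<^esub> y) = Q x \<oplus>\<^bsub>B\<^esub> Q y"
      by (simp add: lin Pc linear_map_add[OF A.op_linear])
    show "Q x \<otimes>\<^bsub>B\<^esub> Q y = Q (Q x \<otimes>\<^bsub>B\<^esub> y) \<oplus>\<^bsub>B\<^esub> Q (x \<otimes>\<^bsub>B\<^esub> Q y) \<ominus>\<^bsub>B\<^esub> Q (Q (x \<otimes>\<^bsub>B\<^esub> y))"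
      using ab by (simp add: lin Pc A.mult_closed A.nijenhuis)
  next
    fix x assume "x \<in> carrier B"
    then obtain a where a: "a \<in> carrier A" "x = f a" unfolding surj[symmetric] by blast
    then show "Q x \<in> carrier B" by (simp add: lin Pc linear_map_closed[OF f])
    fix c assume "c \<in> carrier K"
    then show "Q (c \<odot>\<^bsub>B\<^esub> x) = c \<odot>\<^bsub>B\<^esub> Q x"
      using a by (simp add: lin Pc linear_map_smult[OF A.op_linear])
  qed
qed

text \<open>Preimages are picked by choice, which is harmless because \<open>h\<close> is constant
  on the fibres of \<open>p\<close>. The restriction to \<open>D\<close> makes the factor
  extensional, as the uniqueness statement will require.\<close>

lemma factor_through_surj:
  assumes surj: "p ` C = D" and eq: "\<And>x y. \<lbrakk>x \<in> C; y \<in> C; p x = p y\<rbrakk> \<Longrightarrow> h x = h y"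
  obtains g where "g \<in> extensional D" "\<And>x. x \<in> C \<Longrightarrow> g (p x) = h x"
proof
  let ?g = "restrict (\<lambda>d. h (SOME x. x \<in> C \<and> p x = d)) D"
  show "?g \<in> extensional D" by simp
  fix x assume x: "x \<in> C"
  then have "(SOME y. y \<in> C \<and> p y = p x) \<in> C \<and> p (SOME y. y \<in> C \<and> p y = p x) = p x"
    by (intro someI[of "\<lambda>y. y \<in> C \<and> p y = p x"]) simp
  then have "h (SOME y. y \<in> C \<and> p y = p x) = h x"
    using x by (intro eq) simp_all
  moreover have "p x \<in> D" using x surj by blast
  ultimately show "?g (p x) = h x" by simp
qed

lemma linear_map_factor:
  assumes p: "linear_map K V U p" "p ` carrier V = carrier U" and h: "linear_map K V W h"
    and g: "\<And>x. x \<in> carrier V \<Longrightarrow> g (p x) = h x" and V: "module K V"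
  shows "linear_map K U W g"
proof -
  interpret V: module K V by fact
  have ex: "\<exists>x\<in>carrier V. y = p x" if "y \<in> carrier U" for y
    using that p(2) by blast
  show ?thesis
  proof (rule linear_mapI)
    fix x assume "x \<in> carrier U"
    then obtain a where a: "a \<in> carrier V" "x = p a" unfolding p(2)[symmetric] by blast
    then show "g x \<in> carrier W" using linear_map_closed[OF h] by (simp add: g)
    {
      fix c assume "c \<in> carrier K"
      then show "g (c \<odot>\<^bsub>U\<^esub> x) = c \<odot>\<^bsub>W\<^esub> g x"
        using a by (simp add: g linear_map_smult[OF p(1), symmetric] linear_map_smult[OF h])
    }
    fix y assume "y \<in> carrier U"
    then obtain b where "b \<in> carrier V" "y = p b" unfolding p(2)[symmetric] by blast
    then show "g (x \<oplus>\<^bsub>U\<^esub> y) = g x \<oplus>\<^bsub>W\<^esub> g y"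
      using a by (simp add: g linear_map_add[OF p(1), symmetric] linear_map_add[OF h])
  qed
qed

lemma nijenhuis_hom_factor:
  assumes p: "nijenhuis_hom K A P U R p" "p ` carrier A = carrier U"
    and h: "nijenhuis_hom K A P N Q h"
    and g: "\<And>x. x \<in> carrier A \<Longrightarrow> g (p x) = h x" and A: "nijenhuis_algebra K A P"
  shows "nijenhuis_hom K U R N Q g"
proof -
  interpret A: nijenhuis_algebra K A P by fact
  have pl: "linear_map K A U p"
    and pm: "\<And>x y. \<lbrakk>x \<in> carrier A; y \<in> carrier A\<rbrakk> \<Longrightarrow> p x \<otimes>\<^bsub>U\<^esub> p y = p (x \<otimes>\<^bsub>A\<^esub> y)"
    and po: "\<And>x. x \<in> carrier A \<Longrightarrow> R (p x) = p (P x)"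
    using p(1) by (auto simp: nijenhuis_hom_def)
  have hl: "linear_map K A N h"
    and hm: "\<And>x y. \<lbrakk>x \<in> carrier A; y \<in> carrier A\<rbrakk> \<Longrightarrow> h (x \<otimes>\<^bsub>A\<^esub> y) = h x \<otimes>\<^bsub>N\<^esub> h y"
    and ho: "\<And>x. x \<in> carrier A \<Longrightarrow> h (P x) = Q (h x)"
    using h by (auto simp: nijenhuis_hom_def)
  have "linear_map K U N g"
    by (rule linear_map_factor[OF pl p(2) hl g A.module_axioms])
  moreover have "g (x \<otimes>\<^bsub>U\<^esub> y) = g x \<otimes>\<^bsub>N\<^esub> g y" if xy: "x \<in> carrier U" "y \<in> carrier U" for x y
  proof -
    obtain a b where "a \<in> carrier A" "x = p a" "b \<in> carrier A" "y = p b"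
      using xy p(2) by blast
    then show ?thesis by (simp add: pm g A.mult_closed hm)
  qed
  moreover have "g (R x) = Q (g x)" if x: "x \<in> carrier U" for x
  proof -
    obtain a where "a \<in> carrier A" "x = p a" using x p(2) by blast
    then show ?thesis by (simp add: po g linear_map_closed[OF A.op_linear] ho)
  qed
  ultimately show ?thesis
    unfolding nijenhuis_hom_def by blast
qed

section \<open>Cosets and the operations they inherit\<close>

lemma submodule_abelian_subgroup:
  assumes V: "module K V" and J: "submodule J K V"
  shows "abelian_subgroup J V"
proof -
  interpret V: module K V by fact
  interpret J: submodule J K V by fact
  show ?thesis
    by (rule abelian_subgroupI3[OF additive_subgroupI[OF J.subgroup_axioms] V.abelian_group_axioms])
qed

lemma a_coset_eq_iff:
  assumes V: "module K V" and J: "submodule J K V" and x: "x \<in> carrier V" "y \<in> carrier V"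
  shows "J +>\<^bsub>V\<^esub> x = J +>\<^bsub>V\<^esub> y \<longleftrightarrow> x \<ominus>\<^bsub>V\<^esub> y \<in> J"
proof -
  interpret V: module K V by fact
  interpret J: abelian_subgroup J V by (rule submodule_abelian_subgroup[OF V J])
  have "x \<ominus>\<^bsub>V\<^esub> y \<in> J \<longleftrightarrow> x \<in> J +>\<^bsub>V\<^esub> y"
    using J.a_rcos_module[OF x(2) x(1)] by (simp add: a_minus_def)
  then show ?thesis
    using J.a_repr_independence' J.a_rcos_self x by metis
qed

text \<open>Operations on cosets are defined as unions over representatives; such a union is a
  single coset as soon as the result does not depend on the representative.\<close>

lemma coset_UN:
  assumes "x \<in> S" "\<And>a. a \<in> S \<Longrightarrow> J +>\<^bsub>V\<^esub> h a = J +>\<^bsub>V\<^esub> h x"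
  shows "(\<Union>a\<in>S. J +>\<^bsub>V\<^esub> h a) = J +>\<^bsub>V\<^esub> h x"
  using assms by blast

lemma coset_memD:
  assumes V: "module K V" and J: "submodule J K V" and x: "x \<in> carrier V" and a: "a \<in> J +>\<^bsub>V\<^esub> x"
  shows "a \<in> carrier V" "a \<ominus>\<^bsub>V\<^esub> x \<in> J"
proof -
  interpret V: module K V by fact
  interpret J: abelian_subgroup J V by (rule submodule_abelian_subgroup[OF V J])
  show "a \<in> carrier V" by (rule J.a_elemrcos_carrier[OF x a])
  show "a \<ominus>\<^bsub>V\<^esub> x \<in> J"
    using J.a_rcos_module_imp[OF x a] by (simp add: a_minus_def)
qed

lemma coset_self:
  assumes V: "module K V" and J: "submodule J K V" and x: "x \<in> carrier V"
  shows "x \<in> J +>\<^bsub>V\<^esub> x"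
  by (rule abelian_subgroup.a_rcos_self[OF submodule_abelian_subgroup[OF V J] x])

text \<open>Two representatives differ by an element of \<open>J\<close>, so their images differ by
  an element of \<open>I\<close>. Scalar multiplication and the induced operator are both
  instances.\<close>

lemma linear_coset_UN:
  assumes V: "module K V" and J: "submodule J K V" and W: "module K W" and I: "submodule I K W"
    and h: "linear_map K V W h" and hJ: "\<And>a. a \<in> J \<Longrightarrow> h a \<in> I" and x: "x \<in> carrier V"
  shows "(\<Union>a\<in>J +>\<^bsub>V\<^esub> x. I +>\<^bsub>W\<^esub> h a) = I +>\<^bsub>W\<^esub> h x"
proof (rule coset_UN)
  show "x \<in> J +>\<^bsub>V\<^esub> x" by (rule coset_self[OF V J x])
  fix a assume "a \<in> J +>\<^bsub>V\<^esub> x"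
  note a = coset_memD[OF V J x this]
  show "I +>\<^bsub>W\<^esub> h a = I +>\<^bsub>W\<^esub> h x"
    using a_coset_eq_iff[OF W I linear_map_closed[OF h a(1)] linear_map_closed[OF h x]]
      linear_map_minus[OF V W h a(1) x] hJ[OF a(2)] by simp
qed

text \<open>The inner union collapses for each fixed \<open>a\<close>, then the outer one does.
  Three modules are allowed because the product of tensors leads from two degrees to a
  third.\<close>

lemma bilinear_coset_UN:
  assumes V: "module K V" "submodule J K V" and V': "module K V'" "submodule J' K V'"
    and W: "module K W" "submodule I K W"
    and h1: "\<And>b. b \<in> carrier V' \<Longrightarrow> linear_map K V W (\<lambda>a. h a b)"
    and h2: "\<And>a. a \<in> carrier V \<Longrightarrow> linear_map K V' W (h a)"
    and hJ1: "\<And>a b. \<lbrakk>a \<in> J; b \<in> carrier V'\<rbrakk> \<Longrightarrow> h a b \<in> I"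
    and hJ2: "\<And>a b. \<lbrakk>a \<in> carrier V; b \<in> J'\<rbrakk> \<Longrightarrow> h a b \<in> I"
    and x: "x \<in> carrier V" and y: "y \<in> carrier V'"
  shows "(\<Union>a\<in>J +>\<^bsub>V\<^esub> x. \<Union>b\<in>J' +>\<^bsub>V'\<^esub> y. I +>\<^bsub>W\<^esub> h a b) = I +>\<^bsub>W\<^esub> h x y"
proof -
  have "(\<Union>b\<in>J' +>\<^bsub>V'\<^esub> y. I +>\<^bsub>W\<^esub> h a b) = I +>\<^bsub>W\<^esub> h a y" if "a \<in> J +>\<^bsub>V\<^esub> x" for a
    using coset_memD(1)[OF V x that] by (intro linear_coset_UN[OF V' W] h2 hJ2 y)
  then have "(\<Union>a\<in>J +>\<^bsub>V\<^esub> x. \<Union>b\<in>J' +>\<^bsub>V'\<^esub> y. I +>\<^bsub>W\<^esub> h a b) = (\<Union>a\<in>J +>\<^bsub>V\<^esub> x. I +>\<^bsub>W\<^esub> h a y)"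
    by simp
  also have "\<dots> = I +>\<^bsub>W\<^esub> h x y"
    by (rule linear_coset_UN[OF V W h1 hJ1[OF _ y] x]) (fact y)
  finally show ?thesis .
qed

lemma quot_alg_simps:
  "carrier (quot_alg V J) = (\<lambda>x. J +>\<^bsub>V\<^esub> x) ` carrier V"
  "\<zero>\<^bsub>quot_alg V J\<^esub> = J"
  "S \<oplus>\<^bsub>quot_alg V J\<^esub> T = S <+>\<^bsub>V\<^esub> T"
  "S \<otimes>\<^bsub>quot_alg V J\<^esub> T = rcoset_mult V J S T"
  "c \<odot>\<^bsub>quot_alg V J\<^esub> S = (\<Union>a\<in>S. J +>\<^bsub>V\<^esub> (c \<odot>\<^bsub>V\<^esub> a))"
  by (auto simp: quot_alg_def A_RCOSETS_def')

text \<open>The conditions pass to intersections, and the carrier, one of the submodules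
  intersected, bounds the hull.\<close>

lemma submodule_hull:
  assumes V: "module K V" and G: "G \<subseteq> carrier V"
  shows "submodule ((\<lambda>H. submodule H K V) hull G) K V"
proof -
  interpret V: module K V by fact
  let ?J = "(\<lambda>H. submodule H K V) hull G"
  have sub: "?J \<subseteq> H" if "submodule H K V" "G \<subseteq> H" for H
    using that by (intro hull_minimal)
  have memI: "a \<in> ?J" if "\<And>H. \<lbrakk>submodule H K V; G \<subseteq> H\<rbrakk> \<Longrightarrow> a \<in> H" for a
    using that unfolding hull_def by blast
  show ?thesis
  proof (rule V.submoduleI)
    show "?J \<subseteq> carrier V" by (rule sub[OF V.carrier_is_submodule G])
    show "\<zero>\<^bsub>V\<^esub> \<in> ?J"
      by (rule memI) (simp add: submodule.axioms(1)[THEN subgroup.one_closed, simplified])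
    show "\<ominus>\<^bsub>V\<^esub> a \<in> ?J" if "a \<in> ?J" for a
      using that sub by (intro memI) (blast intro: V.submoduleE(3))
    show "a \<oplus>\<^bsub>V\<^esub> b \<in> ?J" if "a \<in> ?J" "b \<in> ?J" for a b
      using that sub by (intro memI) (blast intro: V.submoduleE(5))
    show "c \<odot>\<^bsub>V\<^esub> a \<in> ?J" if "c \<in> carrier K" "a \<in> ?J" for c a
      using that sub by (intro memI) (blast intro: V.submoduleE(4))
  qed
qed

text \<open>With \<open>I\<close> a submodule of relations this propagates an inclusion from
  generators to their hull; with \<open>I\<close> zero it shows that kernels are submodules.\<close>

lemma submodule_vimage:
  assumes V: "module K V" and W: "module K W" and I: "submodule I K W" and h: "linear_map K V W h"
  shows "submodule {x \<in> carrier V. h x \<in> I} K V"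
proof -
  interpret V: module K V by fact
  interpret W: module K W by fact
  interpret I: submodule I K W by fact
  show ?thesis
    by (rule V.submoduleI)
      (use I.one_closed W.submoduleE(3-5)[OF I] in \<open>simp_all add: linear_map_zero[OF V W h] subset_iff
        linear_map_uminus[OF V W h] linear_map_add[OF h] linear_map_smult[OF h]\<close>)
qed

lemma submodule_zero: "module K V \<Longrightarrow> submodule {\<zero>\<^bsub>V\<^esub>} K V"
proof -
  assume "module K V"
  then interpret V: module K V .
  show ?thesis by (rule V.submoduleI) simp_all
qed

lemma linear_map_free_mod_mem:
  fixes S :: "'w set" and W :: "('k, 'b, 'z) module_scheme"
  assumes W: "module K W" and I: "submodule I K W" and h: "linear_map K (free_mod K S) W h"
    and d: "\<And>w. w \<in> S \<Longrightarrow> h (delta K w) \<in> I" and p: "p \<in> carrier (free_mod K S)"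
  shows "h p \<in> I"
proof -
  interpret W: module K W by fact
  interpret I: submodule I K W by fact
  have sum: "finsum W g B \<in> I" if "finite B" "\<And>b. b \<in> B \<Longrightarrow> g b \<in> I" for g :: "'w \<Rightarrow> 'b" and B
    using that
  proof induction
    case empty
    then show ?case using I.one_closed by simp
  next
    case (insert b B)
    then have "finsum W g (insert b B) = g b \<oplus>\<^bsub>W\<^esub> finsum W g B"
      using I.subset by (intro W.M.finsum_insert) auto
    then show ?case using insert W.submoduleE(5)[OF I] by simp
  qed
  show ?thesis
    unfolding linear_map_free_mod[OF W h p] lin_ext_def
    using free_mod_carrierD[OF p] d W.submoduleE(4)[OF I] by (intro sum) auto
qed

lemma quot_map_linear:
  assumes V: "module K V" and J: "submodule J K V"
  shows "linear_map K V (quot_alg V J) (\<lambda>x. J +>\<^bsub>V\<^esub> x)"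
proof -
  interpret V: module K V by fact
  interpret J: abelian_subgroup J V by (rule submodule_abelian_subgroup[OF V J])
  show ?thesis
  proof (rule linear_mapI)
    fix c x assume c: "c \<in> carrier K" and x: "x \<in> carrier V"
    \<comment> \<open>Scaling by a fixed \<open>c\<close> is itself linear because \<open>K\<close>
      is commutative, and it preserves \<open>J\<close>, so scalar multiplication of cosets is an
      induced linear map.\<close>
    have "linear_map K V V (\<lambda>x. c \<odot>\<^bsub>V\<^esub> x)"
      by (rule linear_mapI)
        (use c in \<open>simp_all add: V.smult_r_distr V.smult_assoc1[symmetric] V.R.m_comm\<close>)
    then show "J +>\<^bsub>V\<^esub> (c \<odot>\<^bsub>V\<^esub> x) = c \<odot>\<^bsub>quot_alg V J\<^esub> (J +>\<^bsub>V\<^esub> x)"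
      unfolding quot_alg_simps
      by (intro linear_coset_UN[OF V J V J, symmetric] V.submoduleE(4)[OF J c] x)
  qed (simp_all add: quot_alg_simps J.a_rcos_sum)
qed

lemma quot_map_zero:
  assumes V: "module K V" and J: "submodule J K V"
  shows "J +>\<^bsub>V\<^esub> \<zero>\<^bsub>V\<^esub> = \<zero>\<^bsub>quot_alg V J\<^esub>"
proof -
  interpret V: module K V by fact
  show ?thesis
    using V.submoduleE(1)[OF J] by (simp add: quot_alg_simps V.M.a_coset_add_zero)
qed

lemma quot_alg_module:
  assumes V: "module K V" and J: "submodule J K V"
  shows "module K (quot_alg V J)"
  by (rule module_image[OF V quot_map_linear[OF V J] quot_alg_simps(1)[symmetric] quot_map_zero[OF V J]])

text \<open>The two sides of the ideal condition are the two vanishing conditions for a bilinear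
  operation on cosets, and stability under \<open>P\<close> is the one for the operator. The
  Nijenhuis identity is then transported along the quotient map.\<close>

lemma nijenhuis_quotient:
  assumes A: "nijenhuis_algebra K A P" and J: "nijenhuis_ideal K A P J"
  shows "nijenhuis_hom K A P (quot_alg A J) (quot_op A J P) (\<lambda>x. J +>\<^bsub>A\<^esub> x)"
    and "nijenhuis_algebra K (quot_alg A J) (quot_op A J P)"
proof -
  interpret A: nijenhuis_algebra K A P by fact
  note V = A.module_axioms
  have sub: "submodule J K A" and opJ: "\<And>x. x \<in> J \<Longrightarrow> P x \<in> J"
    and l: "\<And>a x. \<lbrakk>a \<in> carrier A; x \<in> J\<rbrakk> \<Longrightarrow> a \<otimes>\<^bsub>A\<^esub> x \<in> J"
    and r: "\<And>a x. \<lbrakk>x \<in> J; a \<in> carrier A\<rbrakk> \<Longrightarrow> x \<otimes>\<^bsub>A\<^esub> a \<in> J"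
    using J by (auto simp: nijenhuis_ideal_def)
  note lin = quot_map_linear[OF V sub]
  have mult: "J +>\<^bsub>A\<^esub> (x \<otimes>\<^bsub>A\<^esub> y) = (J +>\<^bsub>A\<^esub> x) \<otimes>\<^bsub>quot_alg A J\<^esub> (J +>\<^bsub>A\<^esub> y)"
    if "x \<in> carrier A" "y \<in> carrier A" for x y
    unfolding quot_alg_simps rcoset_mult_def
    by (rule bilinear_coset_UN[OF V sub V sub V sub, symmetric])
      (use that l r bilinear_opD[OF A.mult_bilinear] in simp_all)
  have op: "J +>\<^bsub>A\<^esub> P x = quot_op A J P (J +>\<^bsub>A\<^esub> x)" if "x \<in> carrier A" for x
    unfolding quot_op_def
    by (rule linear_coset_UN[OF V sub V sub A.op_linear opJ that, symmetric])
  show "nijenhuis_hom K A P (quot_alg A J) (quot_op A J P) (\<lambda>x. J +>\<^bsub>A\<^esub> x)"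
    unfolding nijenhuis_hom_def using lin mult op by blast
  show "nijenhuis_algebra K (quot_alg A J) (quot_op A J P)"
    by (rule nijenhuis_algebra_image[OF A lin quot_alg_simps(1)[symmetric] quot_map_zero[OF V sub] mult op])
qed

section \<open>Products of lists in a nonunital algebra\<close>

text \<open>There is no unit to start from, hence the separate clause for one factor. The zero given
  to the empty list is only a default and not neutral, so product laws for lists require nonempty
  lists.\<close>

fun list_mult :: "('k, 'a, 'z) module_scheme \<Rightarrow> 'a list \<Rightarrow> 'a"
  where
    "list_mult A [] = \<zero>\<^bsub>A\<^esub>"
  | "list_mult A [a] = a"
  | "list_mult A (a # b # w) = a \<otimes>\<^bsub>A\<^esub> list_mult A (b # w)"

context nonunital_algebra
begin

lemma list_mult_closed: "set w \<subseteq> carrier A \<Longrightarrow> list_mult A w \<in> carrier A"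
  by (induction w rule: induct_list012) (simp_all add: mult_closed)

lemma list_mult_Cons: "w \<noteq> [] \<Longrightarrow> list_mult A (a # w) = a \<otimes>\<^bsub>A\<^esub> list_mult A w"
  by (cases w) simp_all

lemma list_mult_append:
  assumes "u \<noteq> []" "v \<noteq> []" "set u \<subseteq> carrier A" "set v \<subseteq> carrier A"
  shows "list_mult A (u @ v) = list_mult A u \<otimes>\<^bsub>A\<^esub> list_mult A v"
  using assms
proof (induction u)
  case (Cons a u)
  show ?case
  proof (cases "u = []")
    case True
    then show ?thesis using Cons.prems by (simp add: list_mult_Cons)
  next
    case False
    then show ?thesis
      using Cons by (simp add: list_mult_Cons mult_assoc list_mult_closed)
  qed
qed simp

text \<open>Used twice: with \<open>f\<close> an NS homomorphism it makes the multilinearity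
  relations vanish, and with \<open>f\<close> the identity it lets one factor vary inside the
  evaluation of a word. The case distinctions on empty \<open>us\<close> and \<open>vs\<close> are
  due to the missing unit.\<close>

lemma list_mult_multilinear:
  assumes V: "module K V" and f: "linear_map K V A f" and us: "set us \<subseteq> carrier A" and vs: "set vs \<subseteq> carrier A"
  shows "linear_map K V A (\<lambda>x. list_mult A (us @ [f x] @ vs))"
proof -
  have fc: "x \<in> carrier V \<Longrightarrow> f x \<in> carrier A" for x by (rule linear_map_closed[OF f])
  have r: "linear_map K V A (\<lambda>x. list_mult A ([f x] @ vs))"
  proof (cases "vs = []")
    case True
    then show ?thesis using f by simp
  next
    case False
    show ?thesis
      by (rule linear_map_cong[OF V linear_map_comp[OF linear_mult_left[OF list_mult_closed[OF vs]] f]])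
        (simp add: False list_mult_Cons)
  qed
  show ?thesis
  proof (cases "us = []")
    case True
    then show ?thesis using r by simp
  next
    case False
    show ?thesis
    proof (rule linear_map_cong[OF V linear_map_comp[OF linear_mult_right[OF list_mult_closed[OF us]] r]])
      fix x assume "x \<in> carrier V"
      then show "list_mult A us \<otimes>\<^bsub>A\<^esub> list_mult A ([f x] @ vs) = list_mult A (us @ [f x] @ vs)"
        by (intro list_mult_append[symmetric] False us) (use vs fc in auto)
    qed
  qed
qed

end

section \<open>The reduced tensor algebra\<close>

text \<open>The double extension from \<open>tensor_mult\<close>, with the index set as a parameter,
  so that tuples of a fixed length and all nonempty tuples are covered together.\<close>

definition conc :: "('k, 'y) ring_scheme \<Rightarrow> 'a list set \<Rightarrow> ('a list \<Rightarrow> 'k) \<Rightarrow> ('a list \<Rightarrow> 'k) \<Rightarrow> 'a list \<Rightarrow> 'k"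
  where "conc K S p q =
    lin_ext K (free_mod K S) (\<lambda>us. lin_ext K (free_mod K S) (\<lambda>vs. delta K (us @ vs)) q) p"

lemma conc_linear:
  assumes K: "cring K" and S: "\<And>u v. \<lbrakk>u \<in> A; v \<in> B\<rbrakk> \<Longrightarrow> u @ v \<in> S"
  shows "q \<in> carrier (free_mod K B) \<Longrightarrow> linear_map K (free_mod K A) (free_mod K S) (\<lambda>p. conc K S p q)"
    and "p \<in> carrier (free_mod K A) \<Longrightarrow> linear_map K (free_mod K B) (free_mod K S) (conc K S p)"
proof -
  note F = free_mod_module[OF K]
  have d: "delta K (u @ v) \<in> carrier (free_mod K S)" if "u \<in> A" "v \<in> B" for u v
    by (rule delta_closed[OF K S[OF that]])
  have l: "linear_map K (free_mod K B) (free_mod K S) (lin_ext K (free_mod K S) (\<lambda>vs. delta K (us @ vs)))"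
    if "us \<in> A" for us
    by (rule linear_map_lin_ext[OF F d[OF that]])
  show "linear_map K (free_mod K A) (free_mod K S) (\<lambda>p. conc K S p q)" if "q \<in> carrier (free_mod K B)"
    unfolding conc_def by (rule linear_map_lin_ext[OF F linear_map_closed[OF l that]])
  show "linear_map K (free_mod K B) (free_mod K S) (conc K S p)" if "p \<in> carrier (free_mod K A)"
    unfolding conc_def by (rule linear_map_lin_ext_param[OF F that l])
qed

lemma conc_delta:
  assumes K: "cring K" and "u @ v \<in> S"
  shows "conc K S (delta K u) (delta K v) = delta K (u @ v)"
  unfolding conc_def using delta_closed[OF K assms(2)]
  by (simp add: lin_ext_delta[OF free_mod_module[OF K]])

text \<open>Projection to homogeneous components. A set of degrees rather than one degree is allowed
  so that an element can be reassembled by induction over a finite set.\<close>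

definition length_part :: "('k, 'y) ring_scheme \<Rightarrow> nat set \<Rightarrow> ('a list \<Rightarrow> 'k) \<Rightarrow> 'a list \<Rightarrow> 'k"
  where "length_part K B p = (\<lambda>w. if length w \<in> B then p w else \<zero>\<^bsub>K\<^esub>)"

lemma length_part_linear:
  assumes K: "cring K" and T: "\<And>w. \<lbrakk>w \<in> S; length w \<in> B\<rbrakk> \<Longrightarrow> w \<in> T"
  shows "linear_map K (free_mod K S) (free_mod K T) (length_part K B)"
proof (rule linear_mapI)
  interpret cring K by fact
  fix p assume p: "p \<in> carrier (free_mod K S)"
  note pD = free_mod_carrierD[OF p]
  show "length_part K B p \<in> carrier (free_mod K T)"
  proof (rule free_mod_carrierI)
    show "finite {w. length_part K B p w \<noteq> \<zero>\<^bsub>K\<^esub>}"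
      by (rule finite_subset[OF _ pD(3)]) (auto simp: length_part_def)
    show "length_part K B p w = \<zero>\<^bsub>K\<^esub>" if "w \<notin> T" for w
      using that T[of w] pD(2)[of w] by (auto simp: length_part_def)
  qed (use pD in \<open>simp add: length_part_def\<close>)
  show "length_part K B (p \<oplus>\<^bsub>free_mod K S\<^esub> q) = length_part K B p \<oplus>\<^bsub>free_mod K T\<^esub> length_part K B q" for q
    by (auto simp: length_part_def free_mod_simps)
  show "length_part K B (c \<odot>\<^bsub>free_mod K S\<^esub> p) = c \<odot>\<^bsub>free_mod K T\<^esub> length_part K B p" if "c \<in> carrier K" for c
    using that by (auto simp: length_part_def free_mod_simps)
qed

lemma length_part_delta:
  "length_part K B (delta K w) = (if length w \<in> B then delta K w else (\<lambda>w. \<zero>\<^bsub>K\<^esub>))"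
  by (auto simp: length_part_def delta_def)

lemma tensor_algebra_simps:
  "carrier (tensor_algebra K M) =
    {t \<in> (\<Pi>\<^sub>E i\<in>{1..}. carrier (tensor_power K M i)). finite {i\<in>{1..}. t i \<noteq> \<zero>\<^bsub>tensor_power K M i\<^esub>}}"
  "\<zero>\<^bsub>tensor_algebra K M\<^esub> = (\<lambda>i\<in>{1..}. \<zero>\<^bsub>tensor_power K M i\<^esub>)"
  "s \<oplus>\<^bsub>tensor_algebra K M\<^esub> t = (\<lambda>i\<in>{1..}. s i \<oplus>\<^bsub>tensor_power K M i\<^esub> t i)"
  "c \<odot>\<^bsub>tensor_algebra K M\<^esub> t = (\<lambda>i\<in>{1..}. c \<odot>\<^bsub>tensor_power K M i\<^esub> t i)"
  "s \<otimes>\<^bsub>tensor_algebra K M\<^esub> t = (\<lambda>n\<in>{1..}.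
         finsum (tensor_power K M n) (\<lambda>i. tensor_mult K M n (s i) (t (n - i))) {1..<n})"
  by (simp_all add: tensor_algebra_def direct_sum_def)

definition nonempty_tuples :: "('k, 'a, 'z) module_scheme \<Rightarrow> 'a list set"
  where "nonempty_tuples M = {xs. xs \<noteq> [] \<and> set xs \<subseteq> carrier M}"

lemma tuples_nonempty: "0 < n \<Longrightarrow> tuples M n \<subseteq> nonempty_tuples M"
  by (auto simp: nonempty_tuples_def tuples_def)

lemma tuples_append: "\<lbrakk>us \<in> tuples M i; vs \<in> tuples M j\<rbrakk> \<Longrightarrow> us @ vs \<in> tuples M (i + j)"
  by (simp add: tuples_def)

lemma nonempty_tuples_append:
  "\<lbrakk>us \<in> nonempty_tuples M; vs \<in> nonempty_tuples M\<rbrakk> \<Longrightarrow> us @ vs \<in> nonempty_tuples M"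
  by (simp add: nonempty_tuples_def)

text \<open>
  The reduced tensor algebra is the image under \<open>tensor_proj\<close> of the free nonunital algebra on the
  set of vectors of \<open>M\<close>, so all algebra laws are transported along this surjection.
\<close>

definition tensor_proj ::
  "('k, 'y) ring_scheme \<Rightarrow> ('k, 'a, 'z) module_scheme \<Rightarrow> ('a list \<Rightarrow> 'k) \<Rightarrow> nat \<Rightarrow> ('a list \<Rightarrow> 'k) set"
  where "tensor_proj K M p =
    (\<lambda>n\<in>{1..}. multilin_rel K M n +>\<^bsub>free_tuples K M n\<^esub> length_part K {n} p)"

section \<open>Multilinearity relations and the product of homogeneous tensors\<close>

context module
begin

lemmas free_mod_mod = free_mod_module[OF is_cring]

lemma multilin_gensE:
  assumes "g \<in> multilin_gens R M n"
  obtains (add) us vs x y where "us @ [x] @ vs \<in> tuples M n" "x \<in> carrier M" "y \<in> carrier M"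
      "g = delta R (us @ [x \<oplus>\<^bsub>M\<^esub> y] @ vs) \<ominus>\<^bsub>free_tuples R M n\<^esub>
       (delta R (us @ [x] @ vs) \<oplus>\<^bsub>free_tuples R M n\<^esub> delta R (us @ [y] @ vs))"
    | (smult) us vs c x where "us @ [x] @ vs \<in> tuples M n" "x \<in> carrier M" "c \<in> carrier R"
      "g = delta R (us @ [c \<odot>\<^bsub>M\<^esub> x] @ vs) \<ominus>\<^bsub>free_tuples R M n\<^esub>
       (c \<odot>\<^bsub>free_tuples R M n\<^esub> delta R (us @ [x] @ vs))"
proof -
  have t: "us @ [x] @ vs \<in> tuples M n"
    if "x \<in> carrier M" "set us \<subseteq> carrier M" "set vs \<subseteq> carrier M" "length us + 1 + length vs = n" for us vs x
    using that by (simp add: tuples_def)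
  show ?thesis
    using assms unfolding multilin_gens_def
    by (elim UnE CollectE exE conjE) (rule add smult; (rule t)?; assumption)+
qed

lemma tuples_upd: "\<lbrakk>us @ [x] @ vs \<in> tuples M n; y \<in> carrier M\<rbrakk> \<Longrightarrow> us @ [y] @ vs \<in> tuples M n"
  by (simp add: tuples_def)

lemma multilin_gens_closed: "multilin_gens R M n \<subseteq> carrier (free_tuples R M n)"
proof
  interpret F: module R "free_tuples R M n" by (rule free_mod_mod)
  fix g assume "g \<in> multilin_gens R M n"
  then show "g \<in> carrier (free_tuples R M n)"
  proof (cases rule: multilin_gensE)
    case (add us vs x y)
    note d = delta_closed[OF is_cring tuples_upd[OF add(1)]]
    show ?thesis
      using add(2,3) by (simp only: add(4) F.M.minus_closed F.M.a_closed d M.a_closed)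
  next
    case (smult us vs c x)
    note d = delta_closed[OF is_cring tuples_upd[OF smult(1)]]
    show ?thesis
      using smult(2,3) by (simp only: smult(4) F.M.minus_closed F.smult_closed d smult_closed)
  qed
qed

lemma multilin_rel_submodule: "submodule (multilin_rel R M n) R (free_tuples R M n)"
  unfolding multilin_rel_def by (rule submodule_hull[OF free_mod_mod multilin_gens_closed])

text \<open>The preimage of \<open>I\<close> under \<open>h\<close> is a submodule containing the
  generators, hence contains the submodule they generate.\<close>

lemma multilin_rel_minimal:
  assumes "submodule I R W" "module R W" "linear_map R (free_tuples R M n) W h"
    and "\<And>a. a \<in> multilin_gens R M n \<Longrightarrow> h a \<in> I" and a: "a \<in> multilin_rel R M n"
  shows "h a \<in> I"
proof -
  have "multilin_rel R M n \<subseteq> {x \<in> carrier (free_tuples R M n). h x \<in> I}"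
    unfolding multilin_rel_def
    by (rule hull_minimal)
      (use multilin_gens_closed assms(4) in blast, rule submodule_vimage[OF free_mod_mod assms(2,1,3)])
  with a show ?thesis by blast
qed

lemma multilin_gens_add:
  assumes "us @ [x] @ vs \<in> tuples M n" "x \<in> carrier M" "y \<in> carrier M"
  shows "delta R (us @ [x \<oplus>\<^bsub>M\<^esub> y] @ vs) \<ominus>\<^bsub>free_tuples R M n\<^esub>
       (delta R (us @ [x] @ vs) \<oplus>\<^bsub>free_tuples R M n\<^esub> delta R (us @ [y] @ vs)) \<in> multilin_gens R M n"
  using assms unfolding multilin_gens_def tuples_def
  by (intro UnI1 CollectI exI[of _ us] exI[of _ vs] exI[of _ x] exI[of _ y]) auto

lemma multilin_gens_smult:
  assumes "us @ [x] @ vs \<in> tuples M n" "x \<in> carrier M" "c \<in> carrier R"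
  shows "delta R (us @ [c \<odot>\<^bsub>M\<^esub> x] @ vs) \<ominus>\<^bsub>free_tuples R M n\<^esub>
       (c \<odot>\<^bsub>free_tuples R M n\<^esub> delta R (us @ [x] @ vs)) \<in> multilin_gens R M n"
  using assms unfolding multilin_gens_def tuples_def
  by (intro UnI2 CollectI exI[of _ us] exI[of _ vs] exI[of _ c] exI[of _ x]) auto

text \<open>Shared by two arguments: with \<open>I\<close> the relations of another degree it shows
  that concatenation respects them, and with \<open>I\<close> zero that a multilinear evaluation
  kills them.\<close>

lemma linear_map_multilin_gens:
  assumes W: "module R W" and h: "linear_map R (free_tuples R M n) W h"
    and g: "g \<in> multilin_gens R M n" and I: "submodule I R W"
    and add: "\<And>us vs x y. \<lbrakk>us @ [x] @ vs \<in> tuples M n; x \<in> carrier M; y \<in> carrier M\<rbrakk> \<Longrightarrow>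
        h (delta R (us @ [x \<oplus>\<^bsub>M\<^esub> y] @ vs)) \<ominus>\<^bsub>W\<^esub>
        (h (delta R (us @ [x] @ vs)) \<oplus>\<^bsub>W\<^esub> h (delta R (us @ [y] @ vs))) \<in> I"
    and smult: "\<And>us vs c x. \<lbrakk>us @ [x] @ vs \<in> tuples M n; x \<in> carrier M; c \<in> carrier R\<rbrakk> \<Longrightarrow>
        h (delta R (us @ [c \<odot>\<^bsub>M\<^esub> x] @ vs)) \<ominus>\<^bsub>W\<^esub> (c \<odot>\<^bsub>W\<^esub> h (delta R (us @ [x] @ vs))) \<in> I"
  shows "h g \<in> I"
  using g
proof (cases rule: multilin_gensE)
  case (add us vs x y)
  interpret F: module R "free_tuples R M n" by (rule free_mod_mod)
  note d = delta_closed[OF is_cring tuples_upd[OF add(1)]]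
  show ?thesis
    using assms(5)[OF add(1-3)] add(2,3)
    by (simp only: add(4) linear_map_minus[OF F.module_axioms W h] linear_map_add[OF h] d
        F.M.a_closed M.a_closed)
next
  case (smult us vs c x)
  interpret F: module R "free_tuples R M n" by (rule free_mod_mod)
  note d = delta_closed[OF is_cring tuples_upd[OF smult(1)]]
  show ?thesis
    using assms(6)[OF smult(1-3)] smult(2,3)
    by (simp only: smult(4) linear_map_minus[OF F.module_axioms W h] linear_map_smult[OF h] d
        F.smult_closed smult_closed)
qed

lemma conc_tuples_linear:
  "q \<in> carrier (free_tuples R M j)
    \<Longrightarrow> linear_map R (free_tuples R M i) (free_tuples R M (i + j)) (\<lambda>p. conc R (tuples M (i + j)) p q)"
  "p \<in> carrier (free_tuples R M i)
    \<Longrightarrow> linear_map R (free_tuples R M j) (free_tuples R M (i + j)) (conc R (tuples M (i + j)) p)"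
  by (rule conc_linear[OF is_cring tuples_append]; assumption)+

text \<open>Enclosing tuples between fixed tuples \<open>ls\<close> and \<open>rs\<close> lengthens
  the context of the varying slot and turns generators into generators.\<close>

lemma multilin_rel_map:
  assumes h: "linear_map R (free_tuples R M i) (free_tuples R M n) h"
    and hd: "\<And>us. us \<in> tuples M i \<Longrightarrow> h (delta R us) = delta R (ls @ us @ rs)"
    and t: "\<And>us. us \<in> tuples M i \<Longrightarrow> ls @ us @ rs \<in> tuples M n"
    and a: "a \<in> multilin_rel R M i"
  shows "h a \<in> multilin_rel R M n"
proof (rule multilin_rel_minimal[OF multilin_rel_submodule free_mod_mod h _ a])
  fix g assume "g \<in> multilin_gens R M i"
  then show "h g \<in> multilin_rel R M n"
  proof (rule linear_map_multilin_gens[OF free_mod_mod h _ multilin_rel_submodule])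
    fix us vs x y assume *: "us @ [x] @ vs \<in> tuples M i" "x \<in> carrier M" "y \<in> carrier M"
    have "(ls @ us) @ [x] @ (vs @ rs) \<in> tuples M n" using t[OF *(1)] by simp
    from multilin_gens_add[OF this *(2,3)]
    show "h (delta R (us @ [x \<oplus>\<^bsub>M\<^esub> y] @ vs)) \<ominus>\<^bsub>free_tuples R M n\<^esub>
      (h (delta R (us @ [x] @ vs)) \<oplus>\<^bsub>free_tuples R M n\<^esub> h (delta R (us @ [y] @ vs))) \<in> multilin_rel R M n"
      using *(2,3) by (simp only: hd tuples_upd[OF *(1)] M.a_closed append_assoc multilin_rel_def hull_inc)
  next
    fix us vs c x assume *: "us @ [x] @ vs \<in> tuples M i" "x \<in> carrier M" "c \<in> carrier R"
    have "(ls @ us) @ [x] @ (vs @ rs) \<in> tuples M n" using t[OF *(1)] by simp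
    from multilin_gens_smult[OF this *(2,3)]
    show "h (delta R (us @ [c \<odot>\<^bsub>M\<^esub> x] @ vs)) \<ominus>\<^bsub>free_tuples R M n\<^esub>
      (c \<odot>\<^bsub>free_tuples R M n\<^esub> h (delta R (us @ [x] @ vs))) \<in> multilin_rel R M n"
      using *(2,3) by (simp only: hd tuples_upd[OF *(1)] smult_closed append_assoc multilin_rel_def hull_inc)
  qed
qed

text \<open>By linearity \<open>b\<close> may be taken to be a basis tuple, and then the map just
  appends that tuple on the right.\<close>

lemma multilin_rel_conc_right:
  assumes a: "a \<in> multilin_rel R M i" and b: "b \<in> carrier (free_tuples R M j)"
  shows "conc R (tuples M (i + j)) a b \<in> multilin_rel R M (i + j)"
proof (rule linear_map_free_mod_mem[OF free_mod_mod multilin_rel_submodule conc_tuples_linear(2) _ b])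
  show "a \<in> carrier (free_tuples R M i)" using a module.submoduleE(1)[OF free_mod_mod multilin_rel_submodule] by blast
  fix ws assume ws: "ws \<in> tuples M j"
  show "conc R (tuples M (i + j)) a (delta R ws) \<in> multilin_rel R M (i + j)"
    by (rule multilin_rel_map[where ls = "[]" and rs = ws,
          OF conc_tuples_linear(1)[OF delta_closed[OF is_cring ws]] _ _ a])
      (simp_all add: conc_delta[OF is_cring] tuples_append ws)
qed

lemma multilin_rel_conc_left:
  assumes b: "b \<in> carrier (free_tuples R M i)" and a: "a \<in> multilin_rel R M j"
  shows "conc R (tuples M (i + j)) b a \<in> multilin_rel R M (i + j)"
proof (rule linear_map_free_mod_mem[OF free_mod_mod multilin_rel_submodule conc_tuples_linear(1) _ b])
  show "a \<in> carrier (free_tuples R M j)" using a module.submoduleE(1)[OF free_mod_mod multilin_rel_submodule] by blast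
  fix ws assume ws: "ws \<in> tuples M i"
  show "conc R (tuples M (i + j)) (delta R ws) a \<in> multilin_rel R M (i + j)"
    by (rule multilin_rel_map[where ls = ws and rs = "[]",
          OF conc_tuples_linear(2)[OF delta_closed[OF is_cring ws]] _ _ a])
      (simp_all add: conc_delta[OF is_cring] tuples_append ws)
qed

text \<open>\<open>multilin_rel_conc_right\<close> and \<open>multilin_rel_conc_left\<close> are the
  conditions under which the union over representatives collapses.\<close>

lemma tensor_mult_coset:
  assumes p: "p \<in> carrier (free_tuples R M i)" and q: "q \<in> carrier (free_tuples R M j)"
  shows "tensor_mult R M (i + j) (multilin_rel R M i +>\<^bsub>free_tuples R M i\<^esub> p)
      (multilin_rel R M j +>\<^bsub>free_tuples R M j\<^esub> q)
    = multilin_rel R M (i + j) +>\<^bsub>free_tuples R M (i + j)\<^esub> conc R (tuples M (i + j)) p q"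
  unfolding tensor_mult_def conc_def[symmetric]
  by (rule bilinear_coset_UN[OF free_mod_mod multilin_rel_submodule free_mod_mod multilin_rel_submodule
        free_mod_mod multilin_rel_submodule conc_tuples_linear multilin_rel_conc_right
        multilin_rel_conc_left p q])

section \<open>The free nonunital algebra on the vectors of M and its projection onto T(M)\<close>

abbreviation "FT \<equiv> free_mod R (nonempty_tuples M)"
abbreviation "T \<equiv> tensor_algebra R M"

lemma part_linear: "0 < n \<Longrightarrow> linear_map R FT (free_tuples R M n) (length_part R {n})"
  by (rule length_part_linear[OF is_cring]) (simp add: nonempty_tuples_def tuples_def)

lemma tensor_power_module: "module R (tensor_power R M n)"
  unfolding tensor_power_def by (rule quot_alg_module[OF free_mod_mod multilin_rel_submodule])

lemma tensor_power_quot_linear: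
  "linear_map R (free_tuples R M n) (tensor_power R M n) (\<lambda>p. multilin_rel R M n +>\<^bsub>free_tuples R M n\<^esub> p)"
  unfolding tensor_power_def by (rule quot_map_linear[OF free_mod_mod multilin_rel_submodule])

lemma tensor_component_linear:
  "0 < n \<Longrightarrow> linear_map R FT (tensor_power R M n)
    (\<lambda>p. multilin_rel R M n +>\<^bsub>free_tuples R M n\<^esub> length_part R {n} p)"
  by (rule linear_map_comp[OF tensor_power_quot_linear part_linear])

lemma tensor_power_zero:
  "multilin_rel R M n +>\<^bsub>free_tuples R M n\<^esub> \<zero>\<^bsub>free_tuples R M n\<^esub> = \<zero>\<^bsub>tensor_power R M n\<^esub>"
  unfolding tensor_power_def by (rule quot_map_zero[OF free_mod_mod multilin_rel_submodule])

lemma tensor_proj_closed: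
  assumes p: "p \<in> carrier FT"
  shows "tensor_proj R M p \<in> carrier T"
proof -
  \<comment> \<open>Only lengths of tuples in the finite support of \<open>p\<close> can give a
    nonzero component.\<close>
  have "{i \<in> {1..}. tensor_proj R M p i \<noteq> \<zero>\<^bsub>tensor_power R M i\<^esub>} \<subseteq> length ` {w. p w \<noteq> \<zero>}"
  proof
    fix n assume "n \<in> {i \<in> {1..}. tensor_proj R M p i \<noteq> \<zero>\<^bsub>tensor_power R M i\<^esub>}"
    then have n: "n \<in> {1..}" "tensor_proj R M p n \<noteq> \<zero>\<^bsub>tensor_power R M n\<^esub>" by simp_all
    show "n \<in> length ` {w. p w \<noteq> \<zero>}"
    proof (rule ccontr)
      assume "n \<notin> length ` {w. p w \<noteq> \<zero>}"
      then have "p w = \<zero>" if "length w = n" for w using that by blast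
      then have "length_part R {n} p = \<zero>\<^bsub>free_tuples R M n\<^esub>"
        by (simp add: length_part_def free_mod_simps fun_eq_iff)
      with n show False
        using tensor_power_zero[of n] by (simp add: tensor_proj_def)
    qed
  qed
  then have "finite {i \<in> {1..}. tensor_proj R M p i \<noteq> \<zero>\<^bsub>tensor_power R M i\<^esub>}"
    by (rule finite_subset) (rule finite_imageI[OF free_mod_carrierD(3)[OF p]])
  moreover have "tensor_proj R M p \<in> (\<Pi>\<^sub>E i\<in>{1..}. carrier (tensor_power R M i))"
    unfolding tensor_proj_def using linear_map_closed[OF tensor_component_linear p]
    by (intro restrict_PiE[THEN iffD2] Pi_I) simp
  ultimately show ?thesis by (simp add: tensor_algebra_simps)
qed

lemma tensor_proj_linear: "linear_map R FT T (tensor_proj R M)"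
proof (rule linear_mapI)
  fix p assume p: "p \<in> carrier FT"
  show "tensor_proj R M p \<in> carrier T" by (rule tensor_proj_closed[OF p])
  show "tensor_proj R M (p \<oplus>\<^bsub>FT\<^esub> q) = tensor_proj R M p \<oplus>\<^bsub>T\<^esub> tensor_proj R M q" if q: "q \<in> carrier FT" for q
  proof
    fix n
    show "tensor_proj R M (p \<oplus>\<^bsub>FT\<^esub> q) n = (tensor_proj R M p \<oplus>\<^bsub>T\<^esub> tensor_proj R M q) n"
      using linear_map_add[OF tensor_component_linear[of n] p q]
      by (simp add: tensor_proj_def tensor_algebra_simps)
  qed
  show "tensor_proj R M (c \<odot>\<^bsub>FT\<^esub> p) = c \<odot>\<^bsub>T\<^esub> tensor_proj R M p" if c: "c \<in> carrier R" for c
  proof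
    fix n
    show "tensor_proj R M (c \<odot>\<^bsub>FT\<^esub> p) n = (c \<odot>\<^bsub>T\<^esub> tensor_proj R M p) n"
      using linear_map_smult[OF tensor_component_linear[of n] c p]
      by (simp add: tensor_proj_def tensor_algebra_simps)
  qed
qed

lemma tensor_proj_zero: "tensor_proj R M \<zero>\<^bsub>FT\<^esub> = \<zero>\<^bsub>T\<^esub>"
proof
  fix n
  have "length_part R {n} \<zero>\<^bsub>FT\<^esub> = \<zero>\<^bsub>free_tuples R M n\<^esub>"
    by (auto simp: length_part_def free_mod_simps)
  then show "tensor_proj R M \<zero>\<^bsub>FT\<^esub> n = \<zero>\<^bsub>T\<^esub> n"
    by (simp add: tensor_proj_def tensor_algebra_simps tensor_power_zero)
qed

lemma tensor_proj_surj: "tensor_proj R M ` carrier FT = carrier T"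
proof
  show "tensor_proj R M ` carrier FT \<subseteq> carrier T" using tensor_proj_closed by blast
  show "carrier T \<subseteq> tensor_proj R M ` carrier FT"
  proof
    fix t assume t: "t \<in> carrier T"
    let ?N = "{i \<in> {1..}. t i \<noteq> \<zero>\<^bsub>tensor_power R M i\<^esub>}"
    have fin: "finite ?N" and tE: "t \<in> (\<Pi>\<^sub>E i\<in>{1..}. carrier (tensor_power R M i))"
      using t by (simp_all add: tensor_algebra_simps)
    \<comment> \<open>A zero component must be represented by zero itself. Otherwise nonzero
      representatives could be chosen in infinitely many degrees, and gluing them would give
      infinite support.\<close>
    let ?good = "\<lambda>n r. r \<in> carrier (free_tuples R M n) \<and>
        t n = multilin_rel R M n +>\<^bsub>free_tuples R M n\<^esub> r \<and>
        (t n = \<zero>\<^bsub>tensor_power R M n\<^esub> \<longrightarrow> r = \<zero>\<^bsub>free_tuples R M n\<^esub>)"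
    have "\<exists>r. ?good n r" if n: "n \<in> {1..}" for n
    proof (cases "t n = \<zero>\<^bsub>tensor_power R M n\<^esub>")
      case True
      interpret F: module R "free_tuples R M n" by (rule free_mod_mod)
      show ?thesis
        by (rule exI[of _ "\<zero>\<^bsub>free_tuples R M n\<^esub>"]) (simp add: True tensor_power_zero)
    next
      case False
      have "t n \<in> carrier (tensor_power R M n)" using tE n by (rule PiE_mem)
      then obtain x where "x \<in> carrier (free_tuples R M n)" "t n = multilin_rel R M n +>\<^bsub>free_tuples R M n\<^esub> x"
        unfolding tensor_power_def quot_alg_simps(1) by (rule imageE)
      then show ?thesis using False by (intro exI[of _ x]) simp
    qed
    then have "\<forall>n\<in>{1..}. \<exists>r. ?good n r" by (intro ballI)
    from bchoice[OF this] obtain r where r': "\<forall>n\<in>{1..}. ?good n (r n)" by (elim exE)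
    have r: "?good n (r n)" if "n \<in> {1..}" for n by (rule bspec[OF r' that])
    \<comment> \<open>The representatives are glued by reading, at a tuple, the one that belongs to
      its length; their supports are disjoint.\<close>
    define p where "p = (\<lambda>w. if w = [] then \<zero> else r (length w) w)"
    have rc: "r (length w) \<in> carrier (free_tuples R M (length w))" if "w \<noteq> []" for w :: "'c list"
      using r[of "length w"] that by (cases w) auto
    have p: "p \<in> carrier FT"
    proof (rule free_mod_carrierI)
      show "p w \<in> carrier R" for w
        using free_mod_carrierD(1)[OF rc] by (simp add: p_def)
      show "p w = \<zero>" if "w \<notin> nonempty_tuples M" for w
      proof (cases "w = []")
        case False
        then have "w \<notin> tuples M (length w)"
          using that tuples_nonempty[of "length w" M] by blast
        then show ?thesis
          using free_mod_carrierD(2)[OF rc[OF False]] False by (simp add: p_def)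
      qed (simp add: p_def)
      show "finite {w. p w \<noteq> \<zero>}"
      proof (rule finite_subset)
        show "{w. p w \<noteq> \<zero>} \<subseteq> (\<Union>n\<in>?N. {w. r n w \<noteq> \<zero>})"
        proof
          fix w assume "w \<in> {w. p w \<noteq> \<zero>}"
          then have w: "w \<noteq> []" "r (length w) w \<noteq> \<zero>" by (auto simp: p_def split: if_splits)
          then have n: "length w \<in> {1..}" by (cases w) auto
          have "t (length w) \<noteq> \<zero>\<^bsub>tensor_power R M (length w)\<^esub>"
          proof
            assume "t (length w) = \<zero>\<^bsub>tensor_power R M (length w)\<^esub>"
            then have "r (length w) = \<zero>\<^bsub>free_tuples R M (length w)\<^esub>" using r[OF n] by blast
            then show False using w(2) by (simp add: free_mod_simps)
          qed
          then show "w \<in> (\<Union>n\<in>?N. {w. r n w \<noteq> \<zero>})" using n w(2) by blast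
        qed
        show "finite (\<Union>n\<in>?N. {w. r n w \<noteq> \<zero>})"
        proof (rule finite_UN_I[OF fin])
          fix n assume "n \<in> ?N"
          then have "r n \<in> carrier (free_tuples R M n)" using r by blast
          then show "finite {w. r n w \<noteq> \<zero>}" by (rule free_mod_carrierD(3))
        qed
      qed
    qed
    have "tensor_proj R M p = t"
    proof
      fix n
      show "tensor_proj R M p n = t n"
      proof (cases "n \<in> {1..}")
        case True
        have part: "length_part R {n} p = r n"
        proof
          fix w
          have "r n w = \<zero>" if "length w \<noteq> n"
            using free_mod_carrierD(2)[of "r n" R "tuples M n" w] r[OF True] that
            by (simp add: tuples_def)
          then show "length_part R {n} p w = r n w"
            using True by (cases "length w = n") (auto simp: length_part_def p_def)
        qed
        have "tensor_proj R M p n = multilin_rel R M n +>\<^bsub>free_tuples R M n\<^esub> length_part R {n} p"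
          using True by (simp add: tensor_proj_def)
        also have "\<dots> = t n" unfolding part using r[OF True] by (elim conjE) (rule sym)
        finally show ?thesis .
      next
        case False
        then show ?thesis using PiE_arb[OF tE False] by (simp add: tensor_proj_def)
      qed
    qed
    then show "t \<in> tensor_proj R M ` carrier FT" using p by blast
  qed
qed

lemma conc_FT_linear:
  "q \<in> carrier FT \<Longrightarrow> linear_map R FT FT (\<lambda>p. conc R (nonempty_tuples M) p q)"
  "p \<in> carrier FT \<Longrightarrow> linear_map R FT FT (conc R (nonempty_tuples M) p)"
  by (rule conc_linear[OF is_cring nonempty_tuples_append]; assumption)+

text \<open>On basis tuples associativity is that of \<open>append\<close>; trilinearity extends
  it.\<close>

lemma free_nonunital_algebra:
  "nonunital_algebra R (FT\<lparr>mult := conc R (nonempty_tuples M)\<rparr>)"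
proof (intro nonunital_algebra.intro nonunital_algebra_axioms.intro module_mult_update free_mod_mod)
  let ?A = "FT\<lparr>mult := conc R (nonempty_tuples M)\<rparr>"
  let ?c = "conc R (nonempty_tuples M)"
  show "bilinear_op R ?A (\<otimes>\<^bsub>?A\<^esub>)"
    unfolding bilinear_op_def by (simp add: linear_map_mult_update conc_FT_linear)
  fix p q r assume "p \<in> carrier ?A" "q \<in> carrier ?A" "r \<in> carrier ?A"
  then have pqr: "p \<in> carrier FT" "q \<in> carrier FT" "r \<in> carrier FT" by simp_all
  note c = linear_map_closed[OF conc_FT_linear(2)]
  note d = delta_closed[OF is_cring]
  have "?c (?c p q) r = ?c p (?c q r)"
  proof (rule trilinear_eqI[where f = "\<lambda>p q r. ?c (?c p q) r" and g = "\<lambda>p q r. ?c p (?c q r)",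
        OF free_mod_mod[of "nonempty_tuples M"] _ _ _ _ _ _ _ pqr])
    fix q r assume qr: "q \<in> carrier FT" "r \<in> carrier FT"
    show "linear_map R FT FT (\<lambda>p. ?c (?c p q) r)"
      by (rule linear_map_comp[OF conc_FT_linear(1) conc_FT_linear(1)]; fact qr)
    show "linear_map R FT FT (\<lambda>p. ?c p (?c q r))"
      by (rule conc_FT_linear(1)[OF c[OF qr]])
  next
    fix u r assume ur: "u \<in> nonempty_tuples M" "r \<in> carrier FT"
    show "linear_map R FT FT (\<lambda>q. ?c (?c (delta R u) q) r)"
      by (rule linear_map_comp[OF conc_FT_linear(1)[OF ur(2)] conc_FT_linear(2)[OF d[OF ur(1)]]])
    show "linear_map R FT FT (\<lambda>q. ?c (delta R u) (?c q r))"
      by (rule linear_map_comp[OF conc_FT_linear(2)[OF d[OF ur(1)]] conc_FT_linear(1)[OF ur(2)]])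
  next
    fix u v assume uv: "u \<in> nonempty_tuples M" "v \<in> nonempty_tuples M"
    show "linear_map R FT FT (?c (?c (delta R u) (delta R v)))"
      by (rule conc_FT_linear(2)[OF c[OF d d]]; fact uv)
    show "linear_map R FT FT (\<lambda>r. ?c (delta R u) (?c (delta R v) r))"
      by (rule linear_map_comp[OF conc_FT_linear(2)[OF d] conc_FT_linear(2)[OF d]]; fact uv)
  next
    fix u v w assume uvw: "u \<in> nonempty_tuples M" "v \<in> nonempty_tuples M" "w \<in> nonempty_tuples M"
    then show "?c (?c (delta R u) (delta R v)) (delta R w) = ?c (delta R u) (?c (delta R v) (delta R w))"
      by (simp add: conc_delta[OF is_cring] nonempty_tuples_append)
  qed
  then show "p \<otimes>\<^bsub>?A\<^esub> q \<otimes>\<^bsub>?A\<^esub> r = p \<otimes>\<^bsub>?A\<^esub> (q \<otimes>\<^bsub>?A\<^esub> r)" by simp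
qed

text \<open>On basis tuples \<open>u\<close> and \<open>v\<close> the only possible nonzero summand
  is the one at \<open>length u\<close>, and it survives exactly when the lengths add up to
  \<open>n\<close>. The range \<open>{1..<n}\<close> suffices because both tuples are
  nonempty.\<close>

lemma length_part_conc:
  assumes n: "0 < n" and p: "p \<in> carrier FT" and q: "q \<in> carrier FT"
  shows "length_part R {n} (conc R (nonempty_tuples M) p q) =
    finsum (free_tuples R M n)
      (\<lambda>i. conc R (tuples M n) (length_part R {i} p) (length_part R {n - i} q)) {1..<n}"
proof -
  let ?F = "free_tuples R M n"
  interpret F: module R ?F by (rule free_mod_mod)
  note d = delta_closed[OF is_cring]
  have i: "0 < i" "0 < n - i" "i + (n - i) = n" if "i \<in> {1..<n}" for i using that by auto
  have lin1: "linear_map R FT ?F (\<lambda>p. conc R (tuples M n) (length_part R {i} p) (length_part R {n - i} q))"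
    if "i \<in> {1..<n}" "q \<in> carrier FT" for i q
    using linear_map_comp[OF conc_tuples_linear(1)[of _ "n - i" i] part_linear[OF i(1)[OF that(1)]]]
      linear_map_closed[OF part_linear[OF i(2)[OF that(1)]] that(2)] i(3)[OF that(1)] by simp
  have lin2: "linear_map R FT ?F (\<lambda>q. conc R (tuples M n) (length_part R {i} p) (length_part R {n - i} q))"
    if "i \<in> {1..<n}" "p \<in> carrier FT" for i p
    using linear_map_comp[OF conc_tuples_linear(2)[of _ i "n - i"] part_linear[OF i(2)[OF that(1)]]]
      linear_map_closed[OF part_linear[OF i(1)[OF that(1)]] that(2)] i(3)[OF that(1)] by simp
  show ?thesis
  proof (rule bilinear_eqI[where f = "\<lambda>p q. length_part R {n} (conc R (nonempty_tuples M) p q)" and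
        g = "\<lambda>p q. finsum ?F (\<lambda>i. conc R (tuples M n) (length_part R {i} p) (length_part R {n - i} q)) {1..<n}",
        OF free_mod_mod _ _ _ _ _ p q])
    show "linear_map R FT ?F (\<lambda>p. length_part R {n} (conc R (nonempty_tuples M) p q))"
      if "q \<in> carrier FT" for q
      by (rule linear_map_comp[OF part_linear[OF n] conc_FT_linear(1)[OF that]])
    show "linear_map R FT ?F (\<lambda>q. length_part R {n} (conc R (nonempty_tuples M) (delta R w) q))"
      if "w \<in> nonempty_tuples M" for w
      by (rule linear_map_comp[OF part_linear[OF n] conc_FT_linear(2)[OF d[OF that]]])
    show "linear_map R FT ?F (\<lambda>p. finsum ?F (\<lambda>i. conc R (tuples M n) (length_part R {i} p)
        (length_part R {n - i} q)) {1..<n})" if "q \<in> carrier FT" for q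
      by (rule linear_map_finsum_param[OF free_mod_mod lin1]) (use that in auto)
    show "linear_map R FT ?F (\<lambda>q. finsum ?F (\<lambda>i. conc R (tuples M n) (length_part R {i} (delta R w))
        (length_part R {n - i} q)) {1..<n})" if "w \<in> nonempty_tuples M" for w
      by (rule linear_map_finsum_param[OF free_mod_mod lin2]) (use d[OF that] in auto)
    fix u v assume u: "u \<in> nonempty_tuples M" and v: "v \<in> nonempty_tuples M"
    let ?g = "\<lambda>i. conc R (tuples M n) (length_part R {i} (delta R u)) (length_part R {n - i} (delta R v))"
    have pos: "0 < length u" "0 < length v" using u v by (auto simp: nonempty_tuples_def)
    have L: "length_part R {n} (conc R (nonempty_tuples M) (delta R u) (delta R v)) =
        (if length (u @ v) = n then delta R (u @ v) else \<zero>\<^bsub>?F\<^esub>)"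
      using u v by (simp add: conc_delta[OF is_cring] nonempty_tuples_append length_part_delta free_mod_simps)
    have gc: "?g i \<in> carrier ?F" if "i \<in> {1..<n}" for i
      using linear_map_closed[OF lin1[OF that d[OF v]] d[OF u]] .
    \<comment> \<open>If a degree does not match, one factor is the zero of its tuple space, and
      \<open>conc\<close> is linear in each factor.\<close>
    have g0: "?g i = \<zero>\<^bsub>?F\<^esub>" if i': "i \<in> {1..<n}" and ne: "\<not> (length u = i \<and> length v = n - i)" for i
    proof (cases "length u = i")
      case False
      then have "length_part R {i} (delta R u) = \<zero>\<^bsub>free_tuples R M i\<^esub>"
        by (simp add: length_part_delta free_mod_simps)
      then show ?thesis
        using linear_map_zero[OF free_mod_mod free_mod_mod conc_tuples_linear(1)[of _ "n - i" i]]
          linear_map_closed[OF part_linear[OF i(2)[OF i']] d[OF v]] i(3)[OF i'] by simp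
    next
      case True
      then have "length_part R {n - i} (delta R v) = \<zero>\<^bsub>free_tuples R M (n - i)\<^esub>"
        using ne by (simp add: length_part_delta free_mod_simps)
      then show ?thesis
        using linear_map_zero[OF free_mod_mod free_mod_mod conc_tuples_linear(2)[of _ i "n - i"]]
          linear_map_closed[OF part_linear[OF i(1)[OF i']] d[OF u]] i(3)[OF i'] by simp
    qed
    show "length_part R {n} (conc R (nonempty_tuples M) (delta R u) (delta R v)) = finsum ?F ?g {1..<n}"
    proof (cases "length (u @ v) = n")
      case True
      then have m: "length u \<in> {1..<n}" using pos by (simp only: atLeastLessThan_iff length_append) linarith
      have t: "u @ v \<in> tuples M n" using u v True by (auto simp: nonempty_tuples_def tuples_def)
      have "finsum ?F ?g {1..<n} = ?g (length u)"
      proof (rule F.M.finsum_single[where g = ?g, OF _ m gc[OF m]])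
        show "?g i = \<zero>\<^bsub>?F\<^esub>" if "i \<in> {1..<n}" "i \<noteq> length u" for i
          using g0[OF that(1)] that(2) by blast
      qed simp
      also have "\<dots> = delta R (u @ v)"
        using conc_delta[OF is_cring t] True[symmetric] by (simp add: length_part_delta)
      finally show ?thesis unfolding L using True by simp
    next
      case False
      then have "finsum ?F ?g {1..<n} = finsum ?F (\<lambda>i. \<zero>\<^bsub>?F\<^esub>) {1..<n}"
      proof (intro F.M.finsum_cong')
        show "?g i = \<zero>\<^bsub>?F\<^esub>" if "i \<in> {1..<n}" for i
        proof (rule g0[OF that])
          show "\<not> (length u = i \<and> length v = n - i)"
            using False i(3)[OF that] by auto
        qed
      qed simp_all
      then show ?thesis unfolding L using False F.M.finsum_zero by simp
    qed
  qed
qed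

text \<open>Degree by degree: \<open>length_part_conc\<close> writes the product as a Cauchy sum,
  and \<open>tensor_mult_coset\<close> identifies each summand.\<close>

lemma tensor_proj_mult:
  assumes p: "p \<in> carrier FT" and q: "q \<in> carrier FT"
  shows "tensor_proj R M (conc R (nonempty_tuples M) p q) = tensor_proj R M p \<otimes>\<^bsub>T\<^esub> tensor_proj R M q"
proof
  fix n :: nat
  show "tensor_proj R M (conc R (nonempty_tuples M) p q) n = (tensor_proj R M p \<otimes>\<^bsub>T\<^esub> tensor_proj R M q) n"
  proof (cases "n \<in> {1..}")
    case False
    then show ?thesis by (simp add: tensor_proj_def tensor_algebra_simps)
  next
    case True
    then have n: "0 < n" by simp
    interpret W: module R "tensor_power R M n" by (rule tensor_power_module)
    let ?F = "free_tuples R M n" and ?J = "multilin_rel R M n"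
    let ?g = "\<lambda>i. conc R (tuples M n) (length_part R {i} p) (length_part R {n - i} q)"
    have i: "0 < i" "0 < n - i" "i + (n - i) = n" if "i \<in> {1..<n}" for i using that by auto
    have part: "length_part R {i} p \<in> carrier (free_tuples R M i)"
      "length_part R {n - i} q \<in> carrier (free_tuples R M (n - i))" if "i \<in> {1..<n}" for i
      using linear_map_closed[OF part_linear[OF i(1)[OF that]] p]
        linear_map_closed[OF part_linear[OF i(2)[OF that]] q] by simp_all
    have g: "?g i \<in> carrier ?F" if "i \<in> {1..<n}" for i
      using linear_map_closed[OF conc_tuples_linear(2)[OF part(1)[OF that], of "n - i"] part(2)[OF that]]
        i(3)[OF that] by simp
    have "tensor_proj R M (conc R (nonempty_tuples M) p q) n = ?J +>\<^bsub>?F\<^esub> finsum ?F ?g {1..<n}"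
      using True by (simp add: tensor_proj_def length_part_conc[OF n p q])
    also have "\<dots> = finsum (tensor_power R M n) (\<lambda>i. ?J +>\<^bsub>?F\<^esub> ?g i) {1..<n}"
      using g by (intro linear_map_finsum[OF free_mod_mod tensor_power_module tensor_power_quot_linear]) auto
    also have "\<dots> = finsum (tensor_power R M n)
        (\<lambda>i. tensor_mult R M n (tensor_proj R M p i) (tensor_proj R M q (n - i))) {1..<n}"
    proof (rule W.M.finsum_cong'[symmetric])
      show "(\<lambda>i. ?J +>\<^bsub>?F\<^esub> ?g i) \<in> {1..<n} \<rightarrow> carrier (tensor_power R M n)"
        using linear_map_closed[OF tensor_power_quot_linear g] by (intro Pi_I)
      fix k assume k: "k \<in> {1..<n}"
      then show "tensor_mult R M n (tensor_proj R M p k) (tensor_proj R M q (n - k)) = ?J +>\<^bsub>?F\<^esub> ?g k"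
        using tensor_mult_coset[OF part[OF k]] i[OF k] by (simp add: tensor_proj_def Suc_le_eq)
    qed simp
    also have "\<dots> = (tensor_proj R M p \<otimes>\<^bsub>T\<^esub> tensor_proj R M q) n"
      using True by (simp add: tensor_algebra_simps)
    finally show ?thesis .
  qed
qed

lemma tensor_nonunital_algebra: "nonunital_algebra R T"
proof (rule nonunital_algebra_image[OF free_nonunital_algebra, where f = "tensor_proj R M"])
  let ?A = "FT\<lparr>mult := conc R (nonempty_tuples M)\<rparr>"
  show "linear_map R ?A T (tensor_proj R M)"
    using tensor_proj_linear by (simp only: linear_map_mult_update)
  show "tensor_proj R M ` carrier ?A = carrier T"
    by (simp add: tensor_proj_surj)
  show "tensor_proj R M \<zero>\<^bsub>?A\<^esub> = \<zero>\<^bsub>T\<^esub>"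
    using tensor_proj_zero by simp
  show "tensor_proj R M (p \<otimes>\<^bsub>?A\<^esub> q) = tensor_proj R M p \<otimes>\<^bsub>T\<^esub> tensor_proj R M q"
    if "p \<in> carrier ?A" "q \<in> carrier ?A" for p q
    using that tensor_proj_mult by simp
qed

section \<open>Pure tensors and the universal property of T(M)\<close>

lemma pure_tensor_eq_proj:
  assumes "xs \<in> nonempty_tuples M"
  shows "pure_tensor R M xs = tensor_proj R M (delta R xs)"
proof
  fix n
  show "pure_tensor R M xs n = tensor_proj R M (delta R xs) n"
    using tensor_power_zero[of n]
    by (simp add: pure_tensor_def tensor_proj_def length_part_delta free_mod_simps)
qed

lemma pure_tensor_closed: "xs \<in> nonempty_tuples M \<Longrightarrow> pure_tensor R M xs \<in> carrier T"
  by (simp add: pure_tensor_eq_proj tensor_proj_closed delta_closed[OF is_cring])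

lemma pure_tensor_append:
  assumes "us \<in> nonempty_tuples M" "vs \<in> nonempty_tuples M"
  shows "pure_tensor R M (us @ vs) = pure_tensor R M us \<otimes>\<^bsub>T\<^esub> pure_tensor R M vs"
  using assms tensor_proj_mult[of "delta R us" "delta R vs"]
  by (simp add: pure_tensor_eq_proj nonempty_tuples_append delta_closed[OF is_cring] conc_delta[OF is_cring])

text \<open>Pure tensors are products of those of degree one, so two homomorphisms agree on them;
  since pure tensors are the projections of basis tuples, linearity finishes.\<close>

lemma tensor_algebra_hom_eq:
  assumes N: "module R N"
    and g: "linear_map R T N g" and h: "linear_map R T N h"
    and gm: "\<And>x y. \<lbrakk>x \<in> carrier T; y \<in> carrier T\<rbrakk> \<Longrightarrow> g (x \<otimes>\<^bsub>T\<^esub> y) = g x \<otimes>\<^bsub>N\<^esub> g y"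
    and hm: "\<And>x y. \<lbrakk>x \<in> carrier T; y \<in> carrier T\<rbrakk> \<Longrightarrow> h (x \<otimes>\<^bsub>T\<^esub> y) = h x \<otimes>\<^bsub>N\<^esub> h y"
    and eq: "\<And>x. x \<in> carrier M \<Longrightarrow> g (pure_tensor R M [x]) = h (pure_tensor R M [x])"
    and t: "t \<in> carrier T"
  shows "g t = h t"
proof -
  have pure: "g (pure_tensor R M xs) = h (pure_tensor R M xs)" if "xs \<in> nonempty_tuples M" for xs
    using that
  proof (induction xs)
    case (Cons x xs)
    then have x: "x \<in> carrier M" "[x] \<in> nonempty_tuples M" by (simp_all add: nonempty_tuples_def)
    show ?case
    proof (cases "xs = []")
      case True
      then show ?thesis using eq[OF x(1)] by simp
    next
      case False
      then have xs: "xs \<in> nonempty_tuples M" using Cons.prems by (simp add: nonempty_tuples_def)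
      then show ?thesis
        using pure_tensor_append[OF x(2) xs] gm hm Cons.IH eq[OF x(1)] x(2) by (simp add: pure_tensor_closed)
    qed
  qed (simp add: nonempty_tuples_def)
  obtain p where p: "p \<in> carrier FT" "t = tensor_proj R M p"
    using t tensor_proj_surj by blast
  have "g (tensor_proj R M p) = h (tensor_proj R M p)"
    by (rule free_mod_eqI[OF N linear_map_comp[OF g tensor_proj_linear]
          linear_map_comp[OF h tensor_proj_linear] p(1)])
      (simp add: pure pure_tensor_eq_proj[symmetric])
  then show ?thesis by (simp add: p(2))
qed

text \<open>On a tuple the extension can only be the product of the images of its entries. This is
  defined on \<open>FT\<close> and has to descend along \<open>tensor_proj\<close>, so the task is
  to see that it depends only on the projection.\<close>

lemma tensor_algebra_lift:
  assumes N: "nonunital_algebra R N" and f: "linear_map R M N f"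
  obtains g where "linear_map R T N g"
    "\<And>x y. \<lbrakk>x \<in> carrier T; y \<in> carrier T\<rbrakk> \<Longrightarrow> g (x \<otimes>\<^bsub>T\<^esub> y) = g x \<otimes>\<^bsub>N\<^esub> g y"
    "\<And>x. x \<in> carrier M \<Longrightarrow> g (pure_tensor R M [x]) = f x"
proof -
  interpret N: nonunital_algebra R N by fact
  note Nm = N.module_axioms
  define h where "h = lin_ext R N (\<lambda>xs. list_mult N (map f xs))"
  have fc: "set (map f xs) \<subseteq> carrier N" if "set xs \<subseteq> carrier M" for xs
    using that linear_map_closed[OF f] by auto
  have mc: "list_mult N (map f xs) \<in> carrier N" if "xs \<in> nonempty_tuples M" for xs
    by (rule N.list_mult_closed[OF fc]) (use that in \<open>simp add: nonempty_tuples_def\<close>)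
  have h: "linear_map R FT N h"
    unfolding h_def by (rule linear_map_lin_ext[OF Nm], rule mc)
  \<comment> \<open>The same function is used on the tuples of each single length, where the
    multilinearity relations live.\<close>
  have hn: "linear_map R (free_tuples R M n) N h" if "0 < n" for n
    unfolding h_def by (rule linear_map_lin_ext[OF Nm], rule mc) (use tuples_nonempty[OF that] in blast)
  have hd: "h (delta R xs) = list_mult N (map f xs)" if "xs \<in> nonempty_tuples M" for xs
    unfolding h_def by (rule lin_ext_delta[OF Nm], rule mc[OF that])
  have hm: "h (conc R (nonempty_tuples M) p q) = h p \<otimes>\<^bsub>N\<^esub> h q"
    if p: "p \<in> carrier FT" and q: "q \<in> carrier FT" for p q
  proof (rule bilinear_eqI[where f = "\<lambda>p q. h (conc R (nonempty_tuples M) p q)" and g = "\<lambda>p q. h p \<otimes>\<^bsub>N\<^esub> h q",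
        OF Nm _ _ _ _ _ p q])
    show "linear_map R FT N (\<lambda>p. h (conc R (nonempty_tuples M) p q))" if "q \<in> carrier FT" for q
      by (rule linear_map_comp[OF h conc_FT_linear(1)[OF that]])
    show "linear_map R FT N (\<lambda>q. h (conc R (nonempty_tuples M) (delta R w) q))"
      if "w \<in> nonempty_tuples M" for w
      by (rule linear_map_comp[OF h conc_FT_linear(2)[OF delta_closed[OF is_cring that]]])
    show "linear_map R FT N (\<lambda>p. h p \<otimes>\<^bsub>N\<^esub> h q)" if "q \<in> carrier FT" for q
      by (rule linear_map_comp[OF N.linear_mult_left[OF linear_map_closed[OF h that]] h])
    show "linear_map R FT N (\<lambda>q. h (delta R w) \<otimes>\<^bsub>N\<^esub> h q)" if "w \<in> nonempty_tuples M" for w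
      by (rule linear_map_comp[OF N.linear_mult_right[OF linear_map_closed[OF h delta_closed[OF is_cring that]]] h])
    fix us vs assume us: "us \<in> nonempty_tuples M" and vs: "vs \<in> nonempty_tuples M"
    then have "map f us \<noteq> []" "map f vs \<noteq> []" "set (map f us) \<subseteq> carrier N" "set (map f vs) \<subseteq> carrier N"
      using fc by (simp_all add: nonempty_tuples_def)
    from N.list_mult_append[OF this]
    show "h (conc R (nonempty_tuples M) (delta R us) (delta R vs)) = h (delta R us) \<otimes>\<^bsub>N\<^esub> h (delta R vs)"
      using us vs by (simp add: conc_delta[OF is_cring] nonempty_tuples_append hd)
  qed
  have rel: "h r = \<zero>\<^bsub>N\<^esub>" if n: "0 < n" and r: "r \<in> multilin_rel R M n" for n r
  proof -
    have "h r \<in> {\<zero>\<^bsub>N\<^esub>}"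
    proof (rule multilin_rel_minimal[OF submodule_zero[OF Nm] Nm hn[OF n] _ r])
      \<comment> \<open>With all other entries fixed the value depends linearly on the entry in one
        slot, and both kinds of relation then vanish.\<close>
      have slot: "\<exists>l. linear_map R M N l \<and> (\<forall>x\<in>carrier M. h (delta R (us @ [x] @ vs)) = l x)"
        if "us @ [z] @ vs \<in> tuples M n" for us vs z
      proof (intro exI conjI ballI)
        have "set us \<subseteq> carrier M" "set vs \<subseteq> carrier M"
          using that by (simp_all add: tuples_def)
        from N.list_mult_multilinear[OF module_axioms f fc[OF this(1)] fc[OF this(2)]]
        show "linear_map R M N (\<lambda>x. list_mult N (map f us @ [f x] @ map f vs))" .
        fix x assume "x \<in> carrier M"
        from tuples_upd[OF that this] have "us @ [x] @ vs \<in> nonempty_tuples M"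
          using tuples_nonempty[OF n] by blast
        from hd[OF this] show "h (delta R (us @ [x] @ vs)) = list_mult N (map f us @ [f x] @ map f vs)"
          by simp
      qed
      fix g assume "g \<in> multilin_gens R M n"
      then show "h g \<in> {\<zero>\<^bsub>N\<^esub>}"
      proof (rule linear_map_multilin_gens[OF Nm hn[OF n] _ submodule_zero[OF Nm]])
        fix us vs x y assume *: "us @ [x] @ vs \<in> tuples M n" "x \<in> carrier M" "y \<in> carrier M"
        obtain l where l: "linear_map R M N l" "\<And>x. x \<in> carrier M \<Longrightarrow> h (delta R (us @ [x] @ vs)) = l x"
          using slot[OF *(1)] by blast
        show "h (delta R (us @ [x \<oplus>\<^bsub>M\<^esub> y] @ vs)) \<ominus>\<^bsub>N\<^esub>
          (h (delta R (us @ [x] @ vs)) \<oplus>\<^bsub>N\<^esub> h (delta R (us @ [y] @ vs))) \<in> {\<zero>\<^bsub>N\<^esub>}"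
          unfolding l(2)[OF M.a_closed[OF *(2,3)]] l(2)[OF *(2)] l(2)[OF *(3)] linear_map_add[OF l(1) *(2,3)]
          using linear_map_closed[OF l(1)] *(2,3) by (simp add: N.M.a_minus_eq_zero_iff)
      next
        fix us vs c x assume *: "us @ [x] @ vs \<in> tuples M n" "x \<in> carrier M" "c \<in> carrier R"
        obtain l where l: "linear_map R M N l" "\<And>x. x \<in> carrier M \<Longrightarrow> h (delta R (us @ [x] @ vs)) = l x"
          using slot[OF *(1)] by blast
        show "h (delta R (us @ [c \<odot>\<^bsub>M\<^esub> x] @ vs)) \<ominus>\<^bsub>N\<^esub> (c \<odot>\<^bsub>N\<^esub> h (delta R (us @ [x] @ vs))) \<in> {\<zero>\<^bsub>N\<^esub>}"
          unfolding l(2)[OF smult_closed[OF *(3,2)]] l(2)[OF *(2)] linear_map_smult[OF l(1) *(3,2)]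
          using linear_map_closed[OF l(1)] *(2,3) by (simp add: N.M.a_minus_eq_zero_iff)
      qed
    qed
    then show ?thesis by simp
  qed
  interpret F: module R FT by (rule free_mod_mod)
  \<comment> \<open>An element is the sum of its homogeneous parts over the finitely many lengths
    that occur; induction over finite sets of degrees adds them up. Degree zero is excluded because
    the tuples are nonempty.\<close>
  have ker: "h d = \<zero>\<^bsub>N\<^esub>"
    if d: "d \<in> carrier FT" and parts: "\<And>n. 0 < n \<Longrightarrow> h (length_part R {n} d) = \<zero>\<^bsub>N\<^esub>" for d
  proof -
    have partc: "length_part R B d \<in> carrier FT" for B
      by (rule linear_map_closed[OF length_part_linear[OF is_cring] d]) simp
    have "h (length_part R B d) = \<zero>\<^bsub>N\<^esub>" if "finite B" "0 \<notin> B" for B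
      using that
    proof (induction B)
      case empty
      have "length_part R {} d = \<zero>\<^bsub>FT\<^esub>" by (simp add: length_part_def free_mod_simps)
      then show ?case using linear_map_zero[OF free_mod_mod Nm h] by simp
    next
      case (insert n B)
      have "length_part R (insert n B) d = length_part R {n} d \<oplus>\<^bsub>FT\<^esub> length_part R B d"
        using insert.hyps(2) free_mod_carrierD(1)[OF d] by (auto simp: length_part_def free_mod_simps)
      moreover have "0 < n" "0 \<notin> B" using insert.prems by auto
      ultimately show ?case
        using linear_map_add[OF h partc partc, of "{n}" B] parts insert.IH by simp
    qed
    moreover have "finite (length ` {w. d w \<noteq> \<zero>})"
      by (intro finite_imageI free_mod_carrierD(3)[OF d])
    moreover have "0 \<notin> length ` {w. d w \<noteq> \<zero>}"
      using free_mod_carrierD(4)[OF d] by (auto simp: nonempty_tuples_def)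
    ultimately have "h (length_part R (length ` {w. d w \<noteq> \<zero>}) d) = \<zero>\<^bsub>N\<^esub>" by blast
    moreover have "length_part R (length ` {w. d w \<noteq> \<zero>}) d = d"
    proof
      fix w
      show "length_part R (length ` {w. d w \<noteq> \<zero>}) d w = d w"
        by (cases "d w = \<zero>") (auto simp: length_part_def)
    qed
    ultimately show ?thesis by simp
  qed
  \<comment> \<open>Equal projections mean that the difference has all its homogeneous parts in the
    relations, on which \<open>h\<close> vanishes.\<close>
  have eq: "h p = h q" if p: "p \<in> carrier FT" and q: "q \<in> carrier FT"
    and pq: "tensor_proj R M p = tensor_proj R M q" for p q
  proof -
    have "h (p \<ominus>\<^bsub>FT\<^esub> q) = \<zero>\<^bsub>N\<^esub>"
    proof (rule ker[OF F.M.minus_closed[OF p q]])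
      fix n :: nat assume n: "0 < n"
      have "multilin_rel R M n +>\<^bsub>free_tuples R M n\<^esub> length_part R {n} p
          = multilin_rel R M n +>\<^bsub>free_tuples R M n\<^esub> length_part R {n} q"
        using fun_cong[OF pq, of n] n by (simp add: tensor_proj_def Suc_le_eq)
      then have "length_part R {n} (p \<ominus>\<^bsub>FT\<^esub> q) \<in> multilin_rel R M n"
        using a_coset_eq_iff[OF free_mod_mod multilin_rel_submodule linear_map_closed[OF part_linear[OF n] p]
            linear_map_closed[OF part_linear[OF n] q]]
          linear_map_minus[OF free_mod_mod free_mod_mod part_linear[OF n] p q] by simp
      then show "h (length_part R {n} (p \<ominus>\<^bsub>FT\<^esub> q)) = \<zero>\<^bsub>N\<^esub>" by (rule rel[OF n])
    qed
    then show ?thesis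
      using linear_map_minus[OF free_mod_mod Nm h p q] linear_map_closed[OF h] p q
      by (simp add: N.M.a_minus_eq_zero_iff)
  qed
  obtain g where "g \<in> extensional (carrier T)" and g: "\<And>p. p \<in> carrier FT \<Longrightarrow> g (tensor_proj R M p) = h p"
    by (rule factor_through_surj[where p = "tensor_proj R M" and h = h, OF tensor_proj_surj])
      (erule (2) eq, rule that)
  show ?thesis
  proof (rule that)
    show "linear_map R T N g"
      by (rule linear_map_factor[OF tensor_proj_linear tensor_proj_surj h _ free_mod_mod], rule g)
    fix x assume x: "x \<in> carrier M"
    then have "[x] \<in> nonempty_tuples M" by (simp add: nonempty_tuples_def)
    then show "g (pure_tensor R M [x]) = f x"
      by (simp add: pure_tensor_eq_proj g delta_closed[OF is_cring] hd)
  next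
    fix s t assume "s \<in> carrier T" "t \<in> carrier T"
    then obtain p q where "p \<in> carrier FT" "s = tensor_proj R M p" "q \<in> carrier FT" "t = tensor_proj R M q"
      unfolding tensor_proj_surj[symmetric] by blast
    then show "g (s \<otimes>\<^bsub>T\<^esub> t) = g s \<otimes>\<^bsub>N\<^esub> g t"
      using linear_map_closed[OF conc_FT_linear(2)] by (simp add: tensor_proj_mult[symmetric] g hm)
  qed
qed

text \<open>In degree one the multilinearity relations have a single slot and thus express
  additivity and homogeneity of the inclusion.\<close>

lemma pure_tensor_singleton_linear: "linear_map R M T (\<lambda>x. pure_tensor R M [x])"
proof -
  interpret T: nonunital_algebra R T by (rule tensor_nonunital_algebra)
  interpret F: module R FT by (rule free_mod_mod)
  note F1 = free_mod_mod[of "tuples M 1"]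
  interpret F1: module R "free_tuples R M 1" by (rule F1)
  have mem: "[x] \<in> nonempty_tuples M" if "x \<in> carrier M" for x
    using that by (simp add: nonempty_tuples_def)
  have mem1: "[] @ [x] @ [] \<in> tuples M 1" if "x \<in> carrier M" for x
    using that by (simp add: tuples_def)
  have d: "delta R [x] \<in> carrier FT" "delta R [x] \<in> carrier (free_tuples R M 1)" if "x \<in> carrier M" for x
    using delta_closed[OF is_cring mem[OF that]] delta_closed[OF is_cring mem1[OF that]] by simp_all
  \<comment> \<open>Elements supported on tuples with one entry have no component in any other
    degree, so degree one alone decides whether projections agree.\<close>
  have eqI: "tensor_proj R M p = tensor_proj R M q"
    if pq: "p \<in> carrier (free_tuples R M 1)" "q \<in> carrier (free_tuples R M 1)"
      "p \<ominus>\<^bsub>free_tuples R M 1\<^esub> q \<in> multilin_rel R M 1" for p q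
  proof
    fix n
    have *: "length_part R {n} r = (if n = 1 then r else (\<lambda>w. \<zero>))" if "r \<in> carrier (free_tuples R M 1)" for r
      using free_mod_carrierD(2)[OF that] by (auto simp: length_part_def tuples_def)
    show "tensor_proj R M p n = tensor_proj R M q n"
      using a_coset_eq_iff[OF F1 multilin_rel_submodule pq(1,2)] pq(3)
      by (simp add: tensor_proj_def *[OF pq(1)] *[OF pq(2)])
  qed
  show ?thesis
  proof (rule linear_mapI)
    fix x assume x: "x \<in> carrier M"
    show "pure_tensor R M [x] \<in> carrier T" by (rule pure_tensor_closed[OF mem[OF x]])
    {
      fix y assume y: "y \<in> carrier M"
      have "tensor_proj R M (delta R [x \<oplus>\<^bsub>M\<^esub> y]) = tensor_proj R M (delta R [x] \<oplus>\<^bsub>free_tuples R M 1\<^esub> delta R [y])"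
        using x y multilin_gens_add[OF mem1[OF x] x y]
        by (intro eqI F1.M.a_closed d M.a_closed) (simp_all add: multilin_rel_def hull_inc)
      also have "\<dots> = tensor_proj R M (delta R [x] \<oplus>\<^bsub>FT\<^esub> delta R [y])"
        by (simp only: free_mod_simps)
      finally show "pure_tensor R M [x \<oplus>\<^bsub>M\<^esub> y] = pure_tensor R M [x] \<oplus>\<^bsub>T\<^esub> pure_tensor R M [y]"
        using x y by (simp add: pure_tensor_eq_proj mem linear_map_add[OF tensor_proj_linear] d)
    }
    fix c assume c: "c \<in> carrier R"
    have "tensor_proj R M (delta R [c \<odot>\<^bsub>M\<^esub> x]) = tensor_proj R M (c \<odot>\<^bsub>free_tuples R M 1\<^esub> delta R [x])"
      using x c multilin_gens_smult[OF mem1[OF x] x c]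
      by (intro eqI F1.smult_closed d smult_closed) (simp_all add: multilin_rel_def hull_inc)
    also have "\<dots> = tensor_proj R M (c \<odot>\<^bsub>FT\<^esub> delta R [x])"
      by (simp only: free_mod_simps)
    finally show "pure_tensor R M [c \<odot>\<^bsub>M\<^esub> x] = c \<odot>\<^bsub>T\<^esub> pure_tensor R M [x]"
      using x c by (simp add: pure_tensor_eq_proj mem linear_map_smult[OF tensor_proj_linear] d)
  qed
qed

end

section \<open>Bracketed words\<close>

primrec is_gen :: "'x letter \<Rightarrow> bool"
  where
    "is_gen (Gen x) = True"
  | "is_gen (Br w) = False"

abbreviation alternating :: "'x word \<Rightarrow> bool"
  where "alternating \<equiv> successively (\<lambda>a b. is_gen a \<noteq> is_gen b)"

text \<open>The kind \<open>t\<close> of the first letter is a parameter, so the powers that start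
  with a generator and those that start with a bracket are treated at once.\<close>

lemma cat_pow_alternating:
  assumes A: "\<And>a. a \<in> A \<Longrightarrow> is_gen a = t" and B: "\<And>b. b \<in> B \<Longrightarrow> is_gen b = (\<not> t)"
    and l: "l \<in> cat_pow (cat ((\<lambda>a. [a]) ` A) ((\<lambda>b. [b]) ` B)) r"
  shows "set l \<subseteq> A \<union> B \<and> alternating l \<and> (l \<noteq> [] \<longrightarrow> is_gen (hd l) = t \<and> is_gen (last l) = (\<not> t))
    \<and> (0 < r \<longrightarrow> l \<noteq> [])"
  using l
proof (induction r arbitrary: l)
  case (Suc r)
  then obtain a b m where l: "l = [a, b] @ m" "a \<in> A" "b \<in> B"
    and m: "m \<in> cat_pow (cat ((\<lambda>a. [a]) ` A) ((\<lambda>b. [b]) ` B)) r"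
    by (auto simp: cat_def)
  from Suc.IH[OF m] show ?case
    using l A B by (cases "m = []") (auto simp: successively_append_iff successively_Cons)
qed simp

text \<open>Two letters are peeled off at a time. What remains in the end is nothing or one letter
  of the initial kind, which is the difference between the two alternatives.\<close>

lemma alternating_cat_pow:
  assumes A: "\<And>a. a \<in> A \<Longrightarrow> is_gen a = t" and B: "\<And>b. b \<in> B \<Longrightarrow> is_gen b = (\<not> t)"
    and "l \<noteq> []" "set l \<subseteq> A \<union> B" "alternating l" "is_gen (hd l) = t"
  shows "(\<exists>r\<ge>1. l \<in> cat_pow (cat ((\<lambda>a. [a]) ` A) ((\<lambda>b. [b]) ` B)) r) \<or>
    (\<exists>r. l \<in> cat (cat_pow (cat ((\<lambda>a. [a]) ` A) ((\<lambda>b. [b]) ` B)) r) ((\<lambda>a. [a]) ` A))"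
  using assms(3-6)
proof (induction l rule: induct_list012)
  case (2 a)
  then have "[a] \<in> cat (cat_pow (cat ((\<lambda>a. [a]) ` A) ((\<lambda>b. [b]) ` B)) 0) ((\<lambda>a. [a]) ` A)"
    using B by (auto simp: cat_def)
  then show ?case by blast
next
  case (3 a b m)
  let ?C = "cat ((\<lambda>a. [a]) ` A) ((\<lambda>b. [b]) ` B)"
  have ab: "a \<in> A" "b \<in> B" using 3 A B by auto
  then have C: "[a, b] \<in> ?C"
    unfolding cat_def by (intro CollectI exI[of _ "[a]"] exI[of _ "[b]"]) auto
  have step: "[a, b] @ l \<in> cat_pow ?C (Suc r)" if "l \<in> cat_pow ?C r" for l r
    using C that unfolding cat_pow.simps cat_def by blast
  show ?case
  proof (cases "m = []")
    case True
    then have "a # b # m \<in> cat_pow ?C 1" using step[of "[]" 0] by simp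
    then show ?thesis by blast
  next
    case False
    have "is_gen (hd m) = t" "alternating m" "set m \<subseteq> A \<union> B"
      using 3 False by (cases m; auto simp: successively_Cons)+
    from "3.IH"(1)[OF False this(3,2,1)] show ?thesis
    proof (elim disjE exE conjE)
      fix r assume "m \<in> cat_pow ?C r"
      then have "a # b # m \<in> cat_pow ?C (Suc r)" using step by simp
      then show ?thesis by (intro disjI1 exI[of _ "Suc r"]) simp
    next
      fix r assume "m \<in> cat (cat_pow ?C r) ((\<lambda>a. [a]) ` A)"
      then obtain l x where "m = l @ [x]" "l \<in> cat_pow ?C r" "x \<in> A"
        unfolding cat_def by blast
      then have "a # b # m = ([a, b] @ l) @ [x]" "[a, b] @ l \<in> cat_pow ?C (Suc r)" "[x] \<in> (\<lambda>a. [a]) ` A"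
        using step by simp_all
      then have "a # b # m \<in> cat (cat_pow ?C (Suc r)) ((\<lambda>a. [a]) ` A)"
        unfolding cat_def by blast
      then show ?thesis by blast
    qed
  qed
qed simp

text \<open>The four unions sort alternating words by the kind of the first letter and the parity of
  the length. Together they exhaust all of them, which replaces concatenation powers by a condition
  on neighbouring letters.\<close>

lemma Lambda_eq:
  "Lambda ((\<lambda>x. [Gen x]) ` X) Z = {l. l \<noteq> [] \<and> set l \<subseteq> Gen ` X \<union> Br ` Z \<and> alternating l}"
    (is "_ = ?S")
proof -
  let ?A = "(\<lambda>a. [a]) ` Gen ` X" and ?B = "(\<lambda>b. [b]) ` Br ` Z"
  have Y: "(\<lambda>x. [Gen x]) ` X = ?A" and B: "brackets Z = ?B"
    by (auto simp: brackets_def)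
  have g: "\<And>a. a \<in> Gen ` X \<Longrightarrow> is_gen a = True" "\<And>b. b \<in> Br ` Z \<Longrightarrow> is_gen b = (\<not> True)"
    and b: "\<And>a. a \<in> Br ` Z \<Longrightarrow> is_gen a = False" "\<And>b. b \<in> Gen ` X \<Longrightarrow> is_gen b = (\<not> False)"
    by auto
  show ?thesis
    unfolding Lambda_def Y B
  proof (intro equalityI subsetI)
    fix l assume "l \<in> (\<Union>r\<in>{1..}. cat_pow (cat ?A ?B) r) \<union> (\<Union>r. cat (cat_pow (cat ?A ?B) r) ?A) \<union>
      (\<Union>r\<in>{1..}. cat_pow (cat ?B ?A) r) \<union> (\<Union>r. cat (cat_pow (cat ?B ?A) r) ?B)"
    then consider (1) r where "1 \<le> r" "l \<in> cat_pow (cat ?A ?B) r"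
      | (2) r m a where "l = m @ [a]" "m \<in> cat_pow (cat ?A ?B) r" "a \<in> Gen ` X"
      | (3) r where "1 \<le> r" "l \<in> cat_pow (cat ?B ?A) r"
      | (4) r m a where "l = m @ [a]" "m \<in> cat_pow (cat ?B ?A) r" "a \<in> Br ` Z"
      unfolding cat_def[of _ ?A] cat_def[of _ ?B] by auto
    then show "l \<in> ?S"
    proof cases
      case 1
      then show ?thesis using cat_pow_alternating[OF g 1(2)] by auto
    next
      case 2
      then show ?thesis using cat_pow_alternating[OF g 2(2)] by (auto simp: successively_append_iff)
    next
      case 3
      then show ?thesis using cat_pow_alternating[OF b 3(2)] by auto
    next
      case 4
      then show ?thesis using cat_pow_alternating[OF b 4(2)] by (auto simp: successively_append_iff)
    qed
  next
    fix l assume l: "l \<in> ?S"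
    show "l \<in> (\<Union>r\<in>{1..}. cat_pow (cat ?A ?B) r) \<union> (\<Union>r. cat (cat_pow (cat ?A ?B) r) ?A) \<union>
      (\<Union>r\<in>{1..}. cat_pow (cat ?B ?A) r) \<union> (\<Union>r. cat (cat_pow (cat ?B ?A) r) ?B)"
    proof (cases "is_gen (hd l)")
      case True
      then have "(\<exists>r\<ge>1. l \<in> cat_pow (cat ?A ?B) r) \<or> (\<exists>r. l \<in> cat (cat_pow (cat ?A ?B) r) ?A)"
        using l by (intro alternating_cat_pow[where t = True]) auto
      then show ?thesis by auto
    next
      case False
      then have "(\<exists>r\<ge>1. l \<in> cat_pow (cat ?B ?A) r) \<or> (\<exists>r. l \<in> cat (cat_pow (cat ?B ?A) r) ?B)"
        using l by (intro alternating_cat_pow[where t = False]) auto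
      then show ?thesis by auto
    qed
  qed
qed

lemma words_upto_Suc:
  "words_upto X (Suc n) = {l. l \<noteq> [] \<and> set l \<subseteq> Gen ` X \<union> Br ` words_upto X n \<and> alternating l}"
  by (simp add: Lambda_eq)

lemma words_upto_mono: "m \<le> n \<Longrightarrow> words_upto X m \<subseteq> words_upto X n"
proof (rule lift_Suc_mono_le)
  show "words_upto X k \<subseteq> words_upto X (Suc k)" for k
  proof (induction k)
    case 0
    show ?case unfolding words_upto_Suc by auto
  next
    case (Suc k)
    then show ?case unfolding words_upto_Suc by blast
  qed
qed

definition letters :: "'x set \<Rightarrow> 'x letter set"
  where "letters X = Gen ` X \<union> Br ` words X"

text \<open>The stages increase and a word has only finitely many letters, so all brackets in it
  already occur at one common stage. The resulting description is free of depth and is the one used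
  from here on.\<close>

lemma words_iff: "w \<in> words X \<longleftrightarrow> w \<noteq> [] \<and> set w \<subseteq> letters X \<and> alternating w"
proof
  assume "w \<in> words X"
  then obtain n where n: "w \<in> words_upto X n" by (auto simp: words_def)
  then have "w \<in> words_upto X (Suc n)" using words_upto_mono[of n "Suc n" X] by auto
  moreover have "words_upto X n \<subseteq> words X" by (auto simp: words_def)
  ultimately show "w \<noteq> [] \<and> set w \<subseteq> letters X \<and> alternating w"
    unfolding words_upto_Suc letters_def by blast
next
  assume w: "w \<noteq> [] \<and> set w \<subseteq> letters X \<and> alternating w"
  have "\<exists>n. set w \<subseteq> Gen ` X \<union> Br ` words_upto X n"
    using conjunct1[OF conjunct2[OF w]]
  proof (induction w)
    case (Cons a w)
    then obtain n where n: "set w \<subseteq> Gen ` X \<union> Br ` words_upto X n" by auto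
    obtain m where m: "a \<in> Gen ` X \<union> Br ` words_upto X m"
      using Cons.prems by (auto simp: letters_def words_def)
    have "set (a # w) \<subseteq> Gen ` X \<union> Br ` words_upto X (max m n)"
    proof -
      have "words_upto X m \<subseteq> words_upto X (max m n)" "words_upto X n \<subseteq> words_upto X (max m n)"
        by (simp_all add: words_upto_mono)
      then show ?thesis using n m by (simp only: list.set) blast
    qed
    then show ?case by blast
  qed simp
  then obtain n where "set w \<subseteq> Gen ` X \<union> Br ` words_upto X n" by blast
  then have "w \<in> words_upto X (Suc n)" using w unfolding words_upto_Suc by blast
  then show "w \<in> words X" unfolding words_def by blast
qed

lemma Gen_in_letters [simp]: "Gen x \<in> letters X \<longleftrightarrow> x \<in> X"
  and Br_in_letters [simp]: "Br w \<in> letters X \<longleftrightarrow> w \<in> words X"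
  by (auto simp: letters_def)

lemma singleton_in_words [simp]: "[a] \<in> words X \<longleftrightarrow> a \<in> letters X"
  by (simp add: words_iff)

text \<open>The words that may occur in the product of the letters \<open>a\<close> and
  \<open>b\<close>: equal kinds merge into one letter of that kind, different kinds are juxtaposed.
  Recording the kind is what allows the result to be spliced into a word.\<close>

definition joint_words :: "'x set \<Rightarrow> 'x letter \<Rightarrow> 'x letter \<Rightarrow> 'x word set"
  where "joint_words X a b =
    (if is_gen a = is_gen b then {[c] |c. c \<in> letters X \<and> is_gen c = is_gen a} else {[a, b]})"

lemma joint_words_same: "is_gen a = is_gen b \<Longrightarrow> joint_words X a b = {[c] |c. c \<in> letters X \<and> is_gen c = is_gen a}"
  by (simp add: joint_words_def)

text \<open>A member of \<open>joint_words\<close> starts with the kind of \<open>a\<close> and ends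
  with the kind of \<open>b\<close>, so alternation at both seams is inherited from the given
  words.\<close>

lemma joint_words_splice:
  assumes "u @ [a] \<in> words X" "b # v \<in> words X" "s \<in> joint_words X a b"
  shows "u @ s @ v \<in> words X"
  using assms
  by (cases "u = []"; cases "v = []")
    (auto simp: words_iff joint_words_def successively_append_iff successively_Cons split: if_splits)

lemma joint_words_subset:
  "\<lbrakk>a \<in> letters X; b \<in> letters X\<rbrakk> \<Longrightarrow> joint_words X a b \<subseteq> words X"
  by (auto simp: joint_words_def words_iff)

lemma joint_words_ends:
  "s \<in> joint_words X a b \<Longrightarrow> s \<noteq> [] \<and> is_gen (hd s) = is_gen a \<and> is_gen (last s) = is_gen b"
  by (auto simp: joint_words_def split: if_splits)

lemma words_append:
  "\<lbrakk>u \<in> words X; v \<in> words X; is_gen (last u) \<noteq> is_gen (hd v)\<rbrakk> \<Longrightarrow> u @ v \<in> words X"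
  by (auto simp: words_iff successively_append_iff)

lemma words_lettersD: "\<lbrakk>w \<in> words X; a \<in> set w\<rbrakk> \<Longrightarrow> a \<in> letters X"
  by (auto simp: words_iff)

section \<open>The free Nijenhuis algebra on an algebra with a basis\<close>

locale algebra_with_basis = nonunital_algebra K A
  for K :: "('k, 'y) ring_scheme" (structure) and A :: "('k, 'a, 'z) module_scheme" (structure) +
  fixes X :: "'a set"
  assumes basis: "is_basis K A X"
begin

abbreviation "W \<equiv> words X"
abbreviation "F \<equiv> word_space K X"
abbreviation "P \<equiv> word_op K X"
abbreviation "j \<equiv> alg_emb K A X"
abbreviation "lp \<equiv> letter_prod K A X"
abbreviation "wp \<equiv> word_prod K A X"
abbreviation "N \<equiv> free_nijenhuis K A X"
abbreviation nij_mult (infixl \<open>\<diamond>\<close> 70) where "p \<diamond> q \<equiv> p \<otimes>\<^bsub>N\<^esub> q"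

lemma K_cring: "cring K" ..

lemmas free_module = free_mod_module[OF K_cring]
lemmas delta_in = delta_closed[OF K_cring]

lemma basis_closed: "x \<in> X \<Longrightarrow> x \<in> carrier A"
  using basis by (auto simp: is_basis_def)

lemma comb_linear: "linear_map K (free_mod K X) A (lin_ext K A (\<lambda>x. x))"
  by (rule linear_map_lin_ext[OF module_axioms basis_closed])

text \<open>\<open>is_basis\<close> states independence as a trivial kernel; applied to a difference
  it makes the coordinates unique, hence the definite description in \<open>coords\<close>
  meaningful.\<close>

lemma comb_inj:
  assumes "p \<in> carrier (free_mod K X)" "q \<in> carrier (free_mod K X)"
    and "lin_ext K A (\<lambda>x. x) p = lin_ext K A (\<lambda>x. x) q"
  shows "p = q"
proof -
  interpret FX: module K "free_mod K X" by (rule free_module)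
  have "lin_ext K A (\<lambda>x. x) (p \<ominus>\<^bsub>free_mod K X\<^esub> q) = \<zero>\<^bsub>A\<^esub>"
    using linear_map_minus[OF free_module module_axioms comb_linear assms(1,2)]
      linear_map_closed[OF comb_linear assms(2)] assms(3) by (simp add: M.a_minus_eq_zero_iff)
  then have "p \<ominus>\<^bsub>free_mod K X\<^esub> q = \<zero>\<^bsub>free_mod K X\<^esub>"
    using basis FX.M.minus_closed[OF assms(1,2)] by (simp add: is_basis_def)
  then show ?thesis using FX.M.a_minus_eq_zero_iff[OF assms(1,2)] by simp
qed

lemma coords:
  assumes "a \<in> carrier A"
  shows "coords K A X a \<in> carrier (free_mod K X)" "lin_ext K A (\<lambda>x. x) (coords K A X a) = a"
proof -
  obtain p where p: "p \<in> carrier (free_mod K X)" "lin_ext K A (\<lambda>x. x) p = a"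
    using basis assms unfolding is_basis_def by blast
  have "coords K A X a \<in> carrier (free_mod K X) \<and> lin_ext K A (\<lambda>x. x) (coords K A X a) = a"
    unfolding coords_def
  proof (rule theI[where P = "\<lambda>p. p \<in> carrier (free_mod K X) \<and> lin_ext K A (\<lambda>x. x) p = a" and a = p])
    show "p \<in> carrier (free_mod K X) \<and> lin_ext K A (\<lambda>x. x) p = a" using p by simp
    fix q assume "q \<in> carrier (free_mod K X) \<and> lin_ext K A (\<lambda>x. x) q = a"
    then show "q = p" using comb_inj[of q p] p by simp
  qed
  then show "coords K A X a \<in> carrier (free_mod K X)" "lin_ext K A (\<lambda>x. x) (coords K A X a) = a"
    by simp_all
qed

lemma coords_eqI: "\<lbrakk>p \<in> carrier (free_mod K X); lin_ext K A (\<lambda>x. x) p = a; a \<in> carrier A\<rbrakk> \<Longrightarrow> coords K A X a = p"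
  using comb_inj coords by simp

lemma coords_linear: "linear_map K A (free_mod K X) (coords K A X)"
proof -
  interpret FX: module K "free_mod K X" by (rule free_module)
  show ?thesis
    by (rule linear_mapI)
      (auto intro!: coords_eqI simp: coords linear_map_add[OF comb_linear] linear_map_smult[OF comb_linear])
qed

lemma coords_basis: "x \<in> X \<Longrightarrow> coords K A X x = delta K x"
  using basis_closed by (intro coords_eqI delta_in) (simp_all add: lin_ext_delta[OF module_axioms])

lemma basis_eqI:
  assumes V: "module K V" and f: "linear_map K A V f" and g: "linear_map K A V g"
    and eq: "\<And>x. x \<in> X \<Longrightarrow> f x = g x" and a: "a \<in> carrier A"
  shows "f a = g a"
proof -
  have "f (lin_ext K A (\<lambda>x. x) (coords K A X a)) = g (lin_ext K A (\<lambda>x. x) (coords K A X a))"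
  proof (rule free_mod_eqI[OF V linear_map_comp[OF f comb_linear] linear_map_comp[OF g comb_linear] coords(1)[OF a]])
    fix x assume "x \<in> X"
    then show "f (lin_ext K A (\<lambda>x. x) (delta K x)) = g (lin_ext K A (\<lambda>x. x) (delta K x))"
      using basis_closed eq by (simp add: lin_ext_delta[OF module_axioms])
  qed
  then show ?thesis using coords(2)[OF a] by simp
qed

text \<open>The target is left open: with all words it gives the embedding into \<open>F\<close>,
  and with one-letter words of generators it bounds the support of a product of two
  generators.\<close>

lemma emb_linear_gens:
  assumes S: "\<And>x. x \<in> X \<Longrightarrow> [Gen x] \<in> S" "S \<subseteq> W"
  shows "linear_map K A (free_mod K S) j"
proof (rule linear_map_cong[OF module_axioms])
  show "linear_map K A (free_mod K S) (\<lambda>a. lin_ext K (free_mod K S) (\<lambda>x. delta K [Gen x]) (coords K A X a))"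
    by (rule linear_map_comp[OF linear_map_lin_ext[OF free_module delta_in[OF S(1)]] coords_linear])
  fix a assume "a \<in> carrier A"
  then show "lin_ext K (free_mod K S) (\<lambda>x. delta K [Gen x]) (coords K A X a) = j a"
    unfolding alg_emb_def
    by (intro lin_ext_free_mod_cong_set[OF K_cring S(2) coords(1), symmetric] delta_in S(1))
qed

lemma emb_linear: "linear_map K A F j"
  by (rule emb_linear_gens) simp_all

lemma emb_basis: "x \<in> X \<Longrightarrow> j x = delta K [Gen x]"
  unfolding alg_emb_def coords_basis by (rule lin_ext_delta[OF free_module], rule delta_in) simp

lemma op_word: "w \<in> W \<Longrightarrow> P (delta K w) = delta K [Br w]"
  unfolding word_op_def by (rule lin_ext_delta[OF free_module], rule delta_in) simp

text \<open>The counterpart for brackets: each summand in a product of two brackets has the operator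
  outermost and so consists of single brackets.\<close>

lemma op_linear_gens:
  assumes S: "\<And>w. w \<in> W \<Longrightarrow> [Br w] \<in> S" "S \<subseteq> W"
  shows "linear_map K F (free_mod K S) P"
proof (rule linear_map_cong[OF free_module])
  show "linear_map K F (free_mod K S) (lin_ext K (free_mod K S) (\<lambda>w. delta K [Br w]))"
    by (rule linear_map_lin_ext[OF free_module delta_in[OF S(1)]])
  fix p assume "p \<in> carrier F"
  then show "lin_ext K (free_mod K S) (\<lambda>w. delta K [Br w]) p = P p"
    unfolding word_op_def by (rule lin_ext_free_mod_cong_set[OF K_cring S(2) _ delta_in[OF S(1)], symmetric])
qed

lemma op_linear': "linear_map K F F P"
  by (rule op_linear_gens) simp_all

section \<open>Closedness and support of products of words\<close>

lemma word_prod_snoc_Cons: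
  "wp (u @ [a]) (b # v) = lin_ext K F (\<lambda>s. delta K (u @ s @ v)) (lp a b)"
  by simp

declare word_prod.simps [simp del]

lemma word_prod_closed_aux:
  assumes u: "u @ [a] \<in> W" and v: "b # v \<in> W" and ab: "lp a b \<in> carrier (free_mod K (joint_words X a b))"
  shows "wp (u @ [a]) (b # v) \<in> carrier F"
  unfolding word_prod_snoc_Cons
  by (rule lin_ext_closed[OF free_module _ ab]) (rule delta_in[OF joint_words_splice[OF u v]])

text \<open>The two claims depend on each other. Splicing needs the support of the product of the
  two letters at the junction, and for two brackets that support is found from products of smaller
  words, which must already be closed.\<close>

lemma word_prod_closed_all:
  "\<lbrakk>u \<in> W; v \<in> W\<rbrakk> \<Longrightarrow> wp u v \<in> carrier F \<and>
    lp (last u) (hd v) \<in> carrier (free_mod K (joint_words X (last u) (hd v)))"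
proof (induction "size_list size u + size_list size v" arbitrary: u v rule: less_induct)
  case less
  have ne: "u \<noteq> []" "v \<noteq> []" using less.prems by (simp_all add: words_iff)
  define u' a b v' where "u' = butlast u" and "a = last u" and "b = hd v" and "v' = tl v"
  then have uv: "u = u' @ [a]" "v = b # v'" using ne by simp_all
  have ab: "a \<in> letters X" "b \<in> letters X" using less.prems uv by (simp_all add: words_iff)
  have "lp a b \<in> carrier (free_mod K (joint_words X a b))"
  proof (cases a)
    case a: (Gen x)
    show ?thesis
    proof (cases b)
      case b: (Gen y)
      have "x \<otimes>\<^bsub>A\<^esub> y \<in> carrier A" using ab a b by (simp add: mult_closed basis_closed)
      then show ?thesis
        using linear_map_closed[OF emb_linear_gens[of "joint_words X a b"]] joint_words_subset[OF ab]
        by (simp add: a b joint_words_def)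
    next
      case b: (Br w)
      show ?thesis by (simp add: a b joint_words_def delta_in)
    qed
  next
    case a: (Br w)
    show ?thesis
    proof (cases b)
      case b: (Gen y)
      show ?thesis by (simp add: a b joint_words_def delta_in)
    next
      case b: (Br z)
      let ?S = "joint_words X a b"
      interpret S: module K "free_mod K ?S" by (rule free_module)
      have wz: "w \<in> W" "z \<in> W" using ab a b by simp_all
      have c: "wp [Br w] z \<in> carrier F" "wp w [Br z] \<in> carrier F" "wp w z \<in> carrier F"
        using less.hyps[of "[Br w]" z] less.hyps[of w "[Br z]"] less.hyps[of w z] wz uv a b by simp_all
      have P: "linear_map K F (free_mod K ?S) P"
        by (rule op_linear_gens[OF _ joint_words_subset[OF ab]]) (simp add: a b joint_words_def)
      \<comment> \<open>The bracket clause adds and subtracts in \<open>F\<close>, while closedness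
        is wanted in the span of \<open>joint_words\<close>; the pointwise operations agree.\<close>
      have eq: "p \<oplus>\<^bsub>F\<^esub> q \<ominus>\<^bsub>F\<^esub> r = p \<oplus>\<^bsub>free_mod K ?S\<^esub> q \<ominus>\<^bsub>free_mod K ?S\<^esub> r"
        if "r \<in> carrier (free_mod K ?S)" for p q r
      proof -
        have "r \<in> carrier F" using that free_mod_mono[OF joint_words_subset[OF ab]] by blast
        then show ?thesis
          using that by (simp add: a_minus_def free_mod_simps free_mod_uminus[OF K_cring])
      qed
      note Pc = linear_map_closed[OF P]
      have "lp a b = P (wp [Br w] z) \<oplus>\<^bsub>F\<^esub> P (wp w [Br z]) \<ominus>\<^bsub>F\<^esub> P (P (wp w z))"
        by (simp add: a b)
      also have "\<dots> = P (wp [Br w] z) \<oplus>\<^bsub>free_mod K ?S\<^esub> P (wp w [Br z]) \<ominus>\<^bsub>free_mod K ?S\<^esub> P (P (wp w z))"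
        by (rule eq[OF Pc[OF linear_map_closed[OF op_linear' c(3)]]])
      also have "\<dots> \<in> carrier (free_mod K ?S)"
        by (intro S.M.minus_closed S.M.a_closed Pc c linear_map_closed[OF op_linear'])
      finally show ?thesis .
    qed
  qed
  then show ?case
    using word_prod_closed_aux[of u' a b v'] less.prems uv by simp
qed

lemma word_prod_closed: "\<lbrakk>u \<in> W; v \<in> W\<rbrakk> \<Longrightarrow> wp u v \<in> carrier F"
  using word_prod_closed_all by blast

lemma letter_prod_closed:
  "\<lbrakk>a \<in> letters X; b \<in> letters X\<rbrakk> \<Longrightarrow> lp a b \<in> carrier (free_mod K (joint_words X a b))"
  using word_prod_closed_all[of "[a]" "[b]"] by simp

lemma letter_prod_closed': "\<lbrakk>a \<in> letters X; b \<in> letters X\<rbrakk> \<Longrightarrow> lp a b \<in> carrier F"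
  using letter_prod_closed free_mod_mono[OF joint_words_subset] by blast

lemma letter_prod_diff: "is_gen a \<noteq> is_gen b \<Longrightarrow> lp a b = delta K [a, b]"
  by (cases a; cases b) simp_all

lemma word_prod_letters: "\<lbrakk>a \<in> letters X; b \<in> letters X\<rbrakk> \<Longrightarrow> wp [a] [b] = lp a b"
  using word_prod_snoc_Cons[of "[]" a b "[]"] lin_ext_id[OF K_cring letter_prod_closed'] by simp

lemma word_prod_concat:
  assumes "u \<in> W" "v \<in> W" "is_gen (last u) \<noteq> is_gen (hd v)"
  shows "wp u v = delta K (u @ v)"
proof -
  have ne: "u \<noteq> []" "v \<noteq> []" using assms by (simp_all add: words_iff)
  define u' a b v' where "u' = butlast u" and "a = last u" and "b = hd v" and "v' = tl v"
  then have uv: "u = u' @ [a]" "v = b # v'" using ne by simp_all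
  have "wp u v = lin_ext K F (\<lambda>s. delta K (u' @ s @ v')) (delta K [a, b])"
    using assms(3) unfolding uv word_prod_snoc_Cons by (simp add: letter_prod_diff)
  also have "\<dots> = delta K (u @ v)"
    using delta_in[OF words_append[OF assms]] uv by (subst lin_ext_delta[OF free_module]) simp_all
  finally show ?thesis .
qed

section \<open>The product and the Nijenhuis identity on the span of words\<close>

lemma nij_simps:
  "carrier N = carrier F" "\<zero>\<^bsub>N\<^esub> = \<zero>\<^bsub>F\<^esub>" "p \<oplus>\<^bsub>N\<^esub> q = p \<oplus>\<^bsub>F\<^esub> q" "c \<odot>\<^bsub>N\<^esub> p = c \<odot>\<^bsub>F\<^esub> p"
  "p \<otimes>\<^bsub>N\<^esub> q = lin_ext K F (\<lambda>u. lin_ext K F (\<lambda>v. wp u v) q) p"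
  by (simp_all add: free_nijenhuis_def)

lemma linear_nij: "linear_map K N V f = linear_map K F V f" "linear_map K V N g = linear_map K V F g"
  by (simp_all add: linear_map_def nij_simps)

lemma nij_module: "module K N"
  unfolding free_nijenhuis_def by (rule module_mult_update[OF free_module])

lemma nij_minus:
  assumes "q \<in> carrier F"
  shows "p \<ominus>\<^bsub>N\<^esub> q = p \<ominus>\<^bsub>F\<^esub> q"
proof -
  interpret F: module K F by (rule free_module)
  interpret N: module K N by (rule nij_module)
  have "\<ominus>\<^bsub>N\<^esub> q = \<ominus>\<^bsub>F\<^esub> q"
    using F.M.l_neg[OF assms] assms by (intro N.M.minus_equality) (simp_all add: nij_simps)
  then show ?thesis by (simp add: a_minus_def nij_simps)
qed

lemma nij_mult_right: "p \<in> carrier F \<Longrightarrow> linear_map K F F (\<lambda>q. p \<diamond> q)"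
  unfolding nij_simps(5)
  by (rule linear_map_lin_ext_param[OF free_module], assumption)
    (rule linear_map_lin_ext[OF free_module word_prod_closed])

lemma nij_mult_left: "q \<in> carrier F \<Longrightarrow> linear_map K F F (\<lambda>p. p \<diamond> q)"
  unfolding nij_simps(5)
  by (rule linear_map_lin_ext[OF free_module], rule lin_ext_closed[OF free_module])
    (rule word_prod_closed)

lemma nij_mult_closed: "\<lbrakk>p \<in> carrier F; q \<in> carrier F\<rbrakk> \<Longrightarrow> p \<diamond> q \<in> carrier F"
  by (rule linear_map_closed[OF nij_mult_right])

lemma nij_mult_delta: "\<lbrakk>u \<in> W; v \<in> W\<rbrakk> \<Longrightarrow> delta K u \<diamond> delta K v = wp u v"
  unfolding nij_simps(5) by (simp add: lin_ext_delta[OF free_module] word_prod_closed)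

lemma op_closed: "p \<in> carrier F \<Longrightarrow> P p \<in> carrier F"
  by (rule linear_map_closed[OF op_linear'])

text \<open>On basis words this is the clause of \<open>letter_prod\<close> for two brackets; both
  sides are bilinear.\<close>

lemma nij_nijenhuis:
  assumes p: "p \<in> carrier F" and q: "q \<in> carrier F"
  shows "P p \<diamond> P q = P (P p \<diamond> q) \<oplus>\<^bsub>F\<^esub> P (p \<diamond> P q) \<ominus>\<^bsub>F\<^esub> P (P (p \<diamond> q))"
proof (rule bilinear_eqI[where f = "\<lambda>p q. P p \<diamond> P q" and
      g = "\<lambda>p q. P (P p \<diamond> q) \<oplus>\<^bsub>F\<^esub> P (p \<diamond> P q) \<ominus>\<^bsub>F\<^esub> P (P (p \<diamond> q))",
      OF free_module[of W] _ _ _ _ _ p q])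
  note comp = linear_map_comp[of K F F _ F]
  {
    fix q assume q: "q \<in> carrier F"
    note L = nij_mult_left[OF q] and LP = nij_mult_left[OF op_closed[OF q]]
    show "linear_map K F F (\<lambda>p. P p \<diamond> P q)" by (rule comp[OF LP op_linear'])
    show "linear_map K F F (\<lambda>p. P (P p \<diamond> q) \<oplus>\<^bsub>F\<^esub> P (p \<diamond> P q) \<ominus>\<^bsub>F\<^esub> P (P (p \<diamond> q)))"
      by (rule linear_map_diff[OF free_module linear_map_plus[OF free_module
            comp[OF op_linear' comp[OF L op_linear']] comp[OF op_linear' LP]]
            comp[OF op_linear' comp[OF op_linear' L]]])
  }
  fix w assume w: "w \<in> W"
  note d = delta_in[OF w]
  note L = nij_mult_right[OF d] and LP = nij_mult_right[OF op_closed[OF d]]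
  show "linear_map K F F (\<lambda>q. P (delta K w) \<diamond> P q)" by (rule comp[OF LP op_linear'])
  show "linear_map K F F (\<lambda>q. P (P (delta K w) \<diamond> q) \<oplus>\<^bsub>F\<^esub> P (delta K w \<diamond> P q)
      \<ominus>\<^bsub>F\<^esub> P (P (delta K w \<diamond> q)))"
    by (rule linear_map_diff[OF free_module linear_map_plus[OF free_module
          comp[OF op_linear' LP] comp[OF op_linear' comp[OF L op_linear']]]
          comp[OF op_linear' comp[OF op_linear' L]]])
  fix v assume v: "v \<in> W"
  show "P (delta K w) \<diamond> P (delta K v) = P (P (delta K w) \<diamond> delta K v)
      \<oplus>\<^bsub>F\<^esub> P (delta K w \<diamond> P (delta K v)) \<ominus>\<^bsub>F\<^esub> P (P (delta K w \<diamond> delta K v))"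
    using w v by (simp add: op_word nij_mult_delta word_prod_letters)
qed

end

section \<open>Associativity of the product of words\<close>

context abelian_group
begin

text \<open>The first two groups \<open>e\<close>, \<open>f\<close>, \<open>g\<close> are Nijenhuis
  expansions. The third product carries a doubled operator and is expanded twice, which creates
  \<open>h\<close> with both signs; once it cancels, the terms \<open>e\<close> can be
  collected.\<close>

lemma nijenhuis_cancel_left:
  assumes "e1 \<in> carrier G" "f1 \<in> carrier G" "g1 \<in> carrier G" "e2 \<in> carrier G" "f2 \<in> carrier G"
    "g2 \<in> carrier G" "e3 \<in> carrier G" "h \<in> carrier G" "k \<in> carrier G" "l \<in> carrier G"
  shows "(e1 \<oplus> f1 \<ominus> g1) \<oplus> (e2 \<oplus> f2 \<ominus> g2) \<ominus> (e3 \<oplus> (h \<oplus> k \<ominus> l) \<ominus> h)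
    = (e1 \<oplus> e2 \<ominus> e3) \<oplus> f1 \<oplus> f2 \<ominus> g1 \<ominus> g2 \<ominus> k \<oplus> l"
proof -
  have "e3 \<oplus> (h \<oplus> k \<ominus> l) \<ominus> h = (e3 \<oplus> k \<ominus> l) \<oplus> (h \<oplus> \<ominus> h)"
    using assms by (simp add: a_minus_def a_ac del: r_neg)
  also have "\<dots> = e3 \<oplus> k \<ominus> l" using assms by (simp add: r_neg)
  finally show ?thesis using assms by (simp add: a_minus_def minus_add a_ac)
qed

text \<open>The same cancellation when the operators are stacked on the right factor, where the two
  mixed terms of each expansion exchange places.\<close>

lemma nijenhuis_cancel_right:
  assumes "e1 \<in> carrier G" "f1 \<in> carrier G" "g1 \<in> carrier G" "e2 \<in> carrier G" "f2 \<in> carrier G"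
    "g2 \<in> carrier G" "e3 \<in> carrier G" "h \<in> carrier G" "k \<in> carrier G" "l \<in> carrier G"
  shows "(f1 \<oplus> e1 \<ominus> g1) \<oplus> (f2 \<oplus> e2 \<ominus> g2) \<ominus> ((k \<oplus> h \<ominus> l) \<oplus> e3 \<ominus> h)
    = (e1 \<oplus> e2 \<ominus> e3) \<oplus> f1 \<oplus> f2 \<ominus> g1 \<ominus> g2 \<ominus> k \<oplus> l"
proof -
  have "(k \<oplus> h \<ominus> l) \<oplus> e3 \<ominus> h = e3 \<oplus> (h \<oplus> k \<ominus> l) \<ominus> h"
    "f1 \<oplus> e1 \<ominus> g1 = e1 \<oplus> f1 \<ominus> g1" "f2 \<oplus> e2 \<ominus> g2 = e2 \<oplus> f2 \<ominus> g2"
    using assms by (simp_all add: a_minus_def a_ac)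
  then show ?thesis using nijenhuis_cancel_left[OF assms] by simp
qed

end

text \<open>
  Expanding both sides with the Nijenhuis identity gives sums over the same seven bracketings, each
  with fewer applications of the operator.
\<close>

lemma nijenhuis_assoc_step:
  fixes V (structure)
  assumes V: "module K V" and m: "bilinear_op K V m" and P: "linear_map K V V P"
    and nij: "\<And>x y. \<lbrakk>x \<in> carrier V; y \<in> carrier V\<rbrakk> \<Longrightarrow>
      m (P x) (P y) = P (m (P x) y) \<oplus> P (m x (P y)) \<ominus> P (P (m x y))"
    and x: "x \<in> carrier V" and y: "y \<in> carrier V" and z: "z \<in> carrier V"
    and a1: "m (m (P x) (P y)) z = m (P x) (m (P y) z)"
    and a2: "m (m (P x) y) (P z) = m (P x) (m y (P z))"
    and a3: "m (m (P x) y) z = m (P x) (m y z)"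
    and a4: "m (m x (P y)) (P z) = m x (m (P y) (P z))"
    and a5: "m (m x (P y)) z = m x (m (P y) z)"
    and a6: "m (m x y) (P z) = m x (m y (P z))"
    and a7: "m (m x y) z = m x (m y z)"
  shows "m (m (P x) (P y)) (P z) = m (P x) (m (P y) (P z))"
proof -
  interpret V: module K V by fact
  have mc: "m a b \<in> carrier V" if "a \<in> carrier V" "b \<in> carrier V" for a b
    by (rule linear_map_closed[OF bilinear_opD(1)[OF m that(1)] that(2)])
  note Pc = linear_map_closed[OF P]
  note sum = V.M.a_closed V.M.minus_closed
  have Pd: "P (a \<oplus> b \<ominus> c) = P a \<oplus> P b \<ominus> P c"
    if "a \<in> carrier V" "b \<in> carrier V" "c \<in> carrier V" for a b c
    using that by (simp add: linear_map_minus[OF V V P] linear_map_add[OF P])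
  have ml: "m (a \<oplus> b \<ominus> c) d = m a d \<oplus> m b d \<ominus> m c d"
    if "a \<in> carrier V" "b \<in> carrier V" "c \<in> carrier V" "d \<in> carrier V" for a b c d
    using that linear_map_minus[OF V V bilinear_opD(2)[OF m that(4)]]
      linear_map_add[OF bilinear_opD(2)[OF m that(4)]] by simp
  have mr: "m d (a \<oplus> b \<ominus> c) = m d a \<oplus> m d b \<ominus> m d c"
    if "a \<in> carrier V" "b \<in> carrier V" "c \<in> carrier V" "d \<in> carrier V" for a b c d
    using that linear_map_minus[OF V V bilinear_opD(1)[OF m that(4)]]
      linear_map_add[OF bilinear_opD(1)[OF m that(4)]] by simp
  note xyz = x y z Pc[OF x] Pc[OF y] Pc[OF z]
  define A B C where "A = m (P x) y" and "B = m x (P y)" and "C = m x y"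
  have ABC: "A \<in> carrier V" "B \<in> carrier V" "C \<in> carrier V"
    using xyz mc by (simp_all add: A_def B_def C_def)
  have xy: "m (P x) (P y) = P A \<oplus> P B \<ominus> P (P C)"
    unfolding A_def B_def C_def by (rule nij[OF x y])
  \<comment> \<open>A doubled operator needs the identity twice: for \<open>P C\<close> and
    \<open>z\<close>, and inside the result for \<open>C\<close> and \<open>z\<close>. The term
    \<open>P (P (m (P C) z))\<close> appears with both signs.\<close>
  have C2: "m (P (P C)) (P z) = P (m (P (P C)) z)
      \<oplus> (P (P (m (P C) z)) \<oplus> P (P (m C (P z))) \<ominus> P (P (P (m C z)))) \<ominus> P (P (m (P C) z))"
    unfolding nij[OF Pc[OF ABC(3)] z] nij[OF ABC(3) z]
    using ABC xyz by (simp add: Pd Pc mc)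
  have "m (m (P x) (P y)) (P z) = m (P A) (P z) \<oplus> m (P B) (P z) \<ominus> m (P (P C)) (P z)"
    unfolding xy using ABC xyz by (simp add: ml Pc)
  also have "\<dots> = (P (m (P A) z) \<oplus> P (m (P B) z) \<ominus> P (m (P (P C)) z)) \<oplus> P (m A (P z))
      \<oplus> P (m B (P z)) \<ominus> P (P (m A z)) \<ominus> P (P (m B z)) \<ominus> P (P (m C (P z)))
      \<oplus> P (P (P (m C z)))"
    unfolding C2 nij[OF ABC(1) z] nij[OF ABC(2) z]
    by (rule V.M.nijenhuis_cancel_left) (intro Pc mc ABC xyz)+
  \<comment> \<open>Linearity run backwards reassembles three terms into one triple product with the
    operator on \<open>x\<close> and \<open>y\<close> only, to which \<open>a1\<close>
    applies.\<close>
  also have "P (m (P A) z) \<oplus> P (m (P B) z) \<ominus> P (m (P (P C)) z) = P (m (m (P x) (P y)) z)"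
    unfolding xy using ABC xyz by (simp add: ml Pd Pc mc)
  finally have L: "m (m (P x) (P y)) (P z) = P (m (m (P x) (P y)) z) \<oplus> P (m A (P z))
      \<oplus> P (m B (P z)) \<ominus> P (P (m A z)) \<ominus> P (P (m B z)) \<ominus> P (P (m C (P z)))
      \<oplus> P (P (P (m C z)))" .
  define A' B' C' where "A' = m (P y) z" and "B' = m y (P z)" and "C' = m y z"
  have ABC': "A' \<in> carrier V" "B' \<in> carrier V" "C' \<in> carrier V"
    using xyz mc by (simp_all add: A'_def B'_def C'_def)
  have yz: "m (P y) (P z) = P A' \<oplus> P B' \<ominus> P (P C')"
    unfolding A'_def B'_def C'_def by (rule nij[OF y z])
  have C2': "m (P x) (P (P C')) = (P (P (m (P x) C')) \<oplus> P (P (m x (P C'))) \<ominus> P (P (P (m x C'))))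
      \<oplus> P (m x (P (P C'))) \<ominus> P (P (m x (P C')))"
    unfolding nij[OF x Pc[OF ABC'(3)]] nij[OF x ABC'(3)]
    using ABC' xyz by (simp add: Pd Pc mc)
  have "m (P x) (m (P y) (P z)) = m (P x) (P A') \<oplus> m (P x) (P B') \<ominus> m (P x) (P (P C'))"
    unfolding yz using ABC' xyz by (simp add: mr Pc)
  also have "\<dots> = (P (m x (P A')) \<oplus> P (m x (P B')) \<ominus> P (m x (P (P C')))) \<oplus> P (m (P x) A')
      \<oplus> P (m (P x) B') \<ominus> P (P (m x A')) \<ominus> P (P (m x B')) \<ominus> P (P (m (P x) C'))
      \<oplus> P (P (P (m x C')))"
    unfolding C2' nij[OF x ABC'(1)] nij[OF x ABC'(2)]
    by (rule V.M.nijenhuis_cancel_right) (intro Pc mc ABC' xyz)+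
  also have "P (m x (P A')) \<oplus> P (m x (P B')) \<ominus> P (m x (P (P C'))) = P (m x (m (P y) (P z)))"
    unfolding yz using ABC' xyz by (simp add: mr Pd Pc mc)
  finally have R: "m (P x) (m (P y) (P z)) = P (m x (m (P y) (P z))) \<oplus> P (m (P x) A')
      \<oplus> P (m (P x) B') \<ominus> P (P (m x A')) \<ominus> P (P (m x B')) \<ominus> P (P (m (P x) C'))
      \<oplus> P (P (P (m x C')))" .
  have eqs: "m (m (P x) (P y)) z = m (P x) A'" "m A (P z) = m (P x) B'" "m B (P z) = m x (m (P y) (P z))"
    "m A z = m (P x) C'" "m B z = m x A'" "m C (P z) = m x B'" "m C z = m x C'"
    unfolding A_def B_def C_def A'_def B'_def C'_def by (fact a1 a2 a3 a4 a5 a6 a7)+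
  \<comment> \<open>After the seven hypotheses both expansions contain the same terms, in a
    different order.\<close>
  have perm: "a \<oplus> b \<oplus> c \<ominus> d \<ominus> e \<ominus> f \<oplus> g = c \<oplus> a \<oplus> b \<ominus> e \<ominus> f \<ominus> d \<oplus> g"
    if "a \<in> carrier V" "b \<in> carrier V" "c \<in> carrier V" "d \<in> carrier V" "e \<in> carrier V" "f \<in> carrier V"
      "g \<in> carrier V" for a b c d e f g
    using that by (simp add: a_minus_def V.M.a_ac)
  show ?thesis
    unfolding L R eqs by (rule perm) (intro Pc mc ABC' xyz)+
qed

context algebra_with_basis
begin

lemma lin_ext_mult_left:
  assumes "\<And>s. s \<in> S \<Longrightarrow> g s \<in> carrier F" "q \<in> carrier (free_mod K S)" "r \<in> carrier F"
  shows "lin_ext K F g q \<diamond> r = lin_ext K F (\<lambda>s. g s \<diamond> r) q"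
  using linear_map_lin_ext_eq[OF free_module free_module nij_mult_left[OF assms(3)] assms(1,2)] .

lemma lin_ext_mult_right:
  assumes "\<And>s. s \<in> S \<Longrightarrow> g s \<in> carrier F" "q \<in> carrier (free_mod K S)" "r \<in> carrier F"
  shows "r \<diamond> lin_ext K F g q = lin_ext K F (\<lambda>s. r \<diamond> g s) q"
  using linear_map_lin_ext_eq[OF free_module free_module nij_mult_right[OF assms(3)] assms(1,2)] .

lemma splice_in: "\<lbrakk>u @ [a] \<in> W; b # v \<in> W; s \<in> joint_words X a b\<rbrakk> \<Longrightarrow> delta K (u @ s @ v) \<in> carrier F"
  by (intro delta_in joint_words_splice)

lemma words_split_letters:
  assumes "u @ [a] \<in> W" "b # v \<in> W"
  shows "a \<in> letters X" "b \<in> letters X"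
  using assms by (simp_all add: words_iff)

text \<open>The middle word has at least two letters, so the junctions \<open>a\<close>,
  \<open>b1\<close> and \<open>b2\<close>, \<open>c\<close> do not overlap. Both sides are the same
  double sum over the results at the two junctions, taken in opposite orders.\<close>

lemma assoc_long:
  assumes u: "u @ [a] \<in> W" and v: "b1 # m @ [b2] \<in> W" and w: "c # w \<in> W"
  shows "wp (u @ [a]) (b1 # m @ [b2]) \<diamond> delta K (c # w) = delta K (u @ [a]) \<diamond> wp (b1 # m @ [b2]) (c # w)"
proof -
  have v': "(b1 # m) @ [b2] \<in> W" using v by simp
  note q = letter_prod_closed[OF words_split_letters[OF u v]]
  note r = letter_prod_closed[OF words_split_letters[OF v' w]]
  have s: "(u @ s @ m) @ [b2] \<in> W" if "s \<in> joint_words X a b1" for s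
    using joint_words_splice[OF u v that] by simp
  have t: "b1 # m @ t @ w \<in> W" if "t \<in> joint_words X b2 c" for t
    using joint_words_splice[OF v' w that] by simp
  have st: "delta K (u @ s @ m @ t @ w) \<in> carrier F" if "s \<in> joint_words X a b1" "t \<in> joint_words X b2 c" for s t
    using splice_in[OF s[OF that(1)] w that(2)] by simp
  have "wp (u @ [a]) (b1 # m @ [b2]) \<diamond> delta K (c # w)
      = lin_ext K F (\<lambda>s. delta K (u @ s @ m @ [b2]) \<diamond> delta K (c # w)) (lp a b1)"
    unfolding word_prod_snoc_Cons by (rule lin_ext_mult_left[OF splice_in[OF u v] q delta_in[OF w]])
  also have "\<dots> = lin_ext K F (\<lambda>s. lin_ext K F (\<lambda>t. delta K (u @ s @ m @ t @ w)) (lp b2 c)) (lp a b1)"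
  proof (rule lin_ext_cong[OF free_module q])
    fix s assume sj: "s \<in> joint_words X a b1"
    show "delta K (u @ s @ m @ [b2]) \<diamond> delta K (c # w) \<in> carrier F"
      using nij_mult_closed[OF delta_in[OF s[OF sj]] delta_in[OF w]] by simp
    show "delta K (u @ s @ m @ [b2]) \<diamond> delta K (c # w) = lin_ext K F (\<lambda>t. delta K (u @ s @ m @ t @ w)) (lp b2 c)"
      using nij_mult_delta[OF s[OF sj] w] word_prod_snoc_Cons[of "u @ s @ m" b2 c w] by simp
  qed
  also have "\<dots> = lin_ext K F (\<lambda>t. lin_ext K F (\<lambda>s. delta K (u @ s @ m @ t @ w)) (lp a b1)) (lp b2 c)"
    by (rule lin_ext_swap[OF free_module q r st])
  also have "\<dots> = lin_ext K F (\<lambda>t. delta K (u @ [a]) \<diamond> delta K (b1 # m @ t @ w)) (lp b2 c)"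
  proof (rule lin_ext_cong[OF free_module r, symmetric])
    fix t assume tj: "t \<in> joint_words X b2 c"
    show "delta K (u @ [a]) \<diamond> delta K (b1 # m @ t @ w) \<in> carrier F"
      using nij_mult_closed[OF delta_in[OF u] delta_in[OF t[OF tj]]] .
    show "delta K (u @ [a]) \<diamond> delta K (b1 # m @ t @ w) = lin_ext K F (\<lambda>s. delta K (u @ s @ m @ t @ w)) (lp a b1)"
      using nij_mult_delta[OF u t[OF tj]] word_prod_snoc_Cons[of u a b1 "m @ t @ w"] by simp
  qed
  also have "\<dots> = delta K (u @ [a]) \<diamond> lin_ext K F (\<lambda>t. delta K (b1 # m @ t @ w)) (lp b2 c)"
    by (rule lin_ext_mult_right[OF _ r delta_in[OF u], symmetric]) (rule delta_in[OF t])
  also have "lin_ext K F (\<lambda>t. delta K (b1 # m @ t @ w)) (lp b2 c) = wp (b1 # m @ [b2]) (c # w)"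
    using word_prod_snoc_Cons[of "b1 # m" b2 c w] by simp
  finally show ?thesis .
qed

text \<open>The left junction is plain concatenation, and it stays so after \<open>b\<close> and
  \<open>c\<close> are multiplied, because every resulting word still starts with the kind of
  \<open>b\<close>. Hence \<open>u\<close> is an inert prefix on both sides.\<close>

lemma assoc_concat_left:
  assumes u: "u \<in> W" and b: "b \<in> letters X" and w: "c # w \<in> W" and ub: "is_gen (last u) \<noteq> is_gen b"
  shows "wp u [b] \<diamond> delta K (c # w) = delta K u \<diamond> wp [b] (c # w)"
proof -
  have b': "[] @ [b] \<in> W" using b by simp
  have ubW: "u @ [b] \<in> W" using words_append[OF u, of "[b]"] b ub by simp
  note r = letter_prod_closed[OF words_split_letters[OF b' w]]
  have t: "t @ w \<in> W" if "t \<in> joint_words X b c" for t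
    using joint_words_splice[OF b' w that] by simp
  have "wp u [b] \<diamond> delta K (c # w) = lin_ext K F (\<lambda>t. delta K (u @ t @ w)) (lp b c)"
    using word_prod_concat[OF u, of "[b]"] b ub nij_mult_delta[OF ubW w] word_prod_snoc_Cons by simp
  also have "\<dots> = lin_ext K F (\<lambda>t. delta K u \<diamond> delta K (t @ w)) (lp b c)"
  proof (rule lin_ext_cong[OF free_module r])
    fix t assume tj: "t \<in> joint_words X b c"
    show "delta K (u @ t @ w) \<in> carrier F" by (rule splice_in[OF ubW w tj])
    have "is_gen (last u) \<noteq> is_gen (hd (t @ w))" using joint_words_ends[OF tj] ub by simp
    from word_prod_concat[OF u t[OF tj] this]
    show "delta K (u @ t @ w) = delta K u \<diamond> delta K (t @ w)"
      by (simp add: nij_mult_delta u t tj)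
  qed
  also have "\<dots> = delta K u \<diamond> lin_ext K F (\<lambda>t. delta K (t @ w)) (lp b c)"
    by (rule lin_ext_mult_right[OF _ r delta_in[OF u], symmetric]) (rule delta_in[OF t])
  also have "lin_ext K F (\<lambda>t. delta K (t @ w)) (lp b c) = wp [b] (c # w)"
    using word_prod_snoc_Cons[of "[]" b c w] by simp
  finally show ?thesis .
qed

text \<open>Mirror image of the previous case: products of \<open>a\<close> and \<open>b\<close>
  still end with the kind of \<open>b\<close>, so \<open>w\<close> is an inert suffix.\<close>

lemma assoc_concat_right:
  assumes u: "u @ [a] \<in> W" and b: "b \<in> letters X" and w: "w \<in> W" and bw: "is_gen b \<noteq> is_gen (hd w)"
  shows "wp (u @ [a]) [b] \<diamond> delta K w = delta K (u @ [a]) \<diamond> wp [b] w"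
proof -
  have b': "[b] \<in> W" using b by simp
  have bwW: "b # w \<in> W" using words_append[OF b' w] bw by simp
  note q = letter_prod_closed[OF words_split_letters[OF u b']]
  have s: "u @ s \<in> W" if "s \<in> joint_words X a b" for s
    using joint_words_splice[OF u b' that] by simp
  have "delta K (u @ [a]) \<diamond> wp [b] w = lin_ext K F (\<lambda>s. delta K (u @ s @ w)) (lp a b)"
    using word_prod_concat[OF b' w] bw nij_mult_delta[OF u bwW] word_prod_snoc_Cons by simp
  also have "\<dots> = lin_ext K F (\<lambda>s. delta K (u @ s) \<diamond> delta K w) (lp a b)"
  proof (rule lin_ext_cong[OF free_module q])
    fix s assume sj: "s \<in> joint_words X a b"
    show "delta K (u @ s @ w) \<in> carrier F" by (rule splice_in[OF u bwW sj])
    have "is_gen (last (u @ s)) \<noteq> is_gen (hd w)" using joint_words_ends[OF sj] bw by simp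
    from word_prod_concat[OF s[OF sj] w this]
    show "delta K (u @ s @ w) = delta K (u @ s) \<diamond> delta K w"
      by (simp add: nij_mult_delta w s sj)
  qed
  also have "\<dots> = lin_ext K F (\<lambda>s. delta K (u @ s)) (lp a b) \<diamond> delta K w"
    by (rule lin_ext_mult_left[OF _ q delta_in[OF w], symmetric]) (rule delta_in[OF s])
  also have "lin_ext K F (\<lambda>s. delta K (u @ s)) (lp a b) = wp (u @ [a]) [b]"
    using word_prod_snoc_Cons[of u a b "[]"] by simp
  finally show ?thesis by (rule sym)
qed

text \<open>When all three letters have one kind, every intermediate product is a combination of
  single letters of that kind. The outer words then form a fixed linear context, and only the
  identity for the three letters is left.\<close>

lemma assoc_same:
  assumes u: "u @ [a] \<in> W" and b: "b \<in> letters X" and w: "c # w \<in> W"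
    and ab: "is_gen a = is_gen b" and bc: "is_gen b = is_gen c"
    and letters: "lp a b \<diamond> delta K [c] = delta K [a] \<diamond> lp b c"
  shows "wp (u @ [a]) [b] \<diamond> delta K (c # w) = delta K (u @ [a]) \<diamond> wp [b] (c # w)"
proof -
  define S where "S = {[d] |d. d \<in> letters X \<and> is_gen d = is_gen a}"
  have Sj: "joint_words X d e = S" if "is_gen d = is_gen a" "is_gen e = is_gen a" for d e
    using that by (simp add: S_def joint_words_def)
  have types: "is_gen b = is_gen a" "is_gen c = is_gen a" using ab bc by simp_all
  note Sjs = Sj[OF refl types(1)] Sj[OF types] Sj[OF refl types(2)]
  have b': "[b] \<in> W" "[] @ [b] \<in> W" using b by simp_all
  note ac = words_split_letters[OF u w]
  have q: "lp a b \<in> carrier (free_mod K S)"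
    using letter_prod_closed[OF ac(1) b] unfolding Sjs .
  have r: "lp b c \<in> carrier (free_mod K S)"
    using letter_prod_closed[OF b ac(2)] unfolding Sjs .
  have SW: "S \<subseteq> W" by (auto simp: S_def)
  \<comment> \<open>Insertion between the fixed ends \<open>u\<close> and \<open>w\<close>, extended
    linearly.\<close>
  let ?C = "lin_ext K F (\<lambda>t. delta K (u @ t @ w))"
  have C: "linear_map K (free_mod K S) F ?C"
  proof (rule linear_map_lin_ext[OF free_module])
    fix t assume "t \<in> S"
    then show "delta K (u @ t @ w) \<in> carrier F"
      by (intro splice_in[OF u w]) (simp only: Sjs)
  qed
  have s: "u @ s \<in> W" "s @ w \<in> W" if "s \<in> S" for s
    using joint_words_splice[OF u b'(1), of s] joint_words_splice[OF b'(2) w, of s] that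
    unfolding Sjs by simp_all
  have lpS: "wp s [c] \<in> carrier (free_mod K S)" "wp [a] s \<in> carrier (free_mod K S)"
      "wp (u @ s) (c # w) = ?C (wp s [c])" "wp (u @ [a]) (s @ w) = ?C (wp [a] s)" if s': "s \<in> S" for s
  proof -
    obtain d where d: "s = [d]" "d \<in> letters X" "is_gen d = is_gen a"
      using s' unfolding S_def by blast
    show "wp s [c] \<in> carrier (free_mod K S)" "wp [a] s \<in> carrier (free_mod K S)"
      using letter_prod_closed[OF d(2) ac(2)] letter_prod_closed[OF ac(1) d(2)] d(1,2) ac
      unfolding Sj[OF d(3) types(2)] Sj[OF refl d(3)] by (simp_all add: word_prod_letters)
    show "wp (u @ s) (c # w) = ?C (wp s [c])" "wp (u @ [a]) (s @ w) = ?C (wp [a] s)"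
      using d(1,2) ac by (simp_all add: word_prod_letters word_prod_snoc_Cons)
  qed
  \<comment> \<open>Extension into \<open>F\<close> and into the span of \<open>S\<close> give the
    same function, so the context can be pulled out of a sum over letters.\<close>
  have comb: "lin_ext K F (\<lambda>s. ?C (g s)) p = ?C (lin_ext K F g p)"
    if p: "p \<in> carrier (free_mod K S)" and g: "\<And>s. s \<in> S \<Longrightarrow> g s \<in> carrier (free_mod K S)" for g p
    using linear_map_lin_ext_eq[OF free_module free_module C g p]
      lin_ext_free_mod_cong_set[OF K_cring SW p g] by simp
  have qF: "lp a b \<in> carrier F" "lp b c \<in> carrier F"
    using q r free_mod_mono[OF SW] by blast+
  have Sd: "delta K s \<in> carrier F" if "s \<in> S" for s using that SW by (intro delta_in) blast
  have "wp (u @ [a]) [b] \<diamond> delta K (c # w) = lin_ext K F (\<lambda>s. delta K (u @ s)) (lp a b) \<diamond> delta K (c # w)"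
    by (simp add: word_prod_snoc_Cons)
  also have "\<dots> = lin_ext K F (\<lambda>s. delta K (u @ s) \<diamond> delta K (c # w)) (lp a b)"
    by (rule lin_ext_mult_left[OF _ q delta_in[OF w]]) (rule delta_in[OF s(1)])
  also have "\<dots> = lin_ext K F (\<lambda>s. ?C (wp s [c])) (lp a b)"
  proof (rule lin_ext_cong[OF free_module q])
    fix s' assume "s' \<in> S"
    then show "delta K (u @ s') \<diamond> delta K (c # w) \<in> carrier F"
      "delta K (u @ s') \<diamond> delta K (c # w) = ?C (wp s' [c])"
      by (simp_all add: nij_mult_closed delta_in s w nij_mult_delta lpS linear_map_closed[OF C])
  qed
  also have "\<dots> = ?C (lin_ext K F (\<lambda>s. wp s [c]) (lp a b))"
    by (rule comb[OF q lpS(1)])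
  also have "lin_ext K F (\<lambda>s. wp s [c]) (lp a b) = lin_ext K F (\<lambda>s. delta K s \<diamond> delta K [c]) (lp a b)"
    using SW ac(2) by (intro lin_ext_cong[OF free_module q] word_prod_closed)
      (auto simp: nij_mult_delta subset_iff)
  also have "\<dots> = lp a b \<diamond> delta K [c]"
    using linear_map_free_mod[OF free_module nij_mult_left[OF delta_in] qF(1), of "[c]"] ac(2) by simp
  also have "\<dots> = delta K [a] \<diamond> lp b c" by (rule letters)
  also have "\<dots> = lin_ext K F (\<lambda>s. delta K [a] \<diamond> delta K s) (lp b c)"
    using linear_map_free_mod[OF free_module nij_mult_right[OF delta_in] qF(2), of "[a]"] ac(1) by simp
  also have "\<dots> = lin_ext K F (\<lambda>s. wp [a] s) (lp b c)"
    using SW ac(1) by (intro lin_ext_cong[OF free_module r] nij_mult_closed delta_in)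
      (auto simp: nij_mult_delta subset_iff)
  also have "?C (lin_ext K F (\<lambda>s. wp [a] s) (lp b c)) = lin_ext K F (\<lambda>s. ?C (wp [a] s)) (lp b c)"
    by (rule comb[OF r lpS(2), symmetric])
  also have "\<dots> = lin_ext K F (\<lambda>s. delta K (u @ [a]) \<diamond> delta K (s @ w)) (lp b c)"
  proof (rule lin_ext_cong[OF free_module r, symmetric])
    fix s' assume "s' \<in> S"
    then show "delta K (u @ [a]) \<diamond> delta K (s' @ w) \<in> carrier F"
      "delta K (u @ [a]) \<diamond> delta K (s' @ w) = ?C (wp [a] s')"
      by (simp_all add: nij_mult_closed delta_in s u nij_mult_delta lpS linear_map_closed[OF C])
  qed
  also have "\<dots> = delta K (u @ [a]) \<diamond> lin_ext K F (\<lambda>s. delta K (s @ w)) (lp b c)"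
    by (rule lin_ext_mult_right[OF _ r delta_in[OF u], symmetric]) (rule delta_in[OF s(2)])
  also have "lin_ext K F (\<lambda>s. delta K (s @ w)) (lp b c) = wp [b] (c # w)"
    using word_prod_snoc_Cons[of "[]" b c w] by simp
  finally show ?thesis .
qed

end

section \<open>Associativity completed and the universal property of the free Nijenhuis
  algebra\<close>

lemma nijenhuis_homD:
  assumes "nijenhuis_hom K A P B Q g"
  shows "linear_map K A B g"
    and "\<And>x y. \<lbrakk>x \<in> carrier A; y \<in> carrier A\<rbrakk> \<Longrightarrow> g (x \<otimes>\<^bsub>A\<^esub> y) = g x \<otimes>\<^bsub>B\<^esub> g y"
    and "\<And>x. x \<in> carrier A \<Longrightarrow> g (P x) = Q (g x)"
  using assms by (simp_all add: nijenhuis_hom_def)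

text \<open>The value forced on a homomorphism: a bracket must become \<open>Q\<close>, and adjacent
  letters of a word, being of different kinds, must be multiplied.\<close>

primrec eval_letter ::
  "('k, 'b, 'w) module_scheme \<Rightarrow> ('b \<Rightarrow> 'b) \<Rightarrow> ('x \<Rightarrow> 'b) \<Rightarrow> 'x letter \<Rightarrow> 'b"
  where
    "eval_letter B Q f (Gen x) = f x"
  | "eval_letter B Q f (Br w) = Q (list_mult B (map (eval_letter B Q f) w))"

abbreviation eval_word ::
  "('k, 'b, 'w) module_scheme \<Rightarrow> ('b \<Rightarrow> 'b) \<Rightarrow> ('x \<Rightarrow> 'b) \<Rightarrow> 'x word \<Rightarrow> 'b"
  where "eval_word B Q f w \<equiv> list_mult B (map (eval_letter B Q f) w)"

context algebra_with_basis
begin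

lemma emb_closed: "a \<in> carrier A \<Longrightarrow> j a \<in> carrier F"
  by (rule linear_map_closed[OF emb_linear])

text \<open>On basis elements this is the clause of \<open>letter_prod\<close> for two generators;
  both sides are bilinear.\<close>

lemma emb_mult:
  assumes a: "a \<in> carrier A" and b: "b \<in> carrier A"
  shows "j a \<diamond> j b = j (a \<otimes>\<^bsub>A\<^esub> b)"
proof (rule basis_eqI[where f = "\<lambda>a. j a \<diamond> j b" and g = "\<lambda>a. j (a \<otimes>\<^bsub>A\<^esub> b)", OF free_module _ _ _ a])
  show "linear_map K A F (\<lambda>a. j a \<diamond> j b)"
    by (rule linear_map_comp[OF nij_mult_left[OF emb_closed[OF b]] emb_linear])
  show "linear_map K A F (\<lambda>a. j (a \<otimes>\<^bsub>A\<^esub> b))"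
    by (rule linear_map_comp[OF emb_linear linear_mult_left[OF b]])
  fix x assume x: "x \<in> X"
  note xA = basis_closed[OF x]
  show "j x \<diamond> j b = j (x \<otimes>\<^bsub>A\<^esub> b)"
  proof (rule basis_eqI[where f = "\<lambda>b. j x \<diamond> j b" and g = "\<lambda>b. j (x \<otimes>\<^bsub>A\<^esub> b)", OF free_module _ _ _ b])
    show "linear_map K A F (\<lambda>b. j x \<diamond> j b)"
      by (rule linear_map_comp[OF nij_mult_right[OF emb_closed[OF xA]] emb_linear])
    show "linear_map K A F (\<lambda>b. j (x \<otimes>\<^bsub>A\<^esub> b))"
      by (rule linear_map_comp[OF emb_linear linear_mult_right[OF xA]])
    fix y assume y: "y \<in> X"
    show "j x \<diamond> j y = j (x \<otimes>\<^bsub>A\<^esub> y)"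
      using x y by (simp add: emb_basis nij_mult_delta word_prod_letters)
  qed
qed

lemma nij_bilinear: "bilinear_op K F (\<diamond>)"
  unfolding bilinear_op_def using nij_mult_right nij_mult_left by simp

text \<open>Read through \<open>j\<close>, this is associativity of \<open>A\<close>, since the
  outer letters are embedded basis elements.\<close>

lemma assoc_letters_Gen:
  assumes "x \<in> X" "y \<in> X" "z \<in> X"
  shows "lp (Gen x) (Gen y) \<diamond> delta K [Gen z] = delta K [Gen x] \<diamond> lp (Gen y) (Gen z)"
  using assms basis_closed by (simp add: emb_basis[symmetric] emb_mult mult_closed mult_assoc)

text \<open>The hypothesis covers every choice of brackets in which at least one of the three words
  stays unbracketed; these are the seven instances consumed by
  \<open>nijenhuis_assoc_step\<close>.\<close>

lemma assoc_letters_Br: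
  assumes uvw: "u \<in> W" "v \<in> W" "w \<in> W"
    and IH: "\<And>u' v' w'. \<lbrakk>u' \<in> {u, [Br u]}; v' \<in> {v, [Br v]}; w' \<in> {w, [Br w]};
      u' = u \<or> v' = v \<or> w' = w\<rbrakk> \<Longrightarrow> wp u' v' \<diamond> delta K w' = delta K u' \<diamond> wp v' w'"
  shows "lp (Br u) (Br v) \<diamond> delta K [Br w] = delta K [Br u] \<diamond> lp (Br v) (Br w)"
proof -
  have B: "[Br u] \<in> W" "[Br v] \<in> W" "[Br w] \<in> W" using uvw by simp_all
  note d = delta_in[OF uvw(1)] delta_in[OF uvw(2)] delta_in[OF uvw(3)]
  note P = op_word[OF uvw(1)] op_word[OF uvw(2)] op_word[OF uvw(3)]
  have "(P (delta K u) \<diamond> P (delta K v)) \<diamond> P (delta K w) = P (delta K u) \<diamond> (P (delta K v) \<diamond> P (delta K w))"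
    by (rule nijenhuis_assoc_step[OF free_module nij_bilinear op_linear' nij_nijenhuis d])
      (simp_all only: P nij_mult_delta uvw B, (rule IH; simp)+)
  then show ?thesis
    by (simp only: P nij_mult_delta B word_prod_letters singleton_in_words[symmetric])
qed

text \<open>A middle word of two or more letters keeps the junctions apart. A single middle letter
  interacts with both neighbours only if all three letters have the same kind, and of these cases
  only that of three brackets is recursive.\<close>

lemma assoc_words:
  "\<lbrakk>u \<in> W; v \<in> W; w \<in> W\<rbrakk> \<Longrightarrow> wp u v \<diamond> delta K w = delta K u \<diamond> wp v w"
proof (induction "size_list size u + size_list size v + size_list size w" arbitrary: u v w rule: less_induct)
  case less
  note uvw = less.prems
  obtain u' a where u: "u = u' @ [a]" using uvw(1) by (cases u rule: rev_cases) (auto simp: words_iff)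
  obtain c w' where w: "w = c # w'" using uvw(3) by (cases w) (auto simp: words_iff)
  obtain b1 v' where v: "v = b1 # v'" using uvw(2) by (cases v) (auto simp: words_iff)
  have u': "u' @ [a] \<in> W" and w': "c # w' \<in> W" using uvw u w by simp_all
  note ac = words_split_letters[OF u' w']
  show ?case
  proof (cases v' rule: rev_cases)
    case (snoc m b2)
    then show ?thesis using assoc_long[of u' a b1 m b2 c w'] uvw u v w by simp
  next
    case Nil
    define b where "b = b1"
    have vb: "v = [b]" and b: "b \<in> letters X" using v Nil uvw(2) by (simp_all add: b_def)
    consider "is_gen a \<noteq> is_gen b" | "is_gen b \<noteq> is_gen c" | "is_gen a = is_gen b" "is_gen b = is_gen c"
      by blast
    then show ?thesis
    proof cases
      case 1
      then show ?thesis using assoc_concat_left[OF uvw(1) b w'] u vb w by simp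
    next
      case 2
      then show ?thesis using assoc_concat_right[OF u' b uvw(3)] u vb w by simp
    next
      case 3
      have "lp a b \<diamond> delta K [c] = delta K [a] \<diamond> lp b c"
      proof (cases b)
        case (Gen y)
        then obtain x z where "a = Gen x" "c = Gen z" using 3 by (cases a; cases c) simp_all
        then show ?thesis using assoc_letters_Gen[of x y z] ac b Gen by simp
      next
        case (Br y)
        then obtain x z where xz: "a = Br x" "c = Br z" using 3 by (cases a; cases c) simp_all
        show ?thesis
          unfolding Br xz
        proof (rule assoc_letters_Br)
          show "x \<in> W" "y \<in> W" "z \<in> W" using ac b Br xz by simp_all
          then have in_W: "[Br x] \<in> W" "[Br y] \<in> W" "[Br z] \<in> W" by simp_all
          fix p q r assume pqr: "p \<in> {x, [Br x]}" "q \<in> {y, [Br y]}" "r \<in> {z, [Br z]}"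
            "p = x \<or> q = y \<or> r = z"
          \<comment> \<open>At least one of the three brackets is removed, and removing a bracket
            strictly lowers the size.\<close>
          have "size_list size p + size_list size q + size_list size r
              < size_list size [Br x] + size_list size [Br y] + size_list size [Br z]"
            using pqr by auto
          also have "\<dots> \<le> size_list size u + size_list size v + size_list size w"
            using u vb w xz Br by simp
          finally show "wp p q \<diamond> delta K r = delta K p \<diamond> wp q r"
            using less.hyps[of p q r] pqr \<open>x \<in> W\<close> \<open>y \<in> W\<close> \<open>z \<in> W\<close> in_W by blast
        qed
      qed
      then show ?thesis using assoc_same[OF u' b w' 3] u vb w by simp
    qed
  qed
qed

lemma nij_assoc:
  assumes pqr: "p \<in> carrier F" "q \<in> carrier F" "r \<in> carrier F"
  shows "p \<diamond> q \<diamond> r = p \<diamond> (q \<diamond> r)"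
proof (rule trilinear_eqI[where f = "\<lambda>p q r. p \<diamond> q \<diamond> r" and g = "\<lambda>p q r. p \<diamond> (q \<diamond> r)",
      OF free_module[of W] _ _ _ _ _ _ _ pqr])
  fix q r assume qr: "q \<in> carrier F" "r \<in> carrier F"
  show "linear_map K F F (\<lambda>p. p \<diamond> q \<diamond> r)"
    by (rule linear_map_comp[OF nij_mult_left[OF qr(2)] nij_mult_left[OF qr(1)]])
  show "linear_map K F F (\<lambda>p. p \<diamond> (q \<diamond> r))"
    by (rule nij_mult_left[OF nij_mult_closed[OF qr]])
next
  fix u r assume u: "u \<in> W" and r: "r \<in> carrier F"
  note d = delta_in[OF u]
  show "linear_map K F F (\<lambda>q. delta K u \<diamond> q \<diamond> r)"
    by (rule linear_map_comp[OF nij_mult_left[OF r] nij_mult_right[OF d]])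
  show "linear_map K F F (\<lambda>q. delta K u \<diamond> (q \<diamond> r))"
    by (rule linear_map_comp[OF nij_mult_right[OF d] nij_mult_left[OF r]])
next
  fix u v assume uv: "u \<in> W" "v \<in> W"
  note d = delta_in[OF uv(1)] delta_in[OF uv(2)]
  show "linear_map K F F (\<lambda>r. delta K u \<diamond> delta K v \<diamond> r)"
    by (rule nij_mult_right[OF nij_mult_closed[OF d]])
  show "linear_map K F F (\<lambda>r. delta K u \<diamond> (delta K v \<diamond> r))"
    by (rule linear_map_comp[OF nij_mult_right[OF d(1)] nij_mult_right[OF d(2)]])
next
  fix u v w assume "u \<in> W" "v \<in> W" "w \<in> W"
  then show "delta K u \<diamond> delta K v \<diamond> delta K w = delta K u \<diamond> (delta K v \<diamond> delta K w)"
    by (simp add: nij_mult_delta assoc_words)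
qed

lemma free_nijenhuis_algebra: "nijenhuis_algebra K N P"
proof (intro nijenhuis_algebra.intro nijenhuis_algebra_axioms.intro nonunital_algebra.intro
    nonunital_algebra_axioms.intro nij_module)
  show "bilinear_op K N (\<diamond>)"
    using nij_bilinear by (simp add: bilinear_op_def linear_nij nij_simps(1))
  show "linear_map K N N P" using op_linear' by (simp add: linear_nij)
  fix p q assume "p \<in> carrier N" "q \<in> carrier N"
  then have pq: "p \<in> carrier F" "q \<in> carrier F" by (simp_all add: nij_simps(1))
  show "P p \<diamond> P q = P (P p \<diamond> q) \<oplus>\<^bsub>N\<^esub> P (p \<diamond> P q) \<ominus>\<^bsub>N\<^esub> P (P (p \<diamond> q))"
    unfolding nij_nijenhuis[OF pq] nij_simps(3)
    by (rule nij_minus[OF op_closed[OF op_closed[OF nij_mult_closed[OF pq]]], symmetric])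
  fix r assume "r \<in> carrier N"
  then show "p \<diamond> q \<diamond> r = p \<diamond> (q \<diamond> r)"
    using pq by (intro nij_assoc) (simp_all add: nij_simps(1))
qed

text \<open>The embedded algebra generates everything: a longer word is the product of its first
  letter and the rest, because the kinds at that junction differ, and a bracket is the operator
  applied to a smaller word.\<close>

lemma free_nijenhuis_hom_eq:
  assumes B: "module K B" and g: "nijenhuis_hom K N P B Q g" and h: "nijenhuis_hom K N P B Q h"
    and eq: "\<And>a. a \<in> carrier A \<Longrightarrow> g (j a) = h (j a)" and p: "p \<in> carrier N"
  shows "g p = h p"
proof -
  note gD = nijenhuis_homD[OF g, unfolded nij_simps(1)] and hD = nijenhuis_homD[OF h, unfolded nij_simps(1)]
  have word: "g (delta K w) = h (delta K w)" if "w \<in> W" for w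
    using that
  proof (induction "size_list size w" arbitrary: w rule: less_induct)
    case less
    obtain a v where w: "w = a # v" using less.prems by (cases w) (auto simp: words_iff)
    have a: "a \<in> letters X" using less.prems w by (simp add: words_iff)
    have ga: "g (delta K [a]) = h (delta K [a])"
    proof (cases a)
      case (Gen x)
      then show ?thesis using eq[OF basis_closed, of x] a by (simp add: emb_basis)
    next
      case (Br u)
      then have u: "u \<in> W" using a by simp
      have "g (delta K u) = h (delta K u)" using u Br w by (intro less.hyps) simp_all
      then show ?thesis
        unfolding Br op_word[OF u, symmetric] gD(3)[OF delta_in[OF u]] hD(3)[OF delta_in[OF u]] by simp
    qed
    show ?case
    proof (cases "v = []")
      case True
      then show ?thesis using ga w by simp
    next
      case False
      then have v: "v \<in> W" and ne: "is_gen a \<noteq> is_gen (hd v)"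
        using less.prems w by (cases v; simp add: words_iff successively_Cons)+
      have aW: "[a] \<in> W" using a by simp
      have "delta K w = delta K [a] \<diamond> delta K v"
        unfolding nij_mult_delta[OF aW v] using word_prod_concat[OF aW v] ne w by simp
      moreover have "g (delta K v) = h (delta K v)" using v w by (intro less.hyps) simp_all
      ultimately show ?thesis using ga delta_in[OF aW] delta_in[OF v] gD(2) hD(2) by simp
    qed
  qed
  show ?thesis
    by (rule free_mod_eqI[OF B gD(1)[unfolded linear_nij] hD(1)[unfolded linear_nij] p[unfolded nij_simps(1)] word])
qed

text \<open>Evaluation of words respects \<open>j\<close> and the operators by construction.
  Multiplicativity follows the recursion of the product, where the bracket clause of
  \<open>letter_prod\<close> is matched by the Nijenhuis identity of \<open>B\<close>.\<close>

lemma free_nijenhuis_lift: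
  assumes B: "nijenhuis_algebra K B Q" and f: "linear_map K A B f"
    and fm: "\<And>x y. \<lbrakk>x \<in> carrier A; y \<in> carrier A\<rbrakk> \<Longrightarrow> f (x \<otimes>\<^bsub>A\<^esub> y) = f x \<otimes>\<^bsub>B\<^esub> f y"
  obtains h where "nijenhuis_hom K N P B Q h" "\<And>a. a \<in> carrier A \<Longrightarrow> h (j a) = f a"
proof -
  interpret B: nijenhuis_algebra K B Q by fact
  note Bm = B.module_axioms
  let ?el = "eval_letter B Q f" and ?ev = "eval_word B Q f"
  have Qc: "b \<in> carrier B \<Longrightarrow> Q b \<in> carrier B" for b by (rule linear_map_closed[OF B.op_linear])
  \<comment> \<open>Letters and words are treated in one induction, since a bracket is evaluated
    through a smaller word.\<close>
  have ev: "?ev w \<in> carrier B \<and> set (map ?el w) \<subseteq> carrier B" if "w \<in> W" for w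
    using that
  proof (induction "size_list size w" arbitrary: w rule: less_induct)
    case less
    have "?el a \<in> carrier B" if a: "a \<in> set w" for a
    proof (cases a)
      case (Gen x)
      then show ?thesis
        using words_lettersD[OF less.prems a] linear_map_closed[OF f basis_closed] by simp
    next
      case (Br u)
      then have u: "u \<in> W" using words_lettersD[OF less.prems a] by simp
      have "size a < size_list size w"
        using a by (induction w) auto
      then have "?ev u \<in> carrier B" using u Br less.hyps[of u] by simp
      then show ?thesis using Br Qc by simp
    qed
    then show ?case using B.list_mult_closed[of "map ?el w"] by auto
  qed
  note evc = ev[THEN conjunct1] and elc = ev[THEN conjunct2]
  define h where "h = lin_ext K B ?ev"
  have h: "linear_map K F B h" unfolding h_def by (rule linear_map_lin_ext[OF Bm], rule evc)
  have hd: "h (delta K w) = ?ev w" if "w \<in> W" for w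
    unfolding h_def by (rule lin_ext_delta[OF Bm], rule evc[OF that])
  have hj: "h (j a) = f a" if "a \<in> carrier A" for a
    by (rule basis_eqI[OF Bm linear_map_comp[OF h emb_linear] f _ that]) (simp add: emb_basis hd)
  have hP: "h (P p) = Q (h p)" if "p \<in> carrier F" for p
    by (rule free_mod_eqI[OF Bm linear_map_comp[OF h op_linear'] linear_map_comp[OF B.op_linear h] that])
      (simp add: op_word hd)
  have ev_append: "?ev (u @ v) = ?ev u \<otimes>\<^bsub>B\<^esub> ?ev v" if "u \<in> W" "v \<in> W" for u v
    using that B.list_mult_append[OF _ _ elc elc, of u v] by (simp add: words_iff)
  have hw: "h (wp u v) = ?ev u \<otimes>\<^bsub>B\<^esub> ?ev v" if "u \<in> W" "v \<in> W" for u v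
    using that
  proof (induction "size_list size u + size_list size v" arbitrary: u v rule: less_induct)
    case less
    note uv = less.prems
    obtain u' a where u: "u = u' @ [a]" using uv(1) by (cases u rule: rev_cases) (auto simp: words_iff)
    obtain b v' where v: "v = b # v'" using uv(2) by (cases v) (auto simp: words_iff)
    have u': "u' @ [a] \<in> W" and v': "b # v' \<in> W" using uv u v by simp_all
    note ab = words_split_letters[OF u' v']
    have ela: "?el a \<in> carrier B" "?el b \<in> carrier B" "set (map ?el u') \<subseteq> carrier B" "set (map ?el v') \<subseteq> carrier B"
      using elc[OF uv(1)] elc[OF uv(2)] u v by simp_all
    show ?case
    proof (cases "is_gen a = is_gen b")
      case False
      then have ne: "is_gen (last u) \<noteq> is_gen (hd v)" using u v by simp
      show ?thesis
        unfolding word_prod_concat[OF uv ne] hd[OF words_append[OF uv ne]] by (rule ev_append[OF uv])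
    next
      case True
      have lab: "h (lp a b) = ?el a \<otimes>\<^bsub>B\<^esub> ?el b"
      proof (cases b)
        case (Gen y)
        then obtain x where "a = Gen x" using True by (cases a) simp_all
        then show ?thesis
          using Gen ab basis_closed by (simp add: hj mult_closed fm)
      next
        case (Br z)
        then obtain x where x: "a = Br x" using True by (cases a) simp_all
        have xz: "x \<in> W" "z \<in> W" "[Br x] \<in> W" "[Br z] \<in> W" using ab x Br by simp_all
        note c = op_closed[OF word_prod_closed[OF xz(3,2)]] op_closed[OF word_prod_closed[OF xz(1,4)]]
          op_closed[OF op_closed[OF word_prod_closed[OF xz(1,2)]]]
        interpret F: module K F by (rule free_module)
        have IH: "h (wp [Br x] z) = Q (?ev x) \<otimes>\<^bsub>B\<^esub> ?ev z" "h (wp x [Br z]) = ?ev x \<otimes>\<^bsub>B\<^esub> Q (?ev z)"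
          "h (wp x z) = ?ev x \<otimes>\<^bsub>B\<^esub> ?ev z"
          using less.hyps[of "[Br x]" z] less.hyps[of x "[Br z]"] less.hyps[of x z] xz u v x Br by simp_all
        have "h (lp a b) = h (P (wp [Br x] z)) \<oplus>\<^bsub>B\<^esub> h (P (wp x [Br z])) \<ominus>\<^bsub>B\<^esub> h (P (P (wp x z)))"
          using c by (simp add: x Br linear_map_minus[OF free_module Bm h] linear_map_add[OF h])
        also have "\<dots> = Q (Q (?ev x) \<otimes>\<^bsub>B\<^esub> ?ev z) \<oplus>\<^bsub>B\<^esub> Q (?ev x \<otimes>\<^bsub>B\<^esub> Q (?ev z)) \<ominus>\<^bsub>B\<^esub> Q (Q (?ev x \<otimes>\<^bsub>B\<^esub> ?ev z))"
          using xz by (simp add: hP op_closed word_prod_closed IH)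
        also have "\<dots> = Q (?ev x) \<otimes>\<^bsub>B\<^esub> Q (?ev z)"
          by (rule B.nijenhuis[OF evc evc, symmetric]) (fact xz)+
        finally show ?thesis by (simp add: x Br)
      qed
      \<comment> \<open>\<open>?H\<close> puts one factor between the values of the outer letters.
        At the junction only single letters occur here, so evaluating after splicing is
        \<open>?H\<close> applied to the value of that letter, and linearity extends this to the
        product of \<open>a\<close> and \<open>b\<close>.\<close>
      let ?H = "\<lambda>y. list_mult B (map ?el u' @ [y] @ map ?el v')"
      have H: "linear_map K B B ?H"
        by (rule B.list_mult_multilinear[OF Bm linear_map_id ela(3,4)])
      note q = letter_prod_closed[OF ab]
      have s: "s \<in> W" if "s \<in> joint_words X a b" for s using that joint_words_subset[OF ab] by blast
      have "h (wp u v) = h (lin_ext K F (\<lambda>s. delta K (u' @ s @ v')) (lp a b))"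
        unfolding u v word_prod_snoc_Cons ..
      also have "\<dots> = lin_ext K B (\<lambda>s. h (delta K (u' @ s @ v'))) (lp a b)"
        by (rule linear_map_lin_ext_eq[OF free_module Bm h splice_in[OF u' v'] q])
      also have "\<dots> = lin_ext K B (\<lambda>s. ?H (h (delta K s))) (lp a b)"
      proof (rule lin_ext_cong[OF Bm q])
        fix s assume sj: "s \<in> joint_words X a b"
        show "h (delta K (u' @ s @ v')) \<in> carrier B"
          by (rule linear_map_closed[OF h splice_in[OF u' v' sj]])
        obtain d where "s = [d]" using sj joint_words_same[OF True] by blast
        then show "h (delta K (u' @ s @ v')) = ?H (h (delta K s))"
          using hd[OF joint_words_splice[OF u' v' sj]] hd[OF s[OF sj]] by simp
      qed
      also have "\<dots> = ?H (h (lp a b))"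
        using linear_map_free_mod[OF Bm linear_map_comp[OF H h] letter_prod_closed'[OF ab]] by simp
      \<comment> \<open>The value at the junction is a product of two letter values; associativity
        of \<open>B\<close> splits it into two entries of the list.\<close>
      also have "\<dots> = list_mult B ((map ?el u' @ [?el a]) @ (?el b # map ?el v'))"
      proof -
        have "list_mult B ([?el a \<otimes>\<^bsub>B\<^esub> ?el b] @ map ?el v') = list_mult B ([?el a] @ ?el b # map ?el v')"
          using ela by (cases v') (simp_all add: B.list_mult_Cons B.mult_assoc B.list_mult_closed)
        then show ?thesis
          unfolding lab using ela by (cases u')
            (simp_all add: B.list_mult_append[of "_ # _" "_ # _", unfolded append_Cons] B.mult_closed
              del: list_mult.simps)
      qed
      also have "\<dots> = ?ev u \<otimes>\<^bsub>B\<^esub> ?ev v"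
        unfolding u v using ela by (subst B.list_mult_append) simp_all
      finally show ?thesis .
    qed
  qed
  have hm: "h (p \<diamond> q) = h p \<otimes>\<^bsub>B\<^esub> h q" if p: "p \<in> carrier F" and q: "q \<in> carrier F" for p q
  proof (rule bilinear_eqI[where f = "\<lambda>p q. h (p \<diamond> q)" and g = "\<lambda>p q. h p \<otimes>\<^bsub>B\<^esub> h q", OF Bm _ _ _ _ _ p q])
    fix q assume q: "q \<in> carrier F"
    show "linear_map K F B (\<lambda>p. h (p \<diamond> q))" by (rule linear_map_comp[OF h nij_mult_left[OF q]])
    show "linear_map K F B (\<lambda>p. h p \<otimes>\<^bsub>B\<^esub> h q)"
      by (rule linear_map_comp[OF B.linear_mult_left[OF linear_map_closed[OF h q]] h])
  next
    fix u assume u: "u \<in> W"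
    note d = delta_in[OF u]
    show "linear_map K F B (\<lambda>q. h (delta K u \<diamond> q))" by (rule linear_map_comp[OF h nij_mult_right[OF d]])
    show "linear_map K F B (\<lambda>q. h (delta K u) \<otimes>\<^bsub>B\<^esub> h q)"
      by (rule linear_map_comp[OF B.linear_mult_right[OF linear_map_closed[OF h d]] h])
    fix v assume "v \<in> W"
    then show "h (delta K u \<diamond> delta K v) = h (delta K u) \<otimes>\<^bsub>B\<^esub> h (delta K v)"
      using u by (simp add: nij_mult_delta hw hd)
  qed
  show ?thesis
  proof (rule that)
    show "nijenhuis_hom K N P B Q h"
      unfolding nijenhuis_hom_def linear_nij nij_simps(1) using h hm hP by blast
  qed (rule hj)
qed

end

section \<open>The enveloping algebra\<close>

lemma nijenhuis_ideal_hull: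
  assumes A: "nijenhuis_algebra K A P" and G: "G \<subseteq> carrier A"
  shows "nijenhuis_ideal K A P (nijenhuis_ideal K A P hull G)"
proof -
  interpret A: nijenhuis_algebra K A P by fact
  let ?J = "nijenhuis_ideal K A P hull G"
  have carrier: "nijenhuis_ideal K A P (carrier A)"
    unfolding nijenhuis_ideal_def
    using A.carrier_is_submodule A.mult_closed linear_map_closed[OF A.op_linear] by blast
  have sub: "?J \<subseteq> H" if "nijenhuis_ideal K A P H" "G \<subseteq> H" for H
    using that by (intro hull_minimal)
  have memI: "a \<in> ?J" if "\<And>H. \<lbrakk>nijenhuis_ideal K A P H; G \<subseteq> H\<rbrakk> \<Longrightarrow> a \<in> H" for a
    using that unfolding hull_def by blast
  have D: "submodule H K A" "\<And>x. x \<in> H \<Longrightarrow> P x \<in> H"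
    "\<And>a x. \<lbrakk>a \<in> carrier A; x \<in> H\<rbrakk> \<Longrightarrow> a \<otimes>\<^bsub>A\<^esub> x \<in> H" "\<And>a x. \<lbrakk>a \<in> carrier A; x \<in> H\<rbrakk> \<Longrightarrow> x \<otimes>\<^bsub>A\<^esub> a \<in> H"
    if "nijenhuis_ideal K A P H" for H
    using that by (auto simp: nijenhuis_ideal_def)
  have "submodule ?J K A"
  proof (rule A.submoduleI)
    show "?J \<subseteq> carrier A" by (rule sub[OF carrier G])
    show "\<zero>\<^bsub>A\<^esub> \<in> ?J"
      by (rule memI) (simp add: D(1)[THEN submodule.axioms(1), THEN subgroup.one_closed, simplified])
    show "\<ominus>\<^bsub>A\<^esub> a \<in> ?J" if "a \<in> ?J" for a
      using that sub by (intro memI) (blast intro: A.submoduleE(3)[OF D(1)])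
    show "a \<oplus>\<^bsub>A\<^esub> b \<in> ?J" if "a \<in> ?J" "b \<in> ?J" for a b
      using that sub by (intro memI) (blast intro: A.submoduleE(5)[OF D(1)])
    show "c \<odot>\<^bsub>A\<^esub> a \<in> ?J" if "c \<in> carrier K" "a \<in> ?J" for c a
      using that sub by (intro memI) (blast intro: A.submoduleE(4)[OF D(1)])
  qed
  moreover have "a \<otimes>\<^bsub>A\<^esub> x \<in> ?J" "x \<otimes>\<^bsub>A\<^esub> a \<in> ?J" if "a \<in> carrier A" "x \<in> ?J" for a x
    using that sub by (intro memI, blast intro: D(3,4))+
  moreover have "P x \<in> ?J" if "x \<in> ?J" for x
    using that sub by (intro memI) (blast intro: D(2))
  ultimately show ?thesis
    unfolding nijenhuis_ideal_def by blast
qed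

text \<open>Minimality of a generated ideal is exploited through this: if \<open>h\<close> kills the
  generators, the whole ideal lies in the kernel.\<close>

lemma nijenhuis_ideal_kernel:
  assumes A: "nijenhuis_algebra K A P" and B: "nijenhuis_algebra K B Q" and h: "nijenhuis_hom K A P B Q h"
  shows "nijenhuis_ideal K A P {x \<in> carrier A. h x = \<zero>\<^bsub>B\<^esub>}"
proof -
  interpret A: nijenhuis_algebra K A P by fact
  interpret B: nijenhuis_algebra K B Q by fact
  note hD = nijenhuis_homD[OF h]
  note Bm = B.module_axioms
  have "submodule {x \<in> carrier A. h x \<in> {\<zero>\<^bsub>B\<^esub>}} K A"
    by (rule submodule_vimage[OF A.module_axioms Bm submodule_zero[OF Bm] hD(1)])
  then show ?thesis
    using linear_map_zero[OF Bm Bm B.linear_mult_right] linear_map_zero[OF Bm Bm B.linear_mult_left]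
      linear_map_zero[OF Bm Bm B.op_linear] linear_map_closed[OF hD(1)] linear_map_closed[OF A.op_linear]
    by (auto simp: nijenhuis_ideal_def A.mult_closed hD(2,3))
qed

lemma nijenhuis_hom_comp:
  assumes g: "nijenhuis_hom K U R B Q g" and h: "nijenhuis_hom K A P U R h"
  shows "nijenhuis_hom K A P B Q (\<lambda>x. g (h x))"
  unfolding nijenhuis_hom_def
  using linear_map_comp[OF nijenhuis_homD(1)[OF g] nijenhuis_homD(1)[OF h]]
    linear_map_closed[OF nijenhuis_homD(1)[OF h]] nijenhuis_homD(2,3)[OF g] nijenhuis_homD(2,3)[OF h]
  by simp

locale ns_envelope = ns_algebra K M lop rop bop + tensor: algebra_with_basis K "tensor_algebra K M" X
  for K :: "('k, 'y) ring_scheme" (structure) and M :: "('k, 'm, 'z) module_scheme" (structure)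
    and lop rop bop :: "'m \<Rightarrow> 'm \<Rightarrow> 'm" and X :: "(nat \<Rightarrow> ('m list \<Rightarrow> 'k) set) set"
begin

abbreviation "TM \<equiv> tensor_algebra K M"
abbreviation "FN \<equiv> tensor_nij K M X"
abbreviation "FP \<equiv> word_op K X"
abbreviation "incl \<equiv> ns_inj K M X"
abbreviation "emb \<equiv> alg_emb K TM X"
abbreviation "J \<equiv> env_ideal K M lop rop bop X"
abbreviation "U \<equiv> env_alg K M lop rop bop X"
abbreviation "UP \<equiv> env_op K M lop rop bop X"
abbreviation "proj x \<equiv> J +>\<^bsub>FN\<^esub> x"

lemma FN_nijenhuis: "nijenhuis_algebra K FN FP"
  unfolding tensor_nij_def by (rule tensor.free_nijenhuis_algebra)

lemmas FN_hom_eq = tensor.free_nijenhuis_hom_eq[folded tensor_nij_def]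

sublocale FN: nijenhuis_algebra K FN FP by (rule FN_nijenhuis)

lemma singleton_tuple: "x \<in> carrier M \<Longrightarrow> [x] \<in> nonempty_tuples M"
  by (simp add: nonempty_tuples_def)

lemma emb_linear: "linear_map K TM FN emb"
  unfolding tensor_nij_def tensor.linear_nij by (rule tensor.emb_linear)

lemma emb_mult: "\<lbrakk>s \<in> carrier TM; t \<in> carrier TM\<rbrakk> \<Longrightarrow> emb s \<otimes>\<^bsub>FN\<^esub> emb t = emb (s \<otimes>\<^bsub>TM\<^esub> t)"
  unfolding tensor_nij_def by (rule tensor.emb_mult)

lemma incl_linear: "linear_map K M FN incl"
  unfolding ns_inj_def by (rule linear_map_comp[OF emb_linear pure_tensor_singleton_linear])

lemma incl_closed: "x \<in> carrier M \<Longrightarrow> incl x \<in> carrier FN"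
  by (rule linear_map_closed[OF incl_linear])

text \<open>The third family of generators involves a tensor of degree two. As a product of tensors
  of degree one it becomes a product of included elements, which both the quotient map and the
  extension of f can handle.\<close>

lemma emb_pair:
  assumes "x \<in> carrier M" "y \<in> carrier M"
  shows "emb (pure_tensor K M [x, y]) = incl x \<otimes>\<^bsub>FN\<^esub> incl y"
  using pure_tensor_append[OF singleton_tuple singleton_tuple, OF assms]
    emb_mult[OF pure_tensor_closed pure_tensor_closed, OF singleton_tuple singleton_tuple, OF assms]
  by (simp add: ns_inj_def)

lemma ops_closed:
  assumes "x \<in> carrier M" "y \<in> carrier M"
  shows "lop x y \<in> carrier M" "rop x y \<in> carrier M" "bop x y \<in> carrier M"
  using linear_map_closed[OF bilinear_opD(1)[OF lop_bilinear assms(1)] assms(2)]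
    linear_map_closed[OF bilinear_opD(1)[OF rop_bilinear assms(1)] assms(2)]
    linear_map_closed[OF bilinear_opD(1)[OF bop_bilinear assms(1)] assms(2)] .

lemma op_closed: "p \<in> carrier FN \<Longrightarrow> FP p \<in> carrier FN"
  by (rule linear_map_closed[OF FN.op_linear])

lemma env_gens_eq:
  "env_gens K M lop rop bop X =
    {incl (lop x y) \<ominus>\<^bsub>FN\<^esub> (incl x \<otimes>\<^bsub>FN\<^esub> FP (incl y)) | x y. x \<in> carrier M \<and> y \<in> carrier M} \<union>
    {incl (rop x y) \<ominus>\<^bsub>FN\<^esub> (FP (incl x) \<otimes>\<^bsub>FN\<^esub> incl y) | x y. x \<in> carrier M \<and> y \<in> carrier M} \<union>
    {incl (bop x y) \<oplus>\<^bsub>FN\<^esub> FP (incl x \<otimes>\<^bsub>FN\<^esub> incl y) | x y. x \<in> carrier M \<and> y \<in> carrier M}"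
proof -
  have "{incl (bop x y) \<oplus>\<^bsub>FN\<^esub> FP (emb (pure_tensor K M [x, y])) | x y. x \<in> carrier M \<and> y \<in> carrier M}
    = {incl (bop x y) \<oplus>\<^bsub>FN\<^esub> FP (incl x \<otimes>\<^bsub>FN\<^esub> incl y) | x y. x \<in> carrier M \<and> y \<in> carrier M}"
    using emb_pair by (metis (no_types, opaque_lifting))
  then show ?thesis unfolding env_gens_def Let_def by simp
qed

lemma env_gens_closed: "env_gens K M lop rop bop X \<subseteq> carrier FN"
  unfolding env_gens_eq
  by (auto intro!: FN.M.minus_closed FN.M.a_closed FN.mult_closed op_closed incl_closed ops_closed)

lemma J_ideal: "nijenhuis_ideal K FN FP J"
  unfolding env_ideal_def by (rule nijenhuis_ideal_hull[OF FN_nijenhuis env_gens_closed])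

lemma J_submodule: "submodule J K FN"
  using J_ideal by (simp add: nijenhuis_ideal_def)

lemma gens_in_J:
  assumes "x \<in> carrier M" "y \<in> carrier M"
  shows "incl (lop x y) \<ominus>\<^bsub>FN\<^esub> (incl x \<otimes>\<^bsub>FN\<^esub> FP (incl y)) \<in> J"
    and "incl (rop x y) \<ominus>\<^bsub>FN\<^esub> (FP (incl x) \<otimes>\<^bsub>FN\<^esub> incl y) \<in> J"
    and "incl (bop x y) \<oplus>\<^bsub>FN\<^esub> FP (incl x \<otimes>\<^bsub>FN\<^esub> incl y) \<in> J"
  using assms unfolding env_ideal_def env_gens_eq by (intro hull_inc; blast)+

lemma proj_hom: "nijenhuis_hom K FN FP U UP (\<lambda>x. proj x)"
  unfolding env_alg_def env_op_def by (rule nijenhuis_quotient(1)[OF FN_nijenhuis J_ideal])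

lemma proj_surj: "(\<lambda>x. proj x) ` carrier FN = carrier U"
  unfolding env_alg_def by (rule quot_alg_simps(1)[symmetric])

lemma U_nijenhuis: "nijenhuis_algebra K U UP"
  unfolding env_alg_def env_op_def by (rule nijenhuis_quotient(2)[OF FN_nijenhuis J_ideal])

lemma proj_eqI: "\<lbrakk>p \<in> carrier FN; q \<in> carrier FN; p \<ominus>\<^bsub>FN\<^esub> q \<in> J\<rbrakk> \<Longrightarrow> proj p = proj q"
  using a_coset_eq_iff[OF FN.module_axioms J_submodule] by blast

text \<open>Each of the three families of generators says that one of the operations is matched
  modulo \<open>J\<close>.\<close>

lemma env_map_hom:
  "ns_hom K M lop rop bop U (nij_lop U UP) (nij_rop U UP) (nij_bop U UP) (env_map K M lop rop bop X)"
proof -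
  interpret U: nijenhuis_algebra K U UP by (rule U_nijenhuis)
  note proj = nijenhuis_homD(2,3)[OF proj_hom, symmetric]
  have map: "env_map K M lop rop bop X = (\<lambda>x. proj (incl x))"
    by (simp add: env_map_def fun_eq_iff)
  show ?thesis
    unfolding ns_hom_def map
  proof (intro conjI ballI)
    show "linear_map K M U (\<lambda>x. proj (incl x))"
      by (rule linear_map_comp[OF nijenhuis_homD(1)[OF proj_hom] incl_linear])
    fix x y assume xy: "x \<in> carrier M" "y \<in> carrier M"
    note c = incl_closed[OF xy(1)] incl_closed[OF xy(2)] incl_closed[OF ops_closed(1)[OF xy]]
      incl_closed[OF ops_closed(2)[OF xy]] incl_closed[OF ops_closed(3)[OF xy]]
    note g = gens_in_J[OF xy]
    have "nij_lop U UP (proj (incl x)) (proj (incl y)) = proj (incl x \<otimes>\<^bsub>FN\<^esub> FP (incl y))"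
      unfolding nij_lop_def by (simp only: proj c op_closed)
    with proj_eqI[OF c(3) FN.mult_closed[OF c(1) op_closed[OF c(2)]] g(1)]
    show "proj (incl (lop x y)) = nij_lop U UP (proj (incl x)) (proj (incl y))" by simp
    have "nij_rop U UP (proj (incl x)) (proj (incl y)) = proj (FP (incl x) \<otimes>\<^bsub>FN\<^esub> incl y)"
      unfolding nij_rop_def by (simp only: proj c op_closed)
    with proj_eqI[OF c(4) FN.mult_closed[OF op_closed[OF c(1)] c(2)] g(2)]
    show "proj (incl (rop x y)) = nij_rop U UP (proj (incl x)) (proj (incl y))" by simp
    note m = op_closed[OF FN.mult_closed[OF c(1,2)]]
    have "nij_bop U UP (proj (incl x)) (proj (incl y)) = \<ominus>\<^bsub>U\<^esub> proj (FP (incl x \<otimes>\<^bsub>FN\<^esub> incl y))"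
      unfolding nij_bop_def by (simp only: proj c FN.mult_closed)
    also have "\<dots> = proj (\<ominus>\<^bsub>FN\<^esub> FP (incl x \<otimes>\<^bsub>FN\<^esub> incl y))"
      by (rule linear_map_uminus[OF FN.module_axioms U.module_axioms nijenhuis_homD(1)[OF proj_hom] m, symmetric])
    \<comment> \<open>The third family consists of sums because \<open>nij_bop\<close> carries a
      minus sign: subtracting the negative gives back the generator.\<close>
    also have "\<dots> = proj (incl (bop x y))"
      using g(3) c m by (intro proj_eqI[symmetric]) (simp_all add: a_minus_def)
    finally show "proj (incl (bop x y)) = nij_bop U UP (proj (incl x)) (proj (incl y))" by (rule sym)
  qed
qed

lemma env_lift:
  assumes B: "nijenhuis_algebra K B Q"
    and f: "ns_hom K M lop rop bop B (nij_lop B Q) (nij_rop B Q) (nij_bop B Q) f"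
  shows "\<exists>g. g \<in> extensional (carrier U) \<and> nijenhuis_hom K U UP B Q g \<and>
    (\<forall>x\<in>carrier M. g (env_map K M lop rop bop X x) = f x)"
proof -
  interpret B: nijenhuis_algebra K B Q by fact
  have fl: "linear_map K M B f" using f by (simp add: ns_hom_def)
  have fops: "f (lop x y) = f x \<otimes>\<^bsub>B\<^esub> Q (f y)" "f (rop x y) = Q (f x) \<otimes>\<^bsub>B\<^esub> f y"
    "f (bop x y) = \<ominus>\<^bsub>B\<^esub> Q (f x \<otimes>\<^bsub>B\<^esub> f y)" if "x \<in> carrier M" "y \<in> carrier M" for x y
    using f that by (simp_all add: ns_hom_def nij_lop_def nij_rop_def nij_bop_def)
  obtain \<phi> where \<phi>: "linear_map K TM B \<phi>"
      "\<And>x y. \<lbrakk>x \<in> carrier TM; y \<in> carrier TM\<rbrakk> \<Longrightarrow> \<phi> (x \<otimes>\<^bsub>TM\<^esub> y) = \<phi> x \<otimes>\<^bsub>B\<^esub> \<phi> y"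
      "\<And>x. x \<in> carrier M \<Longrightarrow> \<phi> (pure_tensor K M [x]) = f x"
    using tensor_algebra_lift[OF B.nonunital_algebra_axioms fl] by blast
  obtain h where h: "nijenhuis_hom K FN FP B Q h" and h\<phi>: "\<And>t. t \<in> carrier TM \<Longrightarrow> h (emb t) = \<phi> t"
    unfolding tensor_nij_def using tensor.free_nijenhuis_lift[OF B \<phi>(1,2)] by blast
  have hi: "h (incl x) = f x" if "x \<in> carrier M" for x
    using h\<phi>[OF pure_tensor_closed[OF singleton_tuple[OF that]]] \<phi>(3)[OF that] by (simp add: ns_inj_def)
  note hD = nijenhuis_homD[OF h]
  note fc = linear_map_closed[OF fl] and Qc = linear_map_closed[OF B.op_linear]
  note hminus = linear_map_minus[OF FN.module_axioms B.module_axioms hD(1)]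
  \<comment> \<open>For each family the corresponding homomorphism equation of \<open>f\<close>,
    read through the operations induced by \<open>Q\<close>, says that the two terms of the
    generator cancel under \<open>h\<close>.\<close>
  have gens: "h g = \<zero>\<^bsub>B\<^esub>" if "g \<in> env_gens K M lop rop bop X" for g
    using that unfolding env_gens_eq
  proof (elim UnE CollectE exE conjE)
    fix x y assume xy: "x \<in> carrier M" "y \<in> carrier M"
    note c = incl_closed[OF xy(1)] incl_closed[OF xy(2)] ops_closed[OF xy] incl_closed[OF ops_closed(1)[OF xy]]
      incl_closed[OF ops_closed(2)[OF xy]] incl_closed[OF ops_closed(3)[OF xy]]
    {
      assume "g = incl (lop x y) \<ominus>\<^bsub>FN\<^esub> (incl x \<otimes>\<^bsub>FN\<^esub> FP (incl y))"
      then show ?thesis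
        using xy by (simp add: hminus hD(2,3) c hi op_closed FN.mult_closed fops B.M.a_minus_eq_zero_iff
            B.mult_closed fc Qc)
    next
      assume "g = incl (rop x y) \<ominus>\<^bsub>FN\<^esub> (FP (incl x) \<otimes>\<^bsub>FN\<^esub> incl y)"
      then show ?thesis
        using xy by (simp add: hminus hD(2,3) c hi op_closed FN.mult_closed fops B.M.a_minus_eq_zero_iff
            B.mult_closed fc Qc)
    next
      assume "g = incl (bop x y) \<oplus>\<^bsub>FN\<^esub> FP (incl x \<otimes>\<^bsub>FN\<^esub> incl y)"
      then show ?thesis
        using xy by (simp add: linear_map_add[OF hD(1)] hD(2,3) c hi op_closed FN.mult_closed fops B.M.l_neg
            B.mult_closed fc Qc)
    }
  qed
  \<comment> \<open>The kernel of \<open>h\<close> is a Nijenhuis ideal containing the generators,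
    and \<open>J\<close> is the smallest such ideal.\<close>
  have "J \<subseteq> {p \<in> carrier FN. h p = \<zero>\<^bsub>B\<^esub>}"
    unfolding env_ideal_def
  proof (rule hull_minimal)
    show "nijenhuis_ideal K FN FP {p \<in> carrier FN. h p = \<zero>\<^bsub>B\<^esub>}"
      by (rule nijenhuis_ideal_kernel[OF FN_nijenhuis B h])
  qed (use gens env_gens_closed in blast)
  then have ker: "h p = \<zero>\<^bsub>B\<^esub>" if "p \<in> J" for p using that by blast
  have eq: "h p = h q" if p: "p \<in> carrier FN" and q: "q \<in> carrier FN" and pq: "proj p = proj q" for p q
  proof -
    have "p \<ominus>\<^bsub>FN\<^esub> q \<in> J" using a_coset_eq_iff[OF FN.module_axioms J_submodule p q] pq by blast
    then have "h p \<ominus>\<^bsub>B\<^esub> h q = \<zero>\<^bsub>B\<^esub>" using ker hminus[OF p q] by simp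
    then show ?thesis using B.M.a_minus_eq_zero_iff linear_map_closed[OF hD(1)] p q by blast
  qed
  obtain g where ge: "g \<in> extensional (carrier U)" and g: "\<And>p. p \<in> carrier FN \<Longrightarrow> g (proj p) = h p"
    by (rule factor_through_surj[where p = "\<lambda>x. proj x" and h = h, OF proj_surj])
      (erule (2) eq, rule that)
  have "nijenhuis_hom K U UP B Q g"
    by (rule nijenhuis_hom_factor[OF proj_hom proj_surj h _ FN_nijenhuis], rule g)
  moreover have "g (env_map K M lop rop bop X x) = f x" if "x \<in> carrier M" for x
    unfolding env_map_def g[OF incl_closed[OF that]] by (rule hi[OF that])
  ultimately show ?thesis using ge by blast
qed

text \<open>Composing with the quotient map gives homomorphisms on \<open>FN\<close>, which are
  determined on embedded tensors and these in turn on \<open>M\<close>. Surjectivity of the quotient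
  map brings the equality back to \<open>U\<close>.\<close>

lemma env_hom_unique:
  assumes B: "nijenhuis_algebra K B Q"
    and g: "g \<in> extensional (carrier U)" "nijenhuis_hom K U UP B Q g"
    and h: "h \<in> extensional (carrier U)" "nijenhuis_hom K U UP B Q h"
    and eq: "\<And>x. x \<in> carrier M \<Longrightarrow> g (env_map K M lop rop bop X x) = h (env_map K M lop rop bop X x)"
  shows "g = h"
proof (rule extensionalityI[OF g(1) h(1)])
  interpret B: nijenhuis_algebra K B Q by fact
  note gp = nijenhuis_hom_comp[OF g(2) proj_hom] and hp = nijenhuis_hom_comp[OF h(2) proj_hom]
  note gpD = nijenhuis_homD[OF gp] and hpD = nijenhuis_homD[OF hp]
  note embc = linear_map_closed[OF emb_linear]
  have T: "g (proj (emb t)) = h (proj (emb t))" if "t \<in> carrier TM" for t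
  proof (rule tensor_algebra_hom_eq[where g = "\<lambda>t. g (proj (emb t))" and h = "\<lambda>t. h (proj (emb t))",
        OF B.module_axioms _ _ _ _ _ that])
    show "linear_map K TM B (\<lambda>t. g (proj (emb t)))" by (rule linear_map_comp[OF gpD(1) emb_linear])
    show "linear_map K TM B (\<lambda>t. h (proj (emb t)))" by (rule linear_map_comp[OF hpD(1) emb_linear])
    show "g (proj (emb (x \<otimes>\<^bsub>TM\<^esub> y))) = g (proj (emb x)) \<otimes>\<^bsub>B\<^esub> g (proj (emb y))"
      "h (proj (emb (x \<otimes>\<^bsub>TM\<^esub> y))) = h (proj (emb x)) \<otimes>\<^bsub>B\<^esub> h (proj (emb y))"
      if "x \<in> carrier TM" "y \<in> carrier TM" for x y
      using gpD(2)[OF embc embc, OF that] hpD(2)[OF embc embc, OF that] by (simp_all add: emb_mult[OF that])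
    show "g (proj (emb (pure_tensor K M [x]))) = h (proj (emb (pure_tensor K M [x])))"
      if "x \<in> carrier M" for x
      using eq[OF that] by (simp add: env_map_def ns_inj_def)
  qed
  have FNeq: "g (proj p) = h (proj p)" if "p \<in> carrier FN" for p
    by (rule FN_hom_eq[where g = "\<lambda>p. g (proj p)" and h = "\<lambda>p. h (proj p)",
          OF B.module_axioms gp hp _ that], rule T)
  fix u assume "u \<in> carrier U"
  then show "g u = h u" using FNeq unfolding proj_surj[symmetric] by blast
qed

end

theorem theorem3p4:
  fixes K :: "'k ring"
    and M :: "('k, 'm) module"
    and lop :: "'m \<Rightarrow> 'm \<Rightarrow> 'm" and rop :: "'m \<Rightarrow> 'm \<Rightarrow> 'm" and bop :: "'m \<Rightarrow> 'm \<Rightarrow> 'm"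
    and X :: "(nat \<Rightarrow> ('m list \<Rightarrow> 'k) set) set"
  assumes "field K"
    and "ns_algebra K M lop rop bop"
    and "is_basis K (tensor_algebra K M) X"
  shows
    "let U = env_alg K M lop rop bop X;
         P = env_op K M lop rop bop X;
         \<rho> = env_map K M lop rop bop X
     in nijenhuis_algebra K U P \<and>
        ns_hom K M lop rop bop U (nij_lop U P) (nij_rop U P) (nij_bop U P) \<rho> \<and>
        (\<forall>(N :: ('k, 'n) module) Q f.
          nijenhuis_algebra K N Q \<and>
          ns_hom K M lop rop bop N (nij_lop N Q) (nij_rop N Q) (nij_bop N Q) f \<longrightarrow>
          (\<exists>!g. g \<in> extensional (carrier U) \<and> nijenhuis_hom K U P N Q g \<and>
                (\<forall>x\<in>carrier M. g (\<rho> x) = f x)))"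
proof -
  interpret M: ns_algebra K M lop rop bop by fact
  \<comment> \<open>T(M) has to be known as an algebra before its basis \<open>X\<close> can
    instantiate the construction of bracketed words.\<close>
  interpret ns_envelope K M lop rop bop X
    by (intro ns_envelope.intro algebra_with_basis.intro algebra_with_basis_axioms.intro assms
        M.tensor_nonunital_algebra)
  show ?thesis
    unfolding Let_def
  proof (intro conjI allI impI U_nijenhuis env_map_hom)
    fix N :: "('k, 'n) module" and Q f
    assume "nijenhuis_algebra K N Q \<and>
      ns_hom K M lop rop bop N (nij_lop N Q) (nij_rop N Q) (nij_bop N Q) f"
    then have N: "nijenhuis_algebra K N Q"
      and f: "ns_hom K M lop rop bop N (nij_lop N Q) (nij_rop N Q) (nij_bop N Q) f" by simp_all
    show "\<exists>!g. g \<in> extensional (carrier U) \<and> nijenhuis_hom K U UP N Q g \<and>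
        (\<forall>x\<in>carrier M. g (env_map K M lop rop bop X x) = f x)"
      using env_lift[OF N f] env_hom_unique[OF N] by (intro ex_ex1I) auto
  qed
qed

end
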